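(* There exists a constant $C>0$, independent of $\alpha$ and $\lambda$, such that the following hold. (1) For every $\alpha\in\mathbb{R}$, every $\lambda\in\mathbb{R}$ and every $w\in D_1$ with $w\perp r^{3/2}g(r)$ in $L^2(\mathbb{R}_+,dr)$, $$\|\widetilde{\mathcal H}_1 w\|\ \ge\ C^{-1}|\beta_1|^{1/3}\,\|w\|.$$ (2) For every $\alpha\in\mathbb{R}$ with $|\beta_1|\ge 1$, there exist $\lambda\in\mathbb{R}$ and a nonzero $v\in D_1$ with $v\perp r^{3/2}g(r)$ in $L^2(\mathbb{R}_+,dr)$ such that $$\|\widetilde{\mathcal H}_1 v\|\ \le\ C|\beta_1|^{1/3}\,\|v\|.$$
   Context: $\|\cdot\|$ is the norm of the complex Hilbert space $L^2(\mathbb{R}_+,dr)$, $\mathbb{R}_+=(0,\infty)$. Put $$\sigma(r)=\frac{1-e^{-r^2/4}}{r^2/4},\qquad g(r)=e^{-r^2/8},\qquad \beta_1=\frac{\alpha}{8\pi},$$ $$\widetilde{\mathcal K}_1[h](r)=\frac12\int_0^{\infty}\min\Big(\frac rs,\frac sr\Big)(rs)^{1/2}h(s)\,ds .$$ For $\alpha,\lambda\in\mathbb{R}$ the operator $\widetilde{\mathcal H}_1=\widetilde{\mathcal H}_{1}(\alpha,\lambda)$ on $L^2(\mathbb{R}_+,dr)$ is $$\widetilde{\mathcal H}_1 w=-\partial_r^2w+\frac{3}{4r^2}w+\frac{r^2}{16}w-\frac12 w+i\beta_1\sigma(r)w-i\lambda w-i\beta_1\, g\,\widetilde{\mathcal K}_1[g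 w],$$ with domain $$D_1=\Big\{w\in L^2(\mathbb{R}_+,dr):\ r^{1/2}\partial_r^2(w/r^{1/2}),\ r^{1/2}\partial_r(w/r^{3/2}),\ r^2w\in L^2(\mathbb{R}_+,dr)\Big\}.$$ (When $\beta_1\neq0$ one writes $\lambda=\beta_1\nu_1$.) *)

theory Defs
  imports "HOL-Analysis.Analysis"
begin

text \<open>
  Elements of \<open>L\<^sup>2(\<real>\<^sub>+, dr)\<close> are represented by functions \<open>real \<Rightarrow> complex\<close>, Borel measurable on
  \<open>{0<..}\<close>, not by equivalence classes. Values outside \<open>{0<..}\<close> play no role, and every notion below
  is invariant under modification on a null set.
\<close>

definition L2_pos :: "(real \<Rightarrow> complex) set" where
  "L2_pos = {f. set_borel_measurable lborel {0<..} f \<and>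
                set_integrable lborel {0<..} (\<lambda>r. (cmod (f r))\<^sup>2)}"

definition l2norm :: "(real \<Rightarrow> complex) \<Rightarrow> real" where
  "l2norm f = sqrt (LINT r:{0<..}|lborel. (cmod (f r))\<^sup>2)"

definition l2inner :: "(real \<Rightarrow> complex) \<Rightarrow> (real \<Rightarrow> complex) \<Rightarrow> complex" where
  "l2inner f h = (LINT r:{0<..}|lborel. f r * cnj (h r))"

text \<open>
  \<open>C\<^sub>c\<^sup>\<infinity>(\<real>\<^sub>+)\<close>, extended by zero to the whole line. Real-valued test functions suffice for
  distributions with complex values, by linearity.
\<close>

definition test_fun :: "(real \<Rightarrow> real) \<Rightarrow> bool" where
  "test_fun \<phi> \<longleftrightarrow>
     (\<forall>n x. (deriv ^^ n) \<phi> field_differentiable (at x)) \<and>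
     compact (closure {x. \<phi> x \<noteq> 0}) \<and> closure {x. \<phi> x \<noteq> 0} \<subseteq> {0<..}"

definition loc_integrable_pos :: "(real \<Rightarrow> complex) \<Rightarrow> bool" where
  "loc_integrable_pos u \<longleftrightarrow> (\<forall>a b. 0 < a \<longrightarrow> set_integrable lborel {a..b} u)"

text \<open>
  The \<open>n\<close>-th derivative of \<open>u\<close> in the sense of distributions on \<open>\<real>\<^sub>+\<close> is the locally integrable
  function \<open>v\<close>.
\<close>

definition has_weak_deriv :: "nat \<Rightarrow> (real \<Rightarrow> complex) \<Rightarrow> (real \<Rightarrow> complex) \<Rightarrow> bool" where
  "has_weak_deriv n u v \<longleftrightarrow>
     loc_integrable_pos u \<and> loc_integrable_pos v \<and>
     (\<forall>\<phi>. test_fun \<phi> \<longrightarrow>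
        (LINT r:{0<..}|lborel. u r * complex_of_real ((deriv ^^ n) \<phi> r)) =
        (- 1) ^ n * (LINT r:{0<..}|lborel. v r * complex_of_real (\<phi> r)))"

text \<open>If a weak derivative exists it is unique up to a null set, so the choice is immaterial.\<close>

definition weak_deriv :: "nat \<Rightarrow> (real \<Rightarrow> complex) \<Rightarrow> real \<Rightarrow> complex" where
  "weak_deriv n u = (SOME v. has_weak_deriv n u v)"

definition sigma :: "real \<Rightarrow> real" where
  "sigma r = (1 - exp (- (r\<^sup>2 / 4))) / (r\<^sup>2 / 4)"

definition gauss :: "real \<Rightarrow> real" where
  "gauss r = exp (- (r\<^sup>2 / 8))"

definition beta1 :: "real \<Rightarrow> real" where
  "beta1 \<alpha> = \<alpha> / (8 * pi)"

definition K1 :: "(real \<Rightarrow> complex) \<Rightarrow> real \<Rightarrow> complex" where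
  "K1 h r = 1 / 2 * (LINT s:{0<..}|lborel.
      complex_of_real (min (r / s) (s / r) * (r * s) powr (1 / 2)) * h s)"

definition D1 :: "(real \<Rightarrow> complex) set" where
  "D1 = {w \<in> L2_pos.
      (\<exists>v. has_weak_deriv 2 (\<lambda>r. w r / complex_of_real (r powr (1 / 2))) v \<and>
           (\<lambda>r. complex_of_real (r powr (1 / 2)) * v r) \<in> L2_pos) \<and>
      (\<exists>v. has_weak_deriv 1 (\<lambda>r. w r / complex_of_real (r powr (3 / 2))) v \<and>
           (\<lambda>r. complex_of_real (r powr (1 / 2)) * v r) \<in> L2_pos) \<and>
      (\<lambda>r. complex_of_real (r\<^sup>2) * w r) \<in> L2_pos}"

text \<open>
  For \<open>w \<in> D1\<close> the weak second derivative of \<open>w\<close> exists and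
  \<open>H1 \<alpha> lam w \<in> L2_pos\<close>: with
  \<open>u = w / r\<^sup>1\<^sup>/\<^sup>2\<close> one has \<open>- w'' + 3 w / (4 r\<^sup>2) = - r\<^sup>1\<^sup>/\<^sup>2 (u'' + (u / r)')\<close>, although the two
  summands on the left need not be square integrable separately.
\<close>

definition H1 :: "real \<Rightarrow> real \<Rightarrow> (real \<Rightarrow> complex) \<Rightarrow> real \<Rightarrow> complex" where
  "H1 \<alpha> lam w r =
     - weak_deriv 2 w r
     + complex_of_real (3 / (4 * r\<^sup>2)) * w r
     + complex_of_real (r\<^sup>2 / 16) * w r
     - 1 / 2 * w r
     + \<i> * complex_of_real (beta1 \<alpha> * sigma r) * w r
     - \<i> * complex_of_real lam * w r
     - \<i> * complex_of_real (beta1 \<alpha>) * complex_of_real (gauss r)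
         * K1 (\<lambda>s. complex_of_real (gauss s) * w s) r"

definition orth_ground :: "(real \<Rightarrow> complex) \<Rightarrow> bool" where
  "orth_ground w \<longleftrightarrow> l2inner w (\<lambda>r. complex_of_real (r powr (3 / 2) * gauss r)) = 0"

end

theory Submission
  imports Defs
begin


text \<open>
  Write \<open>\<beta>\<close> for \<open>beta1 \<alpha>\<close> and \<open>ground\<close> for \<open>r powr (3 / 2) * gauss r\<close>. The operator is a radial harmonic
  oscillator plus \<open>\<i> * \<beta>\<close> times the multiplication by \<open>sigma\<close>, corrected by a nonlocal term, minus \<open>\<i> * lam\<close>.
  For a purely local skew part the bound follows from an energy argument, so the first task is to get
  rid of the nonlocal term.

  The function \<open>ground\<close> is an eigenfunction of the oscillator and spans the kernel of the skew part. Let \<open>J\<close>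
  and \<open>mass\<close> be the primitives of \<open>ground * w\<close> and of \<open>ground\<^sup>2\<close> from the origin. The Darboux (double
  commutation) transform \<open>T w = w - ground * J / mass\<close> is a contraction, and an isometry on the orthogonal
  complement of \<open>ground\<close> (\<open>transform_contraction\<close>, \<open>transform_isometry\<close>). It conjugates the oscillator to
  itself plus the positive potential \<open>darboux_pot\<close>. At the same time it conjugates the skew part to plain
  multiplication by \<open>sigma\<close>, because \<open>mass = - r ^ 3 * sigma'\<close>: up to a factor, \<open>T w\<close> is the second derivative with
  respect to the variable \<open>sigma\<close> of the stream function \<open>P\<close> of \<open>w\<close>, and the skew part sends \<open>P\<close> to a
  function whose second derivative in that variable is \<open>sigma\<close> times that of \<open>P\<close>. The conjugated equation is
  \<open>u1_deriv\<close>.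

  For the local operator let \<open>\<Gamma>\<close> be the ratio of the norms of right-hand side and solution. The real part of the
  energy identity shows that the solution varies on the length \<open>\<Gamma> powr (- 1 / 2)\<close> and lives on radii up to
  \<open>\<Gamma> powr (1 / 2)\<close>, up to constants. The imaginary part, tested with a regularised sign of \<open>sigma - lam / \<beta>\<close>,
  bounds the mean of \<open>\<bar>\<beta>\<bar> * \<bar>sigma - lam / \<beta>\<bar>\<close> by a multiple of \<open>\<Gamma>\<close>. Outside a thin strip around the
  critical radius \<open>\<bar>sigma - lam / \<beta>\<bar>\<close> is at least of order \<open>\<Gamma> powr (- 2)\<close>, because \<open>sigma\<close> decays with slope of order
  \<open>r powr (- 3)\<close>. Hence \<open>\<bar>\<beta>\<bar>\<close> is at most of order \<open>\<Gamma> ^ 3\<close> (\<open>resolvent_lower_bound\<close>).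

  The exponent is optimal at the radius \<open>b = \<bar>\<beta>\<bar> powr (1 / 6)\<close>, where a bump of width \<open>1 / b\<close> makes all terms of the
  operator of size \<open>b\<^sup>2\<close> for \<open>lam = \<beta> * sigma b\<close>, and where the nonlocal term is negligible due to its Gaussian
  factor. Two neighbouring bumps are combined to achieve orthogonality to \<open>ground\<close>.

  Domain elements are given through weak derivatives. By the lemma of du Bois-Reymond they have
  representatives that are absolutely continuous together with their first derivative
  (\<open>weak_deriv2_imp_ac_deriv\<close>), and for these all identities are obtained from the product rule
  \<open>ac_deriv_mult\<close>.
\<close>

section \<open>Absolutely continuous functions on the half-line\<close>

text \<open>Local absolute continuity with almost everywhere derivative \<open>f'\<close> is encoded as the fundamental theorem of
  calculus on compact subintervals: domain elements have second derivatives that are only locally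
  integrable, and the energy identities below use nothing but this formula and the product rule.\<close>

definition ac_deriv :: "(real \<Rightarrow> complex) \<Rightarrow> (real \<Rightarrow> complex) \<Rightarrow> bool" where
  "ac_deriv f f' \<longleftrightarrow> (\<forall>a b. 0 < a \<longrightarrow> a \<le> b \<longrightarrow>
     set_integrable lborel {a..b} f' \<and> f b - f a = (LINT x:{a..b}|lborel. f' x))"

lemma ac_derivD:
  assumes "ac_deriv f f'" "0 < a" "a \<le> b"
  shows "set_integrable lborel {a..b} f'" "(LINT x:{a..b}|lborel. f' x) = f b - f a"
  using assms unfolding ac_deriv_def by auto

lemma ac_deriv_C1:
  assumes d: "\<And>x. 0 < x \<Longrightarrow> (f has_vector_derivative f' x) (at x)"
    and c: "continuous_on {0<..} f'"
  shows "ac_deriv f f'"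
  unfolding ac_deriv_def
proof (intro allI impI conjI)
  fix a b :: real assume ab: "0 < a" "a \<le> b"
  have c': "continuous_on {a..b} f'" by (rule continuous_on_subset[OF c]) (use ab in auto)
  show "set_integrable lborel {a..b} f'" by (rule borel_integrable_atLeastAtMost'[OF c'])
  show "f b - f a = (LINT x:{a..b}|lborel. f' x)"
    unfolding set_lebesgue_integral_def
    by (rule integral_FTC_atLeastAtMost[symmetric, OF ab(2) _ c'])
       (use ab d in \<open>auto intro: has_vector_derivative_at_within\<close>)
qed

lemma ac_deriv_add:
  assumes f: "ac_deriv f f'" and g: "ac_deriv g g'"
  shows "ac_deriv (\<lambda>x. f x + g x) (\<lambda>x. f' x + g' x)"
  unfolding ac_deriv_def
proof (intro allI impI conjI)
  fix a b :: real assume ab: "0 < a" "a \<le> b"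
  note df = ac_derivD[OF f ab] and dg = ac_derivD[OF g ab]
  show "set_integrable lborel {a..b} (\<lambda>x. f' x + g' x)"
    by (rule set_integral_add(1)[OF df(1) dg(1)])
  show "(f b + g b) - (f a + g a) = (LINT x:{a..b}|lborel. f' x + g' x)"
    unfolding set_integral_add(2)[OF df(1) dg(1)] df(2) dg(2) by simp
qed

lemma ac_deriv_diff:
  assumes f: "ac_deriv f f'" and g: "ac_deriv g g'"
  shows "ac_deriv (\<lambda>x. f x - g x) (\<lambda>x. f' x - g' x)"
  unfolding ac_deriv_def
proof (intro allI impI conjI)
  fix a b :: real assume ab: "0 < a" "a \<le> b"
  note df = ac_derivD[OF f ab] and dg = ac_derivD[OF g ab]
  show "set_integrable lborel {a..b} (\<lambda>x. f' x - g' x)"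
    by (rule set_integral_diff(1)[OF df(1) dg(1)])
  show "(f b - g b) - (f a - g a) = (LINT x:{a..b}|lborel. f' x - g' x)"
    unfolding set_integral_diff(2)[OF df(1) dg(1)] df(2) dg(2) by simp
qed

lemma ac_deriv_cmult: "ac_deriv f f' \<Longrightarrow> ac_deriv (\<lambda>x. c * f x) (\<lambda>x. c * f' x)"
  unfolding ac_deriv_def by (auto simp: set_integral_mult_right simp flip: right_diff_distrib)

lemma ac_deriv_const: "ac_deriv (\<lambda>x. c) (\<lambda>x. 0)"
  unfolding ac_deriv_def set_integrable_def by auto

lemma ac_deriv_cnj:
  assumes "ac_deriv f f'"
  shows "ac_deriv (\<lambda>x. cnj (f x)) (\<lambda>x. cnj (f' x))"
  unfolding ac_deriv_def
proof (intro allI impI conjI)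
  fix a b :: real assume ab: "0 < a" "a \<le> b"
  note d = ac_derivD[OF assms ab]
  have eq: "(\<lambda>x. indicator {a..b} x *\<^sub>R cnj (f' x)) = (\<lambda>x. cnj (indicator {a..b} x *\<^sub>R f' x))"
    by (auto simp: indicator_def)
  show "set_integrable lborel {a..b} (\<lambda>x. cnj (f' x))"
    using integrable_cnj[OF d(1)[unfolded set_integrable_def]] unfolding set_integrable_def eq .
  show "cnj (f b) - cnj (f a) = (LINT x:{a..b}|lborel. cnj (f' x))"
    using d(2) integral_bounded_linear'[OF bounded_linear_cnj bounded_linear_cnj, of lborel "\<lambda>x. indicator {a..b} x *\<^sub>R f' x"]
    unfolding set_lebesgue_integral_def eq by (simp only: complex_cnj_diff complex_cnj_cnj simp_thms)
qed

lemma ac_deriv_cong: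
  assumes "ac_deriv f f'" "\<And>x. 0 < x \<Longrightarrow> f x = g x" "\<And>x. 0 < x \<Longrightarrow> f' x = g' x"
  shows "ac_deriv g g'"
  unfolding ac_deriv_def
proof (intro allI impI conjI)
  fix a b :: real assume ab: "0 < a" "a \<le> b"
  note d = ac_derivD[OF assms(1) ab]
  show "set_integrable lborel {a..b} g'"
    using d(1) by (subst set_integrable_cong[OF refl refl, of _ _ f']) (use ab assms in auto)
  show "g b - g a = (LINT x:{a..b}|lborel. g' x)"
    using d(2) ab assms(2)[of a] assms(2)[of b]
    by (subst set_lebesgue_integral_cong[of _ _ _ f']) (use assms in auto)
qed

text \<open>The base point 1 stays away from the singular endpoint 0.\<close>

definition primitive :: "(real \<Rightarrow> complex) \<Rightarrow> real \<Rightarrow> complex" where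
  "primitive h x = (if 1 \<le> x then (LINT t:{1..x}|lborel. h t) else - (LINT t:{x..1}|lborel. h t))"

lemma set_integral_Icc_split:
  fixes h :: "real \<Rightarrow> 'a :: {banach, second_countable_topology}"
  assumes "set_integrable lborel {a..c} h" "a \<le> b" "b \<le> c"
  shows "(LINT t:{a..c}|lborel. h t) = (LINT t:{a..b}|lborel. h t) + (LINT t:{b..c}|lborel. h t)"
proof -
  have i1: "set_integrable lborel {a..b} h" and i2: "set_integrable lborel {b..c} h"
    by (rule set_integrable_subset[OF assms(1)]; use assms in auto)+
  have "AE t in lborel. t \<noteq> b" by (rule AE_lborel_singleton)
  then have ae: "AE t in lborel. \<not> (t \<in> {a..b} \<and> t \<in> {b..c})" by eventually_elim auto
  have "{a..c} = {a..b} \<union> {b..c}" using assms by auto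
  then show ?thesis
    using set_integral_Un_AE[OF ae _ _ i1 i2] by auto
qed

lemma ac_deriv_primitive:
  assumes h: "loc_integrable_pos h"
  shows "ac_deriv (primitive h) h"
  unfolding ac_deriv_def
proof (intro allI impI conjI)
  fix a b :: real assume ab: "0 < a" "a \<le> b"
  have i: "set_integrable lborel {x..y} h" if "0 < x" for x y
    using h that unfolding loc_integrable_pos_def by auto
  show "set_integrable lborel {a..b} h" by (rule i[OF ab(1)])
  consider "b < 1" | "a < 1" "1 \<le> b" | "1 \<le> a" using ab by linarith
  then show "primitive h b - primitive h a = (LINT x:{a..b}|lborel. h x)"
  proof cases
    case 1
    then show ?thesis using ab set_integral_Icc_split[OF i, of a b 1] by (simp add: primitive_def)
  next
    case 2
    then show ?thesis using ab set_integral_Icc_split[OF i, of a 1 b] by (simp add: primitive_def)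
  next
    case 3
    then show ?thesis using ab set_integral_Icc_split[OF i, of 1 a b] by (simp add: primitive_def)
  qed
qed

lemma ac_deriv_loc_integrable:
  assumes "ac_deriv f f'"
  shows "loc_integrable_pos f'"
  unfolding loc_integrable_pos_def
proof (intro allI impI)
  fix a b :: real assume "0 < a"
  then show "set_integrable lborel {a..b} f'"
    using ac_derivD(1)[OF assms, of a b] by (cases "a \<le> b") auto
qed

lemma ac_deriv_continuous:
  assumes "ac_deriv f f'"
  shows "continuous_on {0<..} f"
proof -
  have "isCont f x" if x: "0 < x" for x
  proof -
    have ip: "f' integrable_on {x/2..x+1}" and ii: "\<And>y. y \<in> {x/2..x+1} \<Longrightarrow> integral {x/2..y} f' = f y - f (x/2)"
      using ac_derivD[OF assms, of "x/2"] x set_borel_integral_eq_integral[OF ac_derivD(1)[OF assms, of "x/2"]]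
      by auto
    have "continuous_on {x/2..x+1} (\<lambda>y. integral {x/2..y} f')"
      by (rule indefinite_integral_continuous_1[OF ip])
    then have "continuous_on {x/2..x+1} (\<lambda>y. integral {x/2..y} f' + f (x/2))"
      by (intro continuous_intros)
    then have "continuous_on {x/2..x+1} f"
      by (rule continuous_on_eq) (simp add: ii)
    then show ?thesis
      by (rule continuous_on_interior) (use x in auto)
  qed
  then show ?thesis by (intro continuous_at_imp_continuous_on) auto
qed

lemma set_integrable_mult_continuous:
  fixes f g :: "real \<Rightarrow> complex"
  assumes f: "set_integrable lborel {a..b} f" and g: "continuous_on {a..b} g"
  shows "set_integrable lborel {a..b} (\<lambda>x. f x * g x)"
proof -
  have "compact (g ` {a..b})" by (intro compact_continuous_image g) auto
  then obtain B where B: "\<And>x. x \<in> {a..b} \<Longrightarrow> norm (g x) \<le> B"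
    using compact_imp_bounded bounded_iff by (metis imageI)
  have mg: "(\<lambda>x. indicator {a..b} x *\<^sub>R g x) \<in> borel_measurable lborel"
    using borel_integrable_atLeastAtMost'[OF g] unfolding set_integrable_def by auto
  have mf: "(\<lambda>x. indicator {a..b} x *\<^sub>R f x) \<in> borel_measurable lborel"
    using f unfolding set_integrable_def by auto
  have eq: "(\<lambda>x. indicator {a..b} x *\<^sub>R (f x * g x)) = (\<lambda>x. (indicator {a..b} x *\<^sub>R f x) * (indicator {a..b} x *\<^sub>R g x))"
    by (auto simp: indicator_def)
  show ?thesis
  proof (rule set_integrable_bound)
    show "set_integrable lborel {a..b} (\<lambda>x. complex_of_real B * f x)" using f by auto
    show "set_borel_measurable lborel {a..b} (\<lambda>x. f x * g x)"
      unfolding set_borel_measurable_def eq using mf mg by measurable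
    show "AE x in lborel. x \<in> {a..b} \<longrightarrow> norm (f x * g x) \<le> norm (complex_of_real B * f x)"
    proof (intro always_eventually allI impI)
      fix x assume x: "x \<in> {a..b}"
      have "norm (g x) * norm (f x) \<le> \<bar>B\<bar> * norm (f x)"
        by (rule mult_right_mono) (use B[OF x] in auto)
      then show "norm (f x * g x) \<le> norm (complex_of_real B * f x)"
        by (simp add: norm_mult mult.commute)
    qed
  qed
qed

text \<open>Both sides of the product rule come from integrating \<open>f' x * g' t\<close> over the triangle
  \<open>a \<le> t \<le> x \<le> b\<close> in the two possible orders.\<close>

lemma ac_deriv_mult:
  assumes f: "ac_deriv f f'" and g: "ac_deriv g g'"
  shows "ac_deriv (\<lambda>x. f x * g x) (\<lambda>x. f' x * g x + f x * g' x)"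
  unfolding ac_deriv_def
proof (intro allI impI conjI)
  fix a b :: real assume ab: "0 < a" "a \<le> b"
  note df = ac_derivD[OF f ab] and dg = ac_derivD[OF g ab]
  have cf: "continuous_on {a..b} f" and cg: "continuous_on {a..b} g"
    using ab by (auto intro!: continuous_on_subset[OF ac_deriv_continuous[OF f]]
          continuous_on_subset[OF ac_deriv_continuous[OF g]])
  have i1: "set_integrable lborel {a..b} (\<lambda>x. f' x * g x)"
    by (rule set_integrable_mult_continuous[OF df(1) cg])
  have i2: "set_integrable lborel {a..b} (\<lambda>x. f x * g' x)"
    using set_integrable_mult_continuous[OF dg(1) cf] by (simp add: mult.commute)
  show "set_integrable lborel {a..b} (\<lambda>x. f' x * g x + f x * g' x)"
    using i1 i2 by (rule set_integral_add)
  define F where "F = (\<lambda>x. indicator {a..b} x *\<^sub>R f' x)"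
  define G where "G = (\<lambda>x. indicator {a..b} x *\<^sub>R g' x)"
  have F: "integrable lborel F" and G: "integrable lborel G"
    using df(1) dg(1) unfolding F_def G_def set_integrable_def by auto
  have [measurable]: "F \<in> borel_measurable borel" "G \<in> borel_measurable borel"
    using F G by auto
  define H where "H = (\<lambda>(x,t). F x * G t * indicator {p. snd p \<le> fst p} (x,t))"
  have Hm: "H \<in> borel_measurable (lborel \<Otimes>\<^sub>M lborel)"
    unfolding H_def by measurable
  have FG: "integrable (lborel \<Otimes>\<^sub>M lborel) (\<lambda>(x,t). F x * G t)"
  proof (rule lborel_pair.Fubini_integrable)
    show "(\<lambda>(x,t). F x * G t) \<in> borel_measurable (lborel \<Otimes>\<^sub>M lborel)" by measurable
    show "integrable lborel (\<lambda>x. \<integral>y. norm (case (x, y) of (x, t) \<Rightarrow> F x * G t) \<partial>lborel)"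
      using F by (simp add: norm_mult)
    show "AE x in lborel. integrable lborel (\<lambda>y. case (x, y) of (x, t) \<Rightarrow> F x * G t)"
      using G by simp
  qed
  have Hi: "integrable (lborel \<Otimes>\<^sub>M lborel) H"
    by (rule Bochner_Integration.integrable_bound[OF FG Hm])
       (auto simp: H_def indicator_def)
  have fub: "(\<integral>x. (\<integral>t. H (x,t) \<partial>lborel) \<partial>lborel) = (\<integral>t. (\<integral>x. H (x,t) \<partial>lborel) \<partial>lborel)"
    using lborel_pair.Fubini_integral[of "\<lambda>x t. H (x,t)"] Hi by (simp add: case_prod_unfold)
  have in1: "(\<integral>t. H (x,t) \<partial>lborel) = indicator {a..b} x *\<^sub>R (f' x * (g x - g a))" for x
  proof (cases "x \<in> {a..b}")
    case True
    have "(\<lambda>t. H (x,t)) = (\<lambda>t. F x * (indicator {a..x} t *\<^sub>R g' t))"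
      using True by (auto simp: H_def G_def indicator_def)
    then have "(\<integral>t. H (x,t) \<partial>lborel) = F x * (LINT t:{a..x}|lborel. g' t)"
      by (simp only: set_lebesgue_integral_def integral_mult_right_zero)
    then show ?thesis using True ac_derivD(2)[OF g ab(1), of x] by (simp add: F_def)
  next
    case False
    then show ?thesis by (simp add: H_def F_def)
  qed
  have in2: "(\<integral>x. H (x,t) \<partial>lborel) = indicator {a..b} t *\<^sub>R ((f b - f t) * g' t)" for t
  proof (cases "t \<in> {a..b}")
    case True
    have "(\<lambda>x. H (x,t)) = (\<lambda>x. (indicator {t..b} x *\<^sub>R f' x) * G t)"
      using True by (auto simp: H_def F_def indicator_def)
    then have "(\<integral>x. H (x,t) \<partial>lborel) = (LINT x:{t..b}|lborel. f' x) * G t"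
      by (simp only: set_lebesgue_integral_def integral_mult_left_zero)
    then show ?thesis using True ac_derivD(2)[OF f, of t b] ab by (simp add: G_def)
  next
    case False
    then show ?thesis by (simp add: H_def G_def)
  qed
  have L: "(\<integral>x. (\<integral>t. H (x,t) \<partial>lborel) \<partial>lborel) = (LINT x:{a..b}|lborel. f' x * g x) - (f b - f a) * g a"
  proof -
    have "(\<integral>x. (\<integral>t. H (x,t) \<partial>lborel) \<partial>lborel) = (LINT x:{a..b}|lborel. f' x * g x - f' x * g a)"
      unfolding in1 set_lebesgue_integral_def by (simp add: right_diff_distrib)
    also have "\<dots> = (LINT x:{a..b}|lborel. f' x * g x) - (LINT x:{a..b}|lborel. f' x * g a)"
      by (rule set_integral_diff[OF i1]) (use df(1) in auto)
    also have "(LINT x:{a..b}|lborel. f' x * g a) = (f b - f a) * g a"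
      using df by (simp add: set_integral_mult_left)
    finally show ?thesis .
  qed
  have R: "(\<integral>t. (\<integral>x. H (x,t) \<partial>lborel) \<partial>lborel) = f b * (g b - g a) - (LINT x:{a..b}|lborel. f x * g' x)"
  proof -
    have "(\<integral>t. (\<integral>x. H (x,t) \<partial>lborel) \<partial>lborel) = (LINT x:{a..b}|lborel. f b * g' x - f x * g' x)"
      unfolding in2 set_lebesgue_integral_def by (simp add: left_diff_distrib)
    also have "\<dots> = (LINT x:{a..b}|lborel. f b * g' x) - (LINT x:{a..b}|lborel. f x * g' x)"
      by (rule set_integral_diff[OF _ i2]) (use dg(1) in auto)
    also have "(LINT x:{a..b}|lborel. f b * g' x) = f b * (g b - g a)"
      using dg by simp
    finally show ?thesis .
  qed
  have "(LINT x:{a..b}|lborel. f' x * g x + f x * g' x) =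
        (LINT x:{a..b}|lborel. f' x * g x) + (LINT x:{a..b}|lborel. f x * g' x)"
    by (rule set_integral_add[OF i1 i2])
  also have "\<dots> = f b * g b - f a * g a"
    using L R fub by (simp add: algebra_simps)
  finally show "f b * g b - f a * g a = (LINT x:{a..b}|lborel. f' x * g x + f x * g' x)" by simp
qed

text \<open>The intervals \<open>{1 / (k + 1)..k + 1}\<close> exhaust the half-line; they reduce statements about \<open>{0<..}\<close> to
  compact intervals, where all functions in question are integrable.\<close>

lemma exhaust_interval: "0 < 1 / real (Suc k)" "1 / real (Suc k) \<le> real (Suc k)"
proof -
  have "1 / real (Suc k) \<le> 1" "1 \<le> real (Suc k)" by simp_all
  then show "1 / real (Suc k) \<le> real (Suc k)" by (rule order_trans)
qed simp

lemma exhaust_pos: "x \<in> {1 / real (Suc k)..real (Suc k)} \<Longrightarrow> 0 < x"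
  using exhaust_interval(1)[of k] by (metis atLeastAtMost_iff less_le_trans)

lemma exhaust_eventually:
  assumes x: "0 < (x :: real)"
  obtains m where "\<And>k. m \<le> k \<Longrightarrow> x \<in> {1 / real (Suc k)..real (Suc k)}"
proof -
  obtain n where n: "x \<le> real n" using real_arch_simple by blast
  obtain m where m: "inverse (real (Suc m)) < x" using reals_Archimedean x by blast
  have "x \<in> {1 / real (Suc k)..real (Suc k)}" if "max m n \<le> k" for k
  proof -
    have "1 / real (Suc k) \<le> inverse (real (Suc m))"
      using that by (simp add: inverse_eq_divide frac_le)
    then show ?thesis using n m that by simp
  qed
  then show ?thesis using that by blast
qed

lemma exhaust_indicator:
  "(\<lambda>k. indicator {1 / real (Suc k)..real (Suc k)} x *\<^sub>R f x) \<longlonglongrightarrow>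
    indicator {0<..} x *\<^sub>R (f x :: 'a :: real_normed_vector)"
proof (cases "0 < x")
  case True
  then obtain m where m: "\<And>k. m \<le> k \<Longrightarrow> x \<in> {1 / real (Suc k)..real (Suc k)}"
    by (rule exhaust_eventually) (rule that)
  have "indicator {1 / real (Suc k)..real (Suc k)} x *\<^sub>R f x = indicator {0<..} x *\<^sub>R f x" if "m \<le> k" for k
    using m[OF that] True by (simp only: indicator_simps greaterThan_iff)
  then have "eventually (\<lambda>k. indicator {1 / real (Suc k)..real (Suc k)} x *\<^sub>R f x = indicator {0<..} x *\<^sub>R f x) sequentially"
    by (meson eventually_sequentiallyI)
  then show ?thesis by (rule tendsto_eventually)
next
  case False
  then have "x \<notin> {1 / real (Suc k)..real (Suc k)}" for k using exhaust_pos by blast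
  then show ?thesis using False by (simp add: indicator_def)
qed

text \<open>Compact intervals generate the Borel sets, so by a Dynkin argument all set integrals of \<open>f\<close> vanish.\<close>

lemma AE_zero_if_interval_integrals_zero:
  fixes f :: "real \<Rightarrow> complex"
  assumes i: "\<And>a b. 0 < a \<Longrightarrow> a \<le> b \<Longrightarrow> set_integrable lborel {a..b} f"
    and z: "\<And>a b. 0 < a \<Longrightarrow> a \<le> b \<Longrightarrow> (LINT x:{a..b}|lborel. f x) = 0"
  shows "AE x in lborel. 0 < x \<longrightarrow> f x = 0"
proof -
  have loc: "AE x in lborel. x \<in> {a..b} \<longrightarrow> f x = 0" if ab: "0 < a" "a \<le> b" for a b
  proof -
    define h where "h = (\<lambda>x. indicator {a..b} x *\<^sub>R f x)"
    have hi: "integrable lborel h" using i[OF ab] unfolding h_def set_integrable_def .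
    have hA: "set_integrable lborel A h" if "A \<in> sets borel" for A
      using integrable_mult_indicator[OF _ hi, of A] that unfolding set_integrable_def by auto
    have hz: "(LINT x:A|lborel. h x) = 0" if A: "A \<in> sets borel" for A
      using A
    proof (induction rule: borel_set_induct)
      case empty then show ?case by (simp add: set_lebesgue_integral_def)
    next
      case (interval c d)
      have "(LINT x:{c..d}|lborel. h x) = (LINT x:{max a c..min b d}|lborel. f x)"
        unfolding set_lebesgue_integral_def h_def
        by (intro Bochner_Integration.integral_cong) (auto simp: indicator_def)
      also have "\<dots> = 0"
        using z[of "max a c" "min b d"] ab by (cases "max a c \<le> min b d") (auto simp: set_lebesgue_integral_def)
      finally show ?case .
    next
      case (compl A)
      have "(LINT x:A \<union> - A|lborel. h x) = (LINT x:A|lborel. h x) + (LINT x:-A|lborel. h x)"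
        by (rule set_integral_Un) (use compl hA in auto)
      moreover have "(LINT x:UNIV|lborel. h x) = (LINT x:{a..b}|lborel. f x)"
        by (simp add: set_lebesgue_integral_def h_def)
      ultimately show ?case using compl z[OF ab] by simp
    next
      case (union A)
      have "(LINT x:\<Union>(range A)|lborel. h x) = (\<Sum>i. LINT x:A i|lborel. h x)"
        by (rule lebesgue_integral_countable_add)
           (use union hA[of "\<Union>(range A)"] in \<open>auto simp: disjoint_family_on_def\<close>)
      then show ?case using union by simp
    qed
    have "AE x in lborel. h x = 0"
      by (rule sigma_finite_measure.density_zero[OF lborel.sigma_finite_measure_axioms hi]) (simp only: sets_lborel hz)
    then show ?thesis by eventually_elim (simp add: h_def indicator_def)
  qed
  have "AE x in lborel. \<forall>n::nat. x \<in> {1 / Suc n..Suc n} \<longrightarrow> f x = 0"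
    unfolding AE_all_countable by (intro allI loc exhaust_interval)
  then show ?thesis
  proof eventually_elim
    case (elim x)
    show ?case
    proof
      assume "0 < x"
      then obtain m where "\<And>k. m \<le> k \<Longrightarrow> x \<in> {1 / real (Suc k)..real (Suc k)}"
        by (rule exhaust_eventually) (rule that)
      then show "f x = 0" using elim by blast
    qed
  qed
qed

section \<open>Test functions\<close>

lemma set_cong_AE:
  fixes f g :: "'a \<Rightarrow> 'b::{banach, second_countable_topology}"
  assumes f: "set_borel_measurable M A f" and g: "set_borel_measurable M A g"
    and e: "AE x in M. x \<in> A \<longrightarrow> f x = g x"
  shows "set_integrable M A f \<longleftrightarrow> set_integrable M A g"
    and "set_lebesgue_integral M A f = set_lebesgue_integral M A g"
proof -
  have e': "AE x in M. indicator A x *\<^sub>R f x = indicator A x *\<^sub>R g x"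
    using e by eventually_elim (auto simp: indicator_def)
  show "set_integrable M A f \<longleftrightarrow> set_integrable M A g"
    unfolding set_integrable_def
    by (rule integrable_cong_AE[OF f[unfolded set_borel_measurable_def] g[unfolded set_borel_measurable_def] e'])
  show "set_lebesgue_integral M A f = set_lebesgue_integral M A g"
    unfolding set_lebesgue_integral_def
    by (rule integral_cong_AE[OF f[unfolded set_borel_measurable_def] g[unfolded set_borel_measurable_def] e'])
qed

text \<open>The smoothness clause of \<open>test_fun\<close>, without the condition on the support.\<close>

definition smooth :: "(real \<Rightarrow> real) \<Rightarrow> bool" where
  "smooth f \<longleftrightarrow> (\<forall>n x. (deriv ^^ n) f field_differentiable (at x))"

text \<open>Iterated derivatives of the functions below have no useful closed form. It is enough to place the
  function in some class that is closed under differentiation.\<close>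

lemma smooth_coinduct:
  assumes f: "f \<in> S" and S: "\<And>f. f \<in> S \<Longrightarrow> \<exists>g\<in>S. \<forall>x. (f has_field_derivative g x) (at x)"
  shows "smooth f"
proof -
  have "(deriv ^^ n) f \<in> S" for n
  proof (induction n)
    case 0 then show ?case using f by simp
  next
    case (Suc n)
    obtain g where g: "g \<in> S" "\<forall>x. ((deriv ^^ n) f has_field_derivative g x) (at x)"
      using S[OF Suc] by auto
    have "deriv ((deriv ^^ n) f) = g"
      using g(2) by (auto simp: fun_eq_iff intro: DERIV_imp_deriv)
    then show ?case using g by simp
  qed
  then show ?thesis
    using S unfolding smooth_def by (meson field_differentiable_def)
qed

lemma smooth_deriv: "smooth f \<Longrightarrow> smooth (deriv f)"
  unfolding smooth_def by (metis funpow_Suc_right comp_apply)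

lemma smooth_has_deriv: "smooth f \<Longrightarrow> (f has_field_derivative deriv f x) (at x)"
  unfolding smooth_def using DERIV_deriv_iff_field_differentiable[of f x] by (metis funpow_0)

lemma smooth_continuous: "smooth f \<Longrightarrow> continuous_on A f"
  by (meson smooth_has_deriv DERIV_isCont continuous_at_imp_continuous_on)

lemma smooth_lincomb:
  assumes "smooth f" "smooth g"
  shows "smooth (\<lambda>x. f x + c * g x)"
proof (rule smooth_coinduct)
  let ?S = "{h. \<exists>f g. smooth f \<and> smooth g \<and> h = (\<lambda>x. f x + c * g x)}"
  show "(\<lambda>x. f x + c * g x) \<in> ?S" using assms by blast
  fix h assume "h \<in> ?S"
  then obtain f g where fg: "smooth f" "smooth g" "h = (\<lambda>x. f x + c * g x)" by auto
  show "\<exists>k\<in>?S. \<forall>x. (h has_field_derivative k x) (at x)"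
  proof (rule bexI[where x="\<lambda>x. deriv f x + c * deriv g x"])
    show "\<forall>x. (h has_field_derivative (deriv f x + c * deriv g x)) (at x)"
      unfolding fg(3) using smooth_has_deriv[OF fg(1)] smooth_has_deriv[OF fg(2)]
      by (auto intro!: derivative_eq_intros)
    show "(\<lambda>x. deriv f x + c * deriv g x) \<in> ?S"
      using fg smooth_deriv by blast
  qed
qed

lemma smooth_antideriv:
  assumes "smooth g" "\<And>x. (f has_field_derivative g x) (at x)"
  shows "smooth f"
proof (rule smooth_coinduct)
  let ?S = "insert f {h. smooth h}"
  show "f \<in> ?S" by simp
  fix h assume "h \<in> ?S"
  then show "\<exists>k\<in>?S. \<forall>x. (h has_field_derivative k x) (at x)"
    using assms smooth_has_deriv smooth_deriv by blast
qed

lemma test_funI: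
  assumes "smooth \<phi>" "0 < a" "\<And>x. x \<notin> {a..b} \<Longrightarrow> \<phi> x = 0"
  shows "test_fun \<phi>"
proof -
  have sub: "closure {x. \<phi> x \<noteq> 0} \<subseteq> {a..b}"
    by (rule closure_minimal) (use assms(3) in blast, simp)
  have "compact (closure {x. \<phi> x \<noteq> 0})"
    using sub bounded_subset[OF bounded_closed_interval] by (auto simp: compact_eq_bounded_closed)
  moreover have "closure {x. \<phi> x \<noteq> 0} \<subseteq> {0<..}" using sub assms(2) by force
  ultimately show ?thesis using assms(1) unfolding test_fun_def smooth_def by auto
qed

lemma test_funE:
  assumes "test_fun \<phi>"
  obtains a b where "smooth \<phi>" "0 < a" "a < b" "\<And>x. x \<notin> {a..b} \<Longrightarrow> \<phi> x = 0"
proof -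
  let ?K = "closure {x. \<phi> x \<noteq> 0}"
  have K: "compact ?K" "?K \<subseteq> {0<..}" and s: "smooth \<phi>"
    using assms unfolding test_fun_def smooth_def by auto
  have "\<exists>a b. 0 < a \<and> a < b \<and> ?K \<subseteq> {a..b}"
  proof (cases "?K = {}")
    case True then show ?thesis by (intro exI[of _ 1] exI[of _ 2]) auto
  next
    case False
    obtain l where l: "l \<in> ?K" "\<forall>x\<in>?K. l \<le> x" using compact_attains_inf[OF K(1) False] by auto
    obtain u where u: "u \<in> ?K" "\<forall>x\<in>?K. x \<le> u" using compact_attains_sup[OF K(1) False] by auto
    have "0 < l" "l \<le> u" using l u K(2) by auto
    then show ?thesis using l u by (intro exI[of _ l] exI[of _ "u+1"]) fastforce
  qed
  then obtain a b where "0 < a" "a < b" "?K \<subseteq> {a..b}" by auto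
  moreover have "\<phi> x = 0" if "x \<notin> {a..b}" for x
    using that \<open>?K \<subseteq> {a..b}\<close> closure_subset[of "{x. \<phi> x \<noteq> 0}"] by blast
  ultimately show ?thesis using s that by blast
qed

lemma deriv_zero_outside:
  assumes "\<And>x. x \<notin> {a..b} \<Longrightarrow> \<phi> x = (0::real)" "x \<notin> {a..b}"
  shows "deriv \<phi> x = 0"
proof -
  have "((\<lambda>x. 0) has_field_derivative 0) (at x)" by simp
  then have "(\<phi> has_field_derivative 0) (at x)"
    by (rule has_field_derivative_transform_within_open[of _ _ _ "- {a..b}"]) (use assms in auto)
  then show ?thesis by (rule DERIV_imp_deriv)
qed

lemma test_fun_deriv:
  assumes p: "test_fun \<phi>"
  shows "test_fun (deriv \<phi>)"
proof -
  obtain a b where ab: "smooth \<phi>" "0 < a" "a < b" "\<And>x. x \<notin> {a..b} \<Longrightarrow> \<phi> x = 0"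
    using p by (rule test_funE) (rule that)
  show ?thesis
    by (rule test_funI[OF smooth_deriv[OF ab(1)] ab(2)]) (rule deriv_zero_outside[OF ab(4)])
qed

lemma test_fun_lincomb:
  assumes "test_fun f" "test_fun g"
  shows "test_fun (\<lambda>x. f x + c * g x)"
proof -
  obtain a b where f: "smooth f" "0 < a" "a < b" "\<And>x. x \<notin> {a..b} \<Longrightarrow> f x = 0"
    using assms(1) by (rule test_funE) (rule that)
  obtain a' b' where g: "smooth g" "0 < a'" "a' < b'" "\<And>x. x \<notin> {a'..b'} \<Longrightarrow> g x = 0"
    using assms(2) by (rule test_funE) (rule that) 
  show ?thesis
  proof (rule test_funI[of _ "min a a'" "max b b'"])
    show "f x + c * g x = 0" if "x \<notin> {min a a'..max b b'}" for x
    proof -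
      have "x \<notin> {a..b}" "x \<notin> {a'..b'}" using that by auto
      then show ?thesis using f(4) g(4) by simp
    qed
  qed (use f g smooth_lincomb in auto)
qed

definition bump_poly :: "real \<Rightarrow> real \<Rightarrow> real poly" where
  "bump_poly a b = [:- a, 1:] * [:b, - 1:]"

text \<open>The class used for the smoothness of \<open>exp (- c / q)\<close>, \<open>q = (x - a) * (b - x)\<close>: each derivative raises the
  power of \<open>q\<close> in the denominator by two and changes the polynomial \<open>R\<close>.\<close>

definition bump_class :: "real \<Rightarrow> real \<Rightarrow> real \<Rightarrow> real poly \<Rightarrow> nat \<Rightarrow> real \<Rightarrow> real" where
  "bump_class c a b R k x = (if a < x \<and> x < b
     then poly R x / poly (bump_poly a b) x ^ k * exp (- c / poly (bump_poly a b) x) else 0)"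

lemma poly_bump_poly: "poly (bump_poly a b) x = (x - a) * (b - x)"
  by (simp add: bump_poly_def algebra_simps)

lemma bump_class_deriv_inside:
  fixes a b c x :: real
  assumes x: "a < x" "x < b"
  defines "Q \<equiv> bump_poly a b"
  shows "(bump_class c a b R k has_field_derivative
     bump_class c a b (pderiv R * Q^2 - of_nat k * R * pderiv Q * Q + smult c (R * pderiv Q)) (k+2) x) (at x)"
proof -
  let ?q = "poly Q x" and ?q' = "poly (pderiv Q) x"
  have q: "?q > 0" unfolding Q_def poly_bump_poly using x by simp
  have "((\<lambda>y. poly R y / poly Q y ^ k * exp (- c / poly Q y)) has_field_derivative
      (poly (pderiv R) x * ?q ^ k - poly R x * (of_nat k * ?q ^ (k - 1) * ?q')) / (?q ^ k * ?q ^ k) * exp (- c / ?q)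
      + poly R x / ?q ^ k * (exp (- c / ?q) * (c * ?q' / (?q * ?q)))) (at x)"
    using q by (auto intro!: derivative_eq_intros simp: field_simps power2_eq_square)
  also have "(poly (pderiv R) x * ?q ^ k - poly R x * (of_nat k * ?q ^ (k - 1) * ?q')) / (?q ^ k * ?q ^ k) * exp (- c / ?q)
      + poly R x / ?q ^ k * (exp (- c / ?q) * (c * ?q' / (?q * ?q)))
      = bump_class c a b (pderiv R * Q^2 - of_nat k * R * pderiv Q * Q + smult c (R * pderiv Q)) (k+2) x"
  proof (cases k)
    case 0
    then show ?thesis using q x
      by (simp add: bump_class_def Q_def[symmetric] field_simps power2_eq_square)
  next
    case (Suc m)
    then show ?thesis using q x
      by (simp add: bump_class_def Q_def[symmetric] field_simps power2_eq_square)
  qed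
  finally show ?thesis
    by (rule has_field_derivative_transform_within_open[of _ _ _ "{a<..<b}"])
       (use x in \<open>auto simp: bump_class_def Q_def\<close>)
qed

lemma exp_minus_le_power:
  fixes y :: real
  assumes "0 < y" "0 < m"
  shows "exp (- y) \<le> (real m / y) ^ m"
proof -
  have "(y / m) ^ m \<le> (1 + y / m) ^ m" by (rule power_mono) (use assms in auto)
  also have "\<dots> \<le> exp y" by (rule exp_ge_one_plus_x_over_n_power_n) (use assms in auto)
  finally have "inverse (exp y) \<le> inverse ((y / m) ^ m)"
    by (rule le_imp_inverse_le) (use assms in auto)
  then show ?thesis by (simp add: exp_minus power_inverse[symmetric])
qed

text \<open>The exponential beats every negative power of \<open>q\<close>, so a member of the class is bounded by a multiple of
  \<open>q\<^sup>2\<close>, and \<open>q\<close> is at most linear in the distance to any point outside the open interval.\<close>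

lemma bump_class_deriv_outside:
  fixes a b c x0 :: real
  assumes c: "0 < c" and x0: "\<not> (a < x0 \<and> x0 < b)" and ab: "a < b"
  shows "(bump_class c a b R k has_field_derivative 0) (at x0)"
proof -
  have "compact (poly R ` {a..b})" by (intro compact_continuous_image) (auto intro: continuous_intros)
  then obtain B where B: "\<And>x. x \<in> {a..b} \<Longrightarrow> \<bar>poly R x\<bar> \<le> B"
    using compact_imp_bounded bounded_iff by (metis imageI real_norm_def)
  have B0: "B \<ge> 0" using B[of a] ab by auto
  define C where "C = B * (real (k + 2) / c) ^ (k + 2) * (b - a)^2"
  have C0: "C \<ge> 0" unfolding C_def using B0 c ab by auto
  have le: "\<bar>bump_class c a b R k x\<bar> \<le> C * (x - x0)^2" for x
  proof (cases "a < x \<and> x < b")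
    case True
    let ?q = "(x - a) * (b - x)"
    have q: "?q > 0" using True by simp
    have qb: "?q \<le> (b - a) * \<bar>x - x0\<bar>"
    proof (cases "x0 \<le> a")
      case True
      have "?q \<le> \<bar>x - x0\<bar> * (b - a)" by (rule mult_mono) (use True \<open>a < x \<and> x < b\<close> in auto)
      then show ?thesis by (simp add: mult.commute)
    next
      case False
      then have "b \<le> x0" using x0 by auto
      then show ?thesis by (intro mult_mono) (use True in auto)
    qed
    have "\<bar>bump_class c a b R k x\<bar> = \<bar>poly R x\<bar> / ?q ^ k * exp (- (c / ?q))"
      using True q by (simp add: bump_class_def poly_bump_poly abs_mult power_abs)
    also have "\<dots> \<le> B / ?q ^ k * (real (k + 2) / (c / ?q)) ^ (k + 2)"
    proof (rule mult_mono)
      show "\<bar>poly R x\<bar> / ?q ^ k \<le> B / ?q ^ k" 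
        by (rule divide_right_mono) (use B[of x] True q in auto)
      show "exp (- (c / ?q)) \<le> (real (k + 2) / (c / ?q)) ^ (k + 2)"
        by (rule exp_minus_le_power) (use c q in auto)
    qed (use B0 q in auto)
    also have "\<dots> = B * (real (k + 2) / c) ^ (k + 2) * ?q ^ 2"
    proof -
      define D where "D = real (k + 2) / c"
      have "(real (k + 2) / (c / ?q)) ^ (k + 2) = (D * ?q) ^ (k + 2)"
        unfolding D_def by simp
      also have "\<dots> = D ^ (k + 2) * (?q ^ k * ?q ^ 2)"
        by (simp only: power_mult_distrib[of D ?q "k + 2"] power_add[of ?q k 2])
      finally have e: "(real (k + 2) / (c / ?q)) ^ (k + 2) = D ^ (k + 2) * (?q ^ k * ?q ^ 2)" .
      have "?q ^ k \<noteq> 0" using q by (intro power_not_zero) linarith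
      moreover have "B / Z * (Y * (Z * U)) = B * Y * U" if "Z \<noteq> 0" for Y Z U :: real
        using that by simp
      ultimately show ?thesis unfolding e D_def[symmetric] by blast
    qed
    also have "\<dots> \<le> B * (real (k + 2) / c) ^ (k + 2) * ((b - a) * \<bar>x - x0\<bar>) ^ 2"
      by (intro mult_left_mono power_mono qb) (use q B0 c in auto)
    also have "\<dots> = C * (x - x0)^2"
      by (simp add: C_def power_mult_distrib)
    finally show ?thesis .
  next
    case False
    then show ?thesis using C0 by (simp only: bump_class_def if_False) simp
  qed
  have z: "bump_class c a b R k x0 = 0" using le[of x0] by simp
  show ?thesis
    unfolding DERIV_def
  proof (rule Lim_null_comparison)
    show "((\<lambda>h. C * \<bar>h\<bar>) \<longlongrightarrow> 0) (at 0)"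
      by (auto intro!: tendsto_eq_intros)
    have "norm ((bump_class c a b R k (x0 + h) - bump_class c a b R k x0) / h) \<le> C * \<bar>h\<bar>" if "h \<noteq> 0" for h
    proof -
      have "\<bar>bump_class c a b R k (x0 + h)\<bar> \<le> C * \<bar>h\<bar> * \<bar>h\<bar>"
        using le[of "x0 + h"] by (simp add: power2_eq_square abs_mult[symmetric])
      then show ?thesis using that z by (simp add: divide_le_eq)
    qed
    then show "\<forall>\<^sub>F h in at 0. norm ((bump_class c a b R k (x0 + h) - bump_class c a b R k x0) / h) \<le> C * \<bar>h\<bar>"
      by (auto simp: eventually_at_filter)
  qed
qed

definition bump :: "real \<Rightarrow> real \<Rightarrow> real \<Rightarrow> real \<Rightarrow> real" where
  "bump c a b x = (if a < x \<and> x < b then exp (- c / ((x - a) * (b - x))) else 0)"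

lemma smooth_bump:
  assumes "0 < c" "a < b"
  shows "smooth (bump c a b)"
proof (rule smooth_coinduct)
  let ?S = "{bump_class c a b R k |R k. True}"
  have "bump c a b = bump_class c a b 1 0"
    by (auto simp: fun_eq_iff bump_def bump_class_def poly_bump_poly)
  then show "bump c a b \<in> ?S" by blast
  fix h assume "h \<in> ?S"
  then obtain R k where h: "h = bump_class c a b R k" by auto
  let ?Q = "bump_poly a b"
  let ?R = "pderiv R * ?Q^2 - of_nat k * R * pderiv ?Q * ?Q + smult c (R * pderiv ?Q)"
  have "(h has_field_derivative bump_class c a b ?R (k+2) x) (at x)" for x
  proof (cases "a < x \<and> x < b")
    case True then show ?thesis unfolding h using bump_class_deriv_inside[of a x b c R k] by auto
  next
    case False
    then have "bump_class c a b ?R (k+2) x = 0" by (auto simp: bump_class_def)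
    then show ?thesis unfolding h using bump_class_deriv_outside[OF assms(1) False assms(2)] by simp
  qed
  then show "\<exists>k\<in>?S. \<forall>x. (h has_field_derivative k x) (at x)" by blast
qed

lemma test_fun_bump: "0 < c \<Longrightarrow> 0 < a \<Longrightarrow> a < b \<Longrightarrow> test_fun (bump c a b)"
  by (rule test_funI[of _ a b]) (auto intro: smooth_bump simp: bump_def)

section \<open>Weak derivatives are absolutely continuous derivatives\<close>

lemma pairing_restrict:
  fixes u :: "real \<Rightarrow> complex"
  assumes "0 < a" "\<And>x. x \<notin> {a..b} \<Longrightarrow> \<psi> x = (0::real)"
  shows "(LINT r:{0<..}|lborel. u r * complex_of_real (\<psi> r)) = (LINT r:{a..b}|lborel. u r * complex_of_real (\<psi> r))"
  unfolding set_lebesgue_integral_def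
proof (rule Bochner_Integration.integral_cong)
  fix x show "indicator {0<..} x *\<^sub>R (u x * complex_of_real (\<psi> x)) = indicator {a..b} x *\<^sub>R (u x * complex_of_real (\<psi> x))"
    using assms(1) assms(2)[of x] by (cases "x \<in> {a..b}") (auto simp: indicator_def)
qed simp

lemma pairing_integrable:
  assumes u: "loc_integrable_pos u" and p: "test_fun \<phi>"
  shows "set_integrable lborel {0<..} (\<lambda>r. u r * complex_of_real (\<phi> r))"
proof -
  obtain a b where ab: "smooth \<phi>" "0 < a" "a < b" "\<And>x. x \<notin> {a..b} \<Longrightarrow> \<phi> x = 0"
    using p by (rule test_funE) (rule that)
  have "set_integrable lborel {a..b} (\<lambda>r. u r * complex_of_real (\<phi> r))"
    by (rule set_integrable_mult_continuous)
       (use u ab smooth_continuous in \<open>auto simp: loc_integrable_pos_def intro!: continuous_intros\<close>)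
  also have "set_integrable lborel {a..b} (\<lambda>r. u r * complex_of_real (\<phi> r)) = ?thesis"
    unfolding set_integrable_def
  proof (rule Bochner_Integration.integrable_cong)
    fix x show "indicator {a..b} x *\<^sub>R (u x * complex_of_real (\<phi> x)) = indicator {0<..} x *\<^sub>R (u x * complex_of_real (\<phi> x))"
      using ab(2) ab(4)[of x] by (cases "x \<in> {a..b}") (auto simp: indicator_def)
  qed simp
  finally show ?thesis .
qed

lemma pairing_lincomb:
  assumes "loc_integrable_pos u" "test_fun \<phi>" "test_fun \<psi>"
  shows "(LINT r:{0<..}|lborel. u r * complex_of_real (\<phi> r + c * \<psi> r)) =
    (LINT r:{0<..}|lborel. u r * complex_of_real (\<phi> r)) + complex_of_real c * (LINT r:{0<..}|lborel. u r * complex_of_real (\<psi> r))"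
proof -
  have "(LINT r:{0<..}|lborel. u r * complex_of_real (\<phi> r + c * \<psi> r)) =
     (LINT r:{0<..}|lborel. u r * complex_of_real (\<phi> r) + complex_of_real c * (u r * complex_of_real (\<psi> r)))"
    by (simp add: algebra_simps)
  also have "\<dots> = (LINT r:{0<..}|lborel. u r * complex_of_real (\<phi> r)) + (LINT r:{0<..}|lborel. complex_of_real c * (u r * complex_of_real (\<psi> r)))"
    by (rule set_integral_add) (use pairing_integrable assms in auto)
  finally show ?thesis by simp
qed

lemma pairing_lincomb_left:
  assumes "loc_integrable_pos u" "loc_integrable_pos v" "test_fun \<phi>"
  shows "(LINT r:{0<..}|lborel. (u r + c * v r) * complex_of_real (\<phi> r)) =
    (LINT r:{0<..}|lborel. u r * complex_of_real (\<phi> r)) + c * (LINT r:{0<..}|lborel. v r * complex_of_real (\<phi> r))"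
proof -
  have "(LINT r:{0<..}|lborel. (u r + c * v r) * complex_of_real (\<phi> r)) =
     (LINT r:{0<..}|lborel. u r * complex_of_real (\<phi> r) + c * (v r * complex_of_real (\<phi> r)))"
    by (simp add: algebra_simps)
  also have "\<dots> = (LINT r:{0<..}|lborel. u r * complex_of_real (\<phi> r)) + (LINT r:{0<..}|lborel. c * (v r * complex_of_real (\<phi> r)))"
    by (rule set_integral_add) (use pairing_integrable assms in auto)
  finally show ?thesis by simp
qed

lemma loc_integrable_continuous: "continuous_on {0<..} u \<Longrightarrow> loc_integrable_pos u"
  unfolding loc_integrable_pos_def
  by (intro allI impI borel_integrable_atLeastAtMost') (auto elim!: continuous_on_subset)

lemma loc_integrable_lincomb:
  "loc_integrable_pos u \<Longrightarrow> loc_integrable_pos v \<Longrightarrow> loc_integrable_pos (\<lambda>r. u r + c * v r)"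
  unfolding loc_integrable_pos_def by (auto intro!: set_integral_add)

lemma loc_integrable_measurable:
  assumes "loc_integrable_pos u"
  shows "set_borel_measurable lborel {0<..} u"
proof -
  have m: "(\<lambda>x. indicator {1 / Suc n..Suc n} x *\<^sub>R u x) \<in> borel_measurable lborel" for n
    using assms unfolding loc_integrable_pos_def set_integrable_def
    by (metis borel_measurable_integrable of_nat_0_less_iff zero_less_Suc zero_less_divide_1_iff)
  show ?thesis
    unfolding set_borel_measurable_def
    by (rule borel_measurable_LIMSEQ_metric[OF m]) (rule exhaust_indicator)
qed

text \<open>The support of the test function lies strictly inside \<open>{a / 2..b + 1}\<close>, so no boundary term survives.\<close>

lemma pairing_by_parts:
  assumes u: "ac_deriv u v" and p: "test_fun \<phi>"
  shows "(LINT r:{0<..}|lborel. u r * complex_of_real (deriv \<phi> r)) = - (LINT r:{0<..}|lborel. v r * complex_of_real (\<phi> r))"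
proof -
  obtain a b where ab: "smooth \<phi>" "0 < a" "a < b" "\<And>x. x \<notin> {a..b} \<Longrightarrow> \<phi> x = 0"
    using p by (rule test_funE) (rule that)
  have "ac_deriv (\<lambda>x. complex_of_real (\<phi> x)) (\<lambda>x. complex_of_real (deriv \<phi> x))"
  proof (rule ac_deriv_C1)
    show "((\<lambda>x. complex_of_real (\<phi> x)) has_vector_derivative complex_of_real (deriv \<phi> x)) (at x)" for x
      using smooth_has_deriv[OF ab(1)] by (rule has_vector_derivative_of_real)
  qed (auto intro!: continuous_intros smooth_continuous smooth_deriv ab(1))
  then have m: "ac_deriv (\<lambda>x. u x * complex_of_real (\<phi> x)) (\<lambda>x. v x * complex_of_real (\<phi> x) + u x * complex_of_real (deriv \<phi> x))"
    by (rule ac_deriv_mult[OF u])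
  have a': "0 < a / 2" "a/2 \<le> b + 1" "a / 2 \<notin> {a..b}" "b + 1 \<notin> {a..b}" using ab by auto
  have z: "\<And>x. x \<notin> {a/2..b+1} \<Longrightarrow> \<phi> x = 0" using ab by auto
  have zd: "\<And>x. x \<notin> {a/2..b+1} \<Longrightarrow> deriv \<phi> x = 0" by (rule deriv_zero_outside[OF z])
  have i1: "set_integrable lborel {a/2..b+1} (\<lambda>x. v x * complex_of_real (\<phi> x))"
    by (rule set_integrable_mult_continuous)
       (use ac_derivD(1)[OF u a'(1,2)] smooth_continuous[OF ab(1)] in \<open>auto intro!: continuous_intros\<close>)
  have "continuous_on {a/2..b+1} u"
    by (rule continuous_on_subset[OF ac_deriv_continuous[OF u]]) (use ab in auto)
  then have i2: "set_integrable lborel {a/2..b+1} (\<lambda>x. u x * complex_of_real (deriv \<phi> x))"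
    by (intro borel_integrable_atLeastAtMost' continuous_intros smooth_continuous[OF smooth_deriv[OF ab(1)]])
  have "0 = (LINT x:{a/2..b+1}|lborel. v x * complex_of_real (\<phi> x) + u x * complex_of_real (deriv \<phi> x))"
    using ac_derivD(2)[OF m a'(1,2)] ab(4)[OF a'(3)] ab(4)[OF a'(4)] by simp
  also have "\<dots> = (LINT x:{a/2..b+1}|lborel. v x * complex_of_real (\<phi> x)) + (LINT x:{a/2..b+1}|lborel. u x * complex_of_real (deriv \<phi> x))"
    by (rule set_integral_add[OF i1 i2])
  finally have "(LINT x:{a/2..b+1}|lborel. u x * complex_of_real (deriv \<phi> x)) = - (LINT x:{a/2..b+1}|lborel. v x * complex_of_real (\<phi> x))"
    by (metis add.commute eq_neg_iff_add_eq_0)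
  moreover have "(LINT r:{0<..}|lborel. u r * complex_of_real (deriv \<phi> r)) = (LINT x:{a/2..b+1}|lborel. u x * complex_of_real (deriv \<phi> x))"
    by (rule pairing_restrict[OF a'(1)]) (rule zd)
  moreover have "(LINT r:{0<..}|lborel. v r * complex_of_real (\<phi> r)) = (LINT x:{a/2..b+1}|lborel. v x * complex_of_real (\<phi> x))"
    by (rule pairing_restrict[OF a'(1)]) (rule z)
  ultimately show ?thesis by simp
qed

text \<open>The bumps with constant \<open>1 / (n + 1)\<close> increase to the indicator of an open interval, which turns
  vanishing pairings into vanishing interval integrals by dominated convergence.\<close>

lemma AE_zero_if_pairings_zero:
  assumes f: "loc_integrable_pos f"
    and z: "\<And>\<phi>. test_fun \<phi> \<Longrightarrow> (LINT r:{0<..}|lborel. f r * complex_of_real (\<phi> r)) = 0"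
  shows "AE x in lborel. 0 < x \<longrightarrow> f x = 0"
proof (rule AE_zero_if_interval_integrals_zero)
  show i: "set_integrable lborel {a..b} f" if "0 < a" for a b
    using f that unfolding loc_integrable_pos_def by auto
  fix a b :: real assume a: "0 < a" and le: "a \<le> b"
  have AEab: "AE x in lborel. x \<noteq> a \<and> x \<noteq> b"
    using AE_lborel_singleton[of a] AE_lborel_singleton[of b] by eventually_elim auto
  show "(LINT x:{a..b}|lborel. f x) = 0"
  proof (cases "a = b")
    case True
    then show ?thesis
      using set_integral_Icc_split[OF i[OF a], of a a] by simp
  next
    case False
    then have ab: "a < b" using le by simp
    have lim: "(\<lambda>n. LINT r|lborel. indicator {a..b} r *\<^sub>R (f r * complex_of_real (bump (1 / Suc n) a b r)))
        \<longlonglongrightarrow> (LINT r|lborel. indicator {a..b} r *\<^sub>R f r)"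
    proof (rule integral_dominated_convergence)
      show "integrable lborel (\<lambda>r. norm (indicator {a..b} r *\<^sub>R f r))"
        using i[OF a] unfolding set_integrable_def by (rule integrable_norm)
      show "(\<lambda>r. indicator {a..b} r *\<^sub>R f r) \<in> borel_measurable lborel"
        using i[OF a] unfolding set_integrable_def by (rule borel_measurable_integrable)
      fix n
      have "set_integrable lborel {a..b} (\<lambda>r. f r * complex_of_real (bump (1 / Suc n) a b r))"
        by (rule set_integrable_mult_continuous[OF i[OF a]])
           (use ab in \<open>auto intro!: continuous_intros smooth_continuous smooth_bump\<close>)
      then show "(\<lambda>r. indicator {a..b} r *\<^sub>R (f r * complex_of_real (bump (1 / Suc n) a b r))) \<in> borel_measurable lborel"
        unfolding set_integrable_def by (rule borel_measurable_integrable)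
      have "norm (indicator {a..b} r *\<^sub>R (f r * complex_of_real (bump (1 / Suc n) a b r))) \<le> norm (indicator {a..b} r *\<^sub>R f r)" for r
      proof -
        have "\<bar>bump (1 / Suc n) a b r\<bar> \<le> 1"
          by (auto simp: bump_def mult_nonneg_nonneg)
        then show ?thesis by (auto simp: norm_mult indicator_def mult_left_le)
      qed
      then show "AE r in lborel. norm (indicator {a..b} r *\<^sub>R (f r * complex_of_real (bump (1 / Suc n) a b r))) \<le> norm (indicator {a..b} r *\<^sub>R f r)"
        by simp
    next
      show "AE r in lborel. (\<lambda>n. indicator {a..b} r *\<^sub>R (f r * complex_of_real (bump (1 / Suc n) a b r))) \<longlonglongrightarrow> indicator {a..b} r *\<^sub>R f r"
        using AEab
      proof eventually_elim
        case (elim r)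
        show ?case
        proof (cases "r \<in> {a..b}")
          case True
          then have r: "a < r" "r < b" using elim by auto
          have "(\<lambda>n. exp (- ((1 / Suc n) * (1 / ((r - a) * (b - r)))))) \<longlonglongrightarrow> exp (- (0 * (1 / ((r - a) * (b - r)))))"
            by (intro tendsto_intros LIMSEQ_Suc[OF lim_1_over_n])
          then have "(\<lambda>n. bump (1 / Suc n) a b r) \<longlonglongrightarrow> 1"
            using r by (simp add: bump_def)
          then have "(\<lambda>n. f r * complex_of_real (bump (1 / Suc n) a b r)) \<longlonglongrightarrow> f r * complex_of_real 1"
            by (intro tendsto_intros)
          then show ?thesis using True by simp
        qed simp
      qed
    qed
    have "(LINT r|lborel. indicator {a..b} r *\<^sub>R (f r * complex_of_real (bump (1 / Suc n) a b r))) = 0" for n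
    proof -
      have tb: "test_fun (bump (1 / Suc n) a b)" by (rule test_fun_bump) (use a ab in auto)
      have zb: "\<And>x. x \<notin> {a..b} \<Longrightarrow> bump (1 / Suc n) a b x = 0" by (auto simp: bump_def)
      show ?thesis using z[OF tb] pairing_restrict[of a b "bump (1 / Suc n) a b" f, OF a zb]
        unfolding set_lebesgue_integral_def by simp
    qed
    then show ?thesis using lim unfolding set_lebesgue_integral_def by (simp add: LIMSEQ_const_iff)
  qed
qed

text \<open>The primitive that vanishes at the left end of the support is constant to the right of the support, with
  value the integral of \<open>\<eta>\<close>.\<close>

lemma test_fun_antideriv:
  assumes p: "test_fun \<eta>" and z: "(LINT r:{0<..}|lborel. complex_of_real (\<eta> r)) = 0"
  obtains \<phi> where "test_fun \<phi>" "deriv \<phi> = \<eta>"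
proof -
  obtain a b where ab: "smooth \<eta>" "0 < a" "a < b" "\<And>x. x \<notin> {a..b} \<Longrightarrow> \<eta> x = 0"
    using p by (rule test_funE) (rule that)
  have "\<exists>F. \<forall>x. -\<infinity> < ereal x \<longrightarrow> ereal x < \<infinity> \<longrightarrow> (F has_vector_derivative \<eta> x) (at x)"
    by (rule einterval_antiderivative) (use smooth_has_deriv[OF ab(1)] DERIV_isCont in auto)
  then obtain F where F: "\<And>x. (F has_real_derivative \<eta> x) (at x)"
    by (auto simp: has_real_derivative_iff_has_vector_derivative)
  define \<phi> where "\<phi> = (\<lambda>x. F x - F a)"
  have d: "(\<phi> has_real_derivative \<eta> x) (at x)" for x
    unfolding \<phi>_def by (auto intro!: derivative_eq_intros F)
  have ia: "ac_deriv (\<lambda>x. complex_of_real (\<phi> x)) (\<lambda>x. complex_of_real (\<eta> x))"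
    by (rule ac_deriv_C1) (auto intro!: has_vector_derivative_of_real d continuous_intros smooth_continuous ab(1))
  have "(LINT r:{0<..}|lborel. complex_of_real (\<eta> r)) = (LINT r:{a..b}|lborel. complex_of_real (\<eta> r))"
    using pairing_restrict[OF ab(2,4), where u="\<lambda>_. 1"] by simp
  then have pb: "\<phi> b = \<phi> a"
    using z ac_derivD(2)[OF ia, of a b] ab by (metis less_imp_le of_real_eq_iff right_minus_eq)
  have "\<phi> x = 0" if "x \<notin> {a..b}" for x
  proof (cases "x < a")
    case True
    then obtain y where "x < y" "y < a" "\<phi> a - \<phi> x = (a - x) * \<eta> y" using MVT2[OF True d] by auto
    then show ?thesis using ab(4)[of y] by (simp add: \<phi>_def)
  next
    case False
    then have bx: "b < x" using that by auto
    then obtain y where "b < y" "y < x" "\<phi> x - \<phi> b = (x - b) * \<eta> y" using MVT2[OF bx d] by auto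
    then show ?thesis using ab(4)[of y] pb by (simp add: \<phi>_def)
  qed
  then have "test_fun \<phi>"
    by (intro test_funI[of _ a b] smooth_antideriv[OF ab(1) d] ab) auto
  moreover have "deriv \<phi> = \<eta>" using d by (auto simp: fun_eq_iff intro: DERIV_imp_deriv)
  ultimately show ?thesis by (rule that)
qed

lemma bump_integral_nonzero: "(LINT r:{0<..}|lborel. complex_of_real (bump 1 1 2 r)) \<noteq> 0"
proof
  assume "(LINT r:{0<..}|lborel. complex_of_real (bump 1 1 2 r)) = 0"
  then obtain \<phi> where p: "test_fun \<phi>" "deriv \<phi> = bump 1 1 2"
    using test_fun_antideriv[OF test_fun_bump[of 1 1 2]] by auto
  obtain a b where ab: "smooth \<phi>" "0 < a" "a < b" "\<And>x. x \<notin> {a..b} \<Longrightarrow> \<phi> x = 0"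
    using p(1) by (rule test_funE) (rule that)
  have d: "(\<phi> has_real_derivative bump 1 1 2 x) (at x)" for x
    using smooth_has_deriv[OF ab(1), of x] p by simp
  have mono: "\<phi> x \<le> \<phi> y" if "x \<le> y" for x y
    by (rule DERIV_nonneg_imp_nondecreasing[OF that]) (use d in \<open>force simp: bump_def\<close>)
  have "\<phi> 1 < \<phi> 2"
    by (rule DERIV_pos_imp_increasing_open[of 1 2 \<phi>])
       (use d smooth_continuous[OF ab(1)] in \<open>force simp: bump_def\<close>)+
  moreover have "\<phi> (min 1 (a/2)) = 0" "\<phi> (max 2 (b+1)) = 0" using ab by (auto intro!: ab(4))
  moreover have "\<phi> (min 1 (a/2)) \<le> \<phi> 1" "\<phi> 2 \<le> \<phi> (max 2 (b+1))" by (auto intro!: mono)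
  ultimately show False by linarith
qed

text \<open>Subtracting a multiple of one fixed bump makes the integral vanish, so every test function is a derivative
  of a test function up to that multiple.\<close>

lemma test_fun_decompose:
  assumes p: "test_fun \<eta>"
  obtains \<phi> c where "test_fun \<phi>" "deriv \<phi> = (\<lambda>x. \<eta> x + c * bump 1 1 2 x)"
    "(LINT r:{0<..}|lborel. complex_of_real (\<eta> r)) = - complex_of_real c * (LINT r:{0<..}|lborel. complex_of_real (bump 1 1 2 r))"
proof -
  define I where "I = (LINT r:{0<..}|lborel. \<eta> r)"
  define K where "K = (LINT r:{0<..}|lborel. bump 1 1 2 r)"
  have I: "(LINT r:{0<..}|lborel. complex_of_real (\<eta> r)) = complex_of_real I"
    and K: "(LINT r:{0<..}|lborel. complex_of_real (bump 1 1 2 r)) = complex_of_real K"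
    unfolding I_def K_def by (rule set_integral_complex_of_real)+
  have K0: "K \<noteq> 0" using bump_integral_nonzero K by auto
  have tb: "test_fun (bump 1 1 2)" by (rule test_fun_bump) auto
  have "(LINT r:{0<..}|lborel. complex_of_real (\<eta> r + (- I / K) * bump 1 1 2 r)) = 0"
    using pairing_lincomb[of "\<lambda>_. 1", OF _ p tb, of "- I / K"] loc_integrable_continuous[of "\<lambda>_. 1"] I K K0
    by simp
  then obtain \<phi> where "test_fun \<phi>" "deriv \<phi> = (\<lambda>x. \<eta> x + (- I / K) * bump 1 1 2 x)"
    using test_fun_antideriv[OF test_fun_lincomb[OF p tb]] by blast
  then show ?thesis using that[of \<phi> "- I / K"] I K K0 by simp
qed

text \<open>The lemma of du Bois-Reymond; the constant is the pairing of \<open>f\<close> with the normalised fixed bump.\<close>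

lemma weak_deriv_zero_imp_const:
  assumes f: "loc_integrable_pos f"
    and z: "\<And>\<phi>. test_fun \<phi> \<Longrightarrow> (LINT r:{0<..}|lborel. f r * complex_of_real (deriv \<phi> r)) = 0"
  shows "\<exists>c. AE x in lborel. 0 < x \<longrightarrow> f x = c"
proof -
  let ?b = "bump 1 1 2"
  define K where "K = (LINT r:{0<..}|lborel. complex_of_real (?b r))"
  define C where "C = (LINT r:{0<..}|lborel. f r * complex_of_real (?b r)) / K"
  have K0: "K \<noteq> 0" using bump_integral_nonzero K_def by simp
  have tb: "test_fun ?b" by (rule test_fun_bump) auto
  have one: "loc_integrable_pos (\<lambda>_. 1)" by (rule loc_integrable_continuous) auto
  have "AE x in lborel. 0 < x \<longrightarrow> f x + (- C) * 1 = 0"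
  proof (rule AE_zero_if_pairings_zero)
    show "loc_integrable_pos (\<lambda>x. f x + (- C) * 1)" by (rule loc_integrable_lincomb[OF f one])
    fix \<eta> assume e: "test_fun \<eta>"
    obtain \<phi> c where p: "test_fun \<phi>" "deriv \<phi> = (\<lambda>x. \<eta> x + c * ?b x)"
      "(LINT r:{0<..}|lborel. complex_of_real (\<eta> r)) = - complex_of_real c * K"
      using test_fun_decompose[OF e] unfolding K_def by blast
    have "(LINT r:{0<..}|lborel. f r * complex_of_real (\<eta> r)) + complex_of_real c * (C * K) = 0"
      using z[OF p(1)] pairing_lincomb[OF f e tb, of c] K0 by (simp add: p(2) C_def)
    then show "(LINT r:{0<..}|lborel. (f r + (- C) * 1) * complex_of_real (\<eta> r)) = 0"
      using pairing_lincomb_left[OF f one e, of "- C"] p(3) by (simp add: algebra_simps)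
  qed
  then have "AE x in lborel. 0 < x \<longrightarrow> f x = C" by eventually_elim auto
  then show ?thesis by blast
qed

lemma ac_deriv_of_real_id: "ac_deriv (\<lambda>x. complex_of_real x) (\<lambda>x. 1)"
  by (rule ac_deriv_C1) (auto intro!: derivative_eq_intros)

text \<open>If \<open>\<eta> + c * bump\<close> is the derivative of a test function, then \<open>\<eta>' + c * bump'\<close> is a second derivative.
  Testing with it shows that \<open>f\<close> plus a linear function has vanishing weak first derivative.\<close>

lemma weak_deriv2_zero_imp_affine:
  assumes f: "loc_integrable_pos f"
    and z: "\<And>\<phi>. test_fun \<phi> \<Longrightarrow> (LINT r:{0<..}|lborel. f r * complex_of_real ((deriv ^^ 2) \<phi> r)) = 0"
  shows "\<exists>c d. AE x in lborel. 0 < x \<longrightarrow> f x = c + d * complex_of_real x"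
proof -
  let ?b = "bump 1 1 2"
  define K where "K = (LINT r:{0<..}|lborel. complex_of_real (?b r))"
  define D where "D = (LINT r:{0<..}|lborel. f r * complex_of_real (deriv ?b r)) / K"
  have K0: "K \<noteq> 0" using bump_integral_nonzero K_def by simp
  have tb: "test_fun ?b" by (rule test_fun_bump) auto
  have li: "loc_integrable_pos complex_of_real" by (rule loc_integrable_continuous) (auto intro!: continuous_intros)
  have "\<exists>c. AE x in lborel. 0 < x \<longrightarrow> f x + D * complex_of_real x = c"
  proof (rule weak_deriv_zero_imp_const)
    show "loc_integrable_pos (\<lambda>x. f x + D * complex_of_real x)" by (rule loc_integrable_lincomb[OF f li])
    fix \<eta> assume e: "test_fun \<eta>"
    obtain \<phi> c where p: "test_fun \<phi>" "deriv \<phi> = (\<lambda>x. \<eta> x + c * ?b x)"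
      "(LINT r:{0<..}|lborel. complex_of_real (\<eta> r)) = - complex_of_real c * K"
      using test_fun_decompose[OF e] unfolding K_def by blast
    have sm: "smooth \<eta>" "smooth ?b" using e tb by (meson test_funE)+
    have "deriv (deriv \<phi>) = (\<lambda>x. deriv \<eta> x + c * deriv ?b x)"
      unfolding p(2) by (rule ext, rule DERIV_imp_deriv)
        (auto intro!: derivative_eq_intros smooth_has_deriv sm)
    then have "(deriv ^^ 2) \<phi> = (\<lambda>x. deriv \<eta> x + c * deriv ?b x)" by (simp add: numeral_2_eq_2)
    then have "(LINT r:{0<..}|lborel. f r * complex_of_real (deriv \<eta> r)) + complex_of_real c * (D * K) = 0"
      using z[OF p(1)] pairing_lincomb[OF f test_fun_deriv[OF e] test_fun_deriv[OF tb], of c] K0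
      by (simp add: D_def)
    moreover have "(LINT r:{0<..}|lborel. complex_of_real r * complex_of_real (deriv \<eta> r)) = complex_of_real c * K"
      using pairing_by_parts[OF ac_deriv_of_real_id e] p(3) by simp
    ultimately show "(LINT r:{0<..}|lborel. (f r + D * complex_of_real r) * complex_of_real (deriv \<eta> r)) = 0"
      using pairing_lincomb_left[OF f li test_fun_deriv[OF e], of D] by (simp add: algebra_simps)
  qed
  then obtain c where "AE x in lborel. 0 < x \<longrightarrow> f x + D * complex_of_real x = c" by blast
  then have "AE x in lborel. 0 < x \<longrightarrow> f x = c + (- D) * complex_of_real x"
    by eventually_elim (auto simp: algebra_simps)
  then show ?thesis by blast
qed

lemma pairing_cong_AE:
  assumes "loc_integrable_pos u" "loc_integrable_pos v" "AE x in lborel. 0 < x \<longrightarrow> u x = v x" "test_fun \<phi>"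
  shows "(LINT r:{0<..}|lborel. u r * complex_of_real (\<phi> r)) = (LINT r:{0<..}|lborel. v r * complex_of_real (\<phi> r))"
proof (rule set_cong_AE(2))
  show "set_borel_measurable lborel {0<..} (\<lambda>r. u r * complex_of_real (\<phi> r))"
    "set_borel_measurable lborel {0<..} (\<lambda>r. v r * complex_of_real (\<phi> r))"
    using pairing_integrable[OF assms(1,4)] pairing_integrable[OF assms(2,4)]
    unfolding set_integrable_def set_borel_measurable_def by auto
  show "AE x in lborel. x \<in> {0<..} \<longrightarrow> u x * complex_of_real (\<phi> x) = v x * complex_of_real (\<phi> x)"
    using assms(3) by eventually_elim auto
qed

lemma test_fun_deriv_n: "test_fun \<phi> \<Longrightarrow> test_fun ((deriv ^^ n) \<phi>)"
  by (induction n) (auto intro: test_fun_deriv)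

lemma has_weak_deriv_unique:
  assumes "has_weak_deriv n u v" "has_weak_deriv n u v'"
  shows "AE x in lborel. 0 < x \<longrightarrow> v x = v' x"
proof -
  have l: "loc_integrable_pos v" "loc_integrable_pos v'" using assms unfolding has_weak_deriv_def by auto
  have "AE x in lborel. 0 < x \<longrightarrow> v x + (-1) * v' x = 0"
  proof (rule AE_zero_if_pairings_zero)
    show "loc_integrable_pos (\<lambda>x. v x + (-1) * v' x)" by (rule loc_integrable_lincomb[OF l])
    fix \<phi> assume p: "test_fun \<phi>"
    have "(- 1) ^ n * (LINT r:{0<..}|lborel. v r * complex_of_real (\<phi> r)) = (- 1) ^ n * (LINT r:{0<..}|lborel. v' r * complex_of_real (\<phi> r))"
      using assms(1)[unfolded has_weak_deriv_def, THEN conjunct2, THEN conjunct2, rule_format, OF p, symmetric]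
        assms(2)[unfolded has_weak_deriv_def, THEN conjunct2, THEN conjunct2, rule_format, OF p] by (rule trans)
    then have "(LINT r:{0<..}|lborel. v r * complex_of_real (\<phi> r)) = (LINT r:{0<..}|lborel. v' r * complex_of_real (\<phi> r))"
      by simp
    then show "(LINT r:{0<..}|lborel. (v r + (-1) * v' r) * complex_of_real (\<phi> r)) = 0"
      using pairing_lincomb_left[OF l p, of "-1"] by simp
  qed
  then show ?thesis by eventually_elim auto
qed

lemma ac_deriv_imp_weak_deriv1:
  assumes "ac_deriv u v" and w: "loc_integrable_pos w" "AE x in lborel. 0 < x \<longrightarrow> w x = u x"
  shows "has_weak_deriv 1 w v"
  unfolding has_weak_deriv_def
proof (intro conjI allI impI w ac_deriv_loc_integrable[OF assms(1)])
  fix \<phi> assume p: "test_fun \<phi>"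
  show "(LINT r:{0<..}|lborel. w r * complex_of_real ((deriv ^^ 1) \<phi> r)) = (- 1) ^ 1 * (LINT r:{0<..}|lborel. v r * complex_of_real (\<phi> r))"
    using pairing_by_parts[OF assms(1) p]
      pairing_cong_AE[OF w(1) loc_integrable_continuous[OF ac_deriv_continuous[OF assms(1)]] w(2) test_fun_deriv[OF p]]
    by simp
qed

lemma ac_deriv_imp_weak_deriv2:
  assumes "ac_deriv u u1" "ac_deriv u1 v" and w: "loc_integrable_pos w" "AE x in lborel. 0 < x \<longrightarrow> w x = u x"
  shows "has_weak_deriv 2 w v"
  unfolding has_weak_deriv_def
proof (intro conjI allI impI w ac_deriv_loc_integrable[OF assms(2)])
  fix \<phi> assume p: "test_fun \<phi>"
  show "(LINT r:{0<..}|lborel. w r * complex_of_real ((deriv ^^ 2) \<phi> r)) = (- 1) ^ 2 * (LINT r:{0<..}|lborel. v r * complex_of_real (\<phi> r))"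
    using pairing_by_parts[OF assms(1) test_fun_deriv[OF p]] pairing_by_parts[OF assms(2) p]
      pairing_cong_AE[OF w(1) loc_integrable_continuous[OF ac_deriv_continuous[OF assms(1)]] w(2) test_fun_deriv_n[OF p, of 2]]
    by (simp add: numeral_2_eq_2)
qed

text \<open>The difference of \<open>w\<close> and an iterated primitive of \<open>v\<close> is affine by the previous lemma.\<close>

lemma weak_deriv2_imp_ac_deriv:
  assumes "has_weak_deriv 2 w v"
  obtains u u1 where "ac_deriv u u1" "ac_deriv u1 v" "AE x in lborel. 0 < x \<longrightarrow> w x = u x"
proof -
  have l: "loc_integrable_pos w" "loc_integrable_pos v" using assms unfolding has_weak_deriv_def by auto
  note p1 = ac_deriv_primitive[OF l(2)]
  have lp1: "loc_integrable_pos (primitive v)" by (rule loc_integrable_continuous[OF ac_deriv_continuous[OF p1]])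
  note p = ac_deriv_primitive[OF lp1]
  have lp: "loc_integrable_pos (primitive (primitive v))" by (rule loc_integrable_continuous[OF ac_deriv_continuous[OF p]])
  have hp: "has_weak_deriv 2 (primitive (primitive v)) v" by (rule ac_deriv_imp_weak_deriv2[OF p p1 lp]) auto
  have "\<exists>c d. AE x in lborel. 0 < x \<longrightarrow> w x + (-1) * primitive (primitive v) x = c + d * complex_of_real x"
  proof (rule weak_deriv2_zero_imp_affine)
    show "loc_integrable_pos (\<lambda>x. w x + (-1) * primitive (primitive v) x)" by (rule loc_integrable_lincomb[OF l(1) lp])
    fix \<phi> assume t: "test_fun \<phi>"
    show "(LINT r:{0<..}|lborel. (w r + (-1) * primitive (primitive v) r) * complex_of_real ((deriv ^^ 2) \<phi> r)) = 0"
      using pairing_lincomb_left[OF l(1) lp test_fun_deriv_n[OF t, of 2], of "-1"] assms hp t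
      unfolding has_weak_deriv_def by simp
  qed
  then obtain c d where "AE x in lborel. 0 < x \<longrightarrow> w x + (-1) * primitive (primitive v) x = c + d * complex_of_real x" by blast
  then have "AE x in lborel. 0 < x \<longrightarrow> w x = primitive (primitive v) x + (c + d * complex_of_real x)"
    by eventually_elim (auto simp: algebra_simps)
  moreover have "ac_deriv (\<lambda>x. primitive (primitive v) x + (c + d * complex_of_real x)) (\<lambda>x. primitive v x + (0 + d * 1))"
    by (intro ac_deriv_add p ac_deriv_const ac_deriv_cmult ac_deriv_of_real_id)
  moreover have "ac_deriv (\<lambda>x. primitive v x + (0 + d * 1)) v" using ac_deriv_add[OF p1 ac_deriv_const[of "0 + d * 1"]] by simp
  ultimately show ?thesis using that by blast
qed


section \<open>The vorticity profile\<close>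

text \<open>The integral of the squared ground state \<open>r powr (3 / 2) * gauss r\<close> over \<open>{0<..r}\<close>, which is also
  \<open>- r ^ 3\<close> times the derivative of \<open>sigma\<close>. This coincidence is what makes the Darboux transform below
  diagonalise the nonlocal operator.\<close>

definition mass :: "real \<Rightarrow> real" where
  "mass r = 8 * (1 - exp (- (r\<^sup>2 / 4))) - 2 * r\<^sup>2 * exp (- (r\<^sup>2 / 4))"

text \<open>This is \<open>- 2\<close> times the second derivative of \<open>ln mass\<close>, the change of potential under double commutation
  with the ground state.\<close>

definition darboux_pot :: "real \<Rightarrow> real" where
  "darboux_pot r = 2 * ((r ^ 3 * exp (- (r\<^sup>2 / 4)))\<^sup>2 - mass r * ((3 * r\<^sup>2 - r ^ 4 / 2) * exp (- (r\<^sup>2 / 4)))) / (mass r)\<^sup>2"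

definition harmonic_pot :: "real \<Rightarrow> real" where
  "harmonic_pot r = 3 / (4 * r\<^sup>2) + r\<^sup>2 / 16 - 1 / 2"

lemma mass_deriv: "(mass has_real_derivative r ^ 3 * exp (- (r\<^sup>2 / 4))) (at r)"
  unfolding mass_def
  by (auto intro!: derivative_eq_intros simp: field_simps power2_eq_square power3_eq_cube)

lemma exp_ge_quadratic: "1 + t + t\<^sup>2 / 2 \<le> exp t" if "0 \<le> (t::real)" for t
  by (rule exp_lower_Taylor_quadratic[OF that])

lemma mass_alt: "mass r = 8 * exp (- (r\<^sup>2 / 4)) * (exp (r\<^sup>2 / 4) - 1 - r\<^sup>2 / 4)"
  unfolding mass_def by (simp add: algebra_simps exp_minus_inverse flip: exp_add)

lemma mass_lower: "mass r \<ge> exp (- (r\<^sup>2 / 4)) * r ^ 4 / 4"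
proof -
  have "exp (r\<^sup>2 / 4) - 1 - r\<^sup>2 / 4 \<ge> (r\<^sup>2 / 4)\<^sup>2 / 2"
    using exp_ge_quadratic[of "r\<^sup>2 / 4"] by simp
  then have "8 * exp (- (r\<^sup>2 / 4)) * (exp (r\<^sup>2 / 4) - 1 - r\<^sup>2 / 4) \<ge> 8 * exp (- (r\<^sup>2 / 4)) * ((r\<^sup>2 / 4)\<^sup>2 / 2)"
    by (intro mult_left_mono) auto
  then show ?thesis unfolding mass_alt by (simp add: power2_eq_square power4_eq_xxxx)
qed

lemma mass_pos: "0 < r \<Longrightarrow> 0 < mass r"
  by (rule less_le_trans[OF _ mass_lower]) simp

lemma mass_mono: "0 \<le> r \<Longrightarrow> r \<le> s \<Longrightarrow> mass r \<le> mass s"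
  by (rule DERIV_nonneg_imp_nondecreasing[of r s mass]) (auto intro!: exI mass_deriv)

lemma mass_le: "mass r \<le> 8"
proof -
  have "0 \<le> 2 * r\<^sup>2 * exp (- (r\<^sup>2 / 4))" "0 \<le> exp (- (r\<^sup>2 / 4))" by simp_all
  moreover have "8 * (1 - e) - y \<le> 8" if "0 \<le> y" "0 \<le> e" for e y :: real
    using that by simp
  ultimately show ?thesis unfolding mass_def by blast
qed

text \<open>The difference of the two sides vanishes at zero together with its first derivative, and its second
  derivative is \<open>1 - exp t + t * exp t\<close>, which is nonnegative because \<open>exp (- t) \<ge> 1 - t\<close>.\<close>

lemma exp_remainder_bound:
  fixes t :: real
  assumes "0 \<le> t"
  shows "(3 - t) * (exp t - 1 - t) \<le> 3 / 2 * t\<^sup>2"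
proof -
  let ?h = "\<lambda>t::real. 3 / 2 * t\<^sup>2 - (3 - t) * (exp t - 1 - t)"
  let ?h1 = "\<lambda>t::real. 2 + t - 2 * exp t + t * exp t"
  have d1: "(?h has_real_derivative ?h1 x) (at x)" for x
    by (auto intro!: derivative_eq_intros simp: algebra_simps)
  have d2: "(?h1 has_real_derivative (1 - exp x + x * exp x)) (at x)" for x
    by (auto intro!: derivative_eq_intros simp: algebra_simps)
  have p2: "1 - exp x + x * exp x \<ge> 0" for x :: real
  proof -
    have "(1 - x) * exp x \<le> exp (- x) * exp x"
      using exp_ge_add_one_self[of "- x"] by (intro mult_right_mono) auto
    then show ?thesis by (simp add: algebra_simps flip: exp_add)
  qed
  have p1: "?h1 x \<ge> 0" if "x \<ge> 0" for x
    using DERIV_nonneg_imp_nondecreasing[OF that, of ?h1] d2 p2 by fastforce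
  have "?h 0 \<le> ?h t"
    by (rule DERIV_nonneg_imp_nondecreasing[OF assms]) (use d1 p1 in blast)
  then show ?thesis by simp
qed

text \<open>In the variable \<open>t\<close> the Darboux potential equals \<open>t * (2 * t\<^sup>2 - (3 - 2 * t) * X) / X\<^sup>2\<close>.\<close>

lemma darboux_pot_lower:
  assumes r: "0 < r"
  defines "t \<equiv> r\<^sup>2 / 4"
  defines "X \<equiv> exp t - 1 - t"
  shows "darboux_pot r \<ge> t ^ 3 / (2 * X\<^sup>2) + t\<^sup>2 / X" "X > 0"
proof -
  have t: "t > 0" using r unfolding t_def by simp
  show X: "X > 0" unfolding X_def using exp_ge_quadratic[of t] t
    by (smt (verit) half_gt_zero zero_less_power)
  have m: "mass r = 8 * exp (- t) * X" unfolding X_def t_def by (rule mass_alt)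
  have r6: "(r ^ 3 * y)\<^sup>2 = 64 * t ^ 3 * y\<^sup>2" and r24: "3 * r\<^sup>2 - r ^ 4 / 2 = 4 * t * (3 - 2 * t)" for y
    unfolding t_def by (simp_all add: power2_eq_square power3_eq_cube power4_eq_xxxx algebra_simps)
  have "darboux_pot r = 2 * (64 * t ^ 3 * (exp (- t))\<^sup>2 - 8 * exp (- t) * X * (4 * t * (3 - 2 * t) * exp (- t))) / (8 * exp (- t) * X)\<^sup>2"
    unfolding darboux_pot_def m r24 r6 by (simp add: t_def[symmetric])
  also have "\<dots> = t * (2 * t\<^sup>2 - (3 - 2 * t) * X) / X\<^sup>2"
    using X by (simp add: field_simps power2_eq_square power3_eq_cube)
  also have "\<dots> \<ge> t * (t\<^sup>2 / 2 + t * X) / X\<^sup>2"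
  proof (intro divide_right_mono mult_left_mono)
    show "t\<^sup>2 / 2 + t * X \<le> 2 * t\<^sup>2 - (3 - 2 * t) * X"
      using exp_remainder_bound[of t] t unfolding X_def[symmetric] by (simp add: algebra_simps)
  qed (use t in auto)
  also have "t * (t\<^sup>2 / 2 + t * X) / X\<^sup>2 = t ^ 3 / (2 * X\<^sup>2) + t\<^sup>2 / X"
    using X by (simp add: field_simps power2_eq_square power3_eq_cube)
  finally show "darboux_pot r \<ge> t ^ 3 / (2 * X\<^sup>2) + t\<^sup>2 / X" .
qed

text \<open>The oscillator part alone is negative around \<open>t = r\<^sup>2 / 4 = 1\<close>, by the value of the zero-point energy. There the
  Darboux potential is at least \<open>2 / 3\<close>; for \<open>t > 2\<close> the oscillator suffices.\<close>

lemma effective_potential_lower: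
  assumes r: "0 < r"
  shows "harmonic_pot r + darboux_pot r \<ge> (1 + r\<^sup>2) / 400"
proof -
  define t where "t = r\<^sup>2 / 4"
  define X where "X = exp t - 1 - t"
  have t: "t > 0" using r unfolding t_def by simp
  have d: "darboux_pot r \<ge> t ^ 3 / (2 * X\<^sup>2) + t\<^sup>2 / X" and X: "X > 0"
    using darboux_pot_lower[OF r] unfolding X_def t_def by auto
  have q: "harmonic_pot r = 3 / (16 * t) + t / 4 - 1 / 2"
    unfolding harmonic_pot_def t_def using r by simp
  have "(1 + r\<^sup>2) / 400 \<le> (1 + t) / 100" unfolding t_def by simp
  also have "\<dots> \<le> harmonic_pot r + darboux_pot r"
  proof (cases "t \<le> 2")
    case True
    have "X * 1 \<le> (3 - t) * X" using True X by (simp add: mult_le_cancel_right1)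
    also have "\<dots> \<le> 3 / 2 * t\<^sup>2" using exp_remainder_bound[of t] t unfolding X_def by simp
    finally have Xt: "X \<le> 3 / 2 * t\<^sup>2" by simp
    have "t\<^sup>2 / X \<ge> t\<^sup>2 / (3 / 2 * t\<^sup>2)" by (rule divide_left_mono[OF Xt]) (use X t in auto)
    then have "t\<^sup>2 / X \<ge> 2 / 3" using t by simp
    moreover have "t ^ 3 / (2 * X\<^sup>2) \<ge> 0" using t by simp
    ultimately have "darboux_pot r \<ge> 2 / 3" using d by linarith
    moreover have "harmonic_pot r \<ge> t / 4 - 1 / 2" unfolding q using t by simp
    ultimately show ?thesis using True t by (simp add: add_divide_distrib)
  next
    case False
    have "(1 + t) / 100 * t \<le> (3 / (16 * t) + t / 4 - 1 / 2) * t"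
    proof -
      have a: "(t - 2) * (24 * t - 3) \<ge> 0" using False by (intro mult_nonneg_nonneg) auto
      have b: "(3 / (16 * t) + t / 4 - 1 / 2) * t = 3 / 16 + t * t / 4 - t / 2"
        using t by (simp add: field_simps)
      have "(t - 2) * (24 * t - 3) = 24 * (t * t) - 51 * t + 6" "(1 + t) / 100 * t = t / 100 + t * t / 100"
        by (simp_all add: field_simps)
      then show ?thesis unfolding b using a by simp
    qed
    then have "(1 + t) / 100 \<le> harmonic_pot r" unfolding q using t by (simp only: mult_le_cancel_right_pos)
    moreover have "darboux_pot r \<ge> 0" using d t X by (smt (verit) divide_nonneg_nonneg zero_le_power zero_le_power2)
    ultimately show ?thesis by linarith
  qed
  finally show ?thesis .
qed

subsection \<open>Monotonicity of the rotation rate\<close>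

lemma sigma_deriv: "(sigma has_real_derivative - (mass r / r ^ 3)) (at r)" if "0 < r"
proof -
  have "((\<lambda>r. (1 - exp (- (r\<^sup>2 / 4))) / (r\<^sup>2 / 4)) has_real_derivative - (mass r / r ^ 3)) (at r)"
    unfolding mass_def using that
    by (auto intro!: derivative_eq_intros simp: field_simps power2_eq_square power3_eq_cube)
  then show ?thesis unfolding sigma_def[abs_def] .
qed

lemma sigma_decreasing: "0 < r \<Longrightarrow> r \<le> s \<Longrightarrow> sigma s \<le> sigma r"
  by (rule DERIV_nonpos_imp_nonincreasing[of r s sigma])
     (force intro!: exI conjI sigma_deriv simp: less_imp_le[OF mass_pos])+

lemma sigma_pos: "0 < r \<Longrightarrow> 0 < sigma r"
  unfolding sigma_def by simp

lemma sigma_le_1: "0 < r \<Longrightarrow> sigma r \<le> 1"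
  unfolding sigma_def using exp_ge_add_one_self[of "- (r\<^sup>2 / 4)"] by (simp add: field_simps)

lemma sigma_slope:
  assumes "0 < r"
  shows "mass r / r ^ 3 \<ge> min r (1 / r ^ 3) / 12"
proof (cases "r \<le> 2")
  case True
  then have "r\<^sup>2 \<le> 2\<^sup>2" using assms by (intro power_mono) auto
  then have "exp (- (r\<^sup>2 / 4)) \<ge> exp (- 1)" by simp
  moreover have "exp (- 1) \<ge> (1 / 3 :: real)"
    using exp_le by (simp add: exp_minus field_simps)
  ultimately have e: "exp (- (r\<^sup>2 / 4)) \<ge> 1 / 3" by linarith
  have "1 / 3 * r ^ 4 / 4 \<le> exp (- (r\<^sup>2 / 4)) * r ^ 4 / 4"
    by (intro divide_right_mono mult_right_mono e) auto
  also have "\<dots> \<le> mass r" by (rule mass_lower)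
  finally have "1 / 3 * r ^ 4 / 4 / r ^ 3 \<le> mass r / r ^ 3"
    by (rule divide_right_mono) (use assms in auto)
  moreover have "1 / 3 * r ^ 4 / 4 / r ^ 3 = r / 12" using assms by (simp add: power3_eq_cube power4_eq_xxxx)
  ultimately have "r / 12 \<le> mass r / r ^ 3" by metis
  moreover have "min r (1 / r ^ 3) / 12 \<le> r / 12" by simp
  ultimately show ?thesis by (rule order_trans[rotated])
next
  case False
  have "exp (- 1) \<ge> (1 / 3 :: real)"
    using exp_le by (simp add: exp_minus field_simps)
  then have "1 \<le> exp (- 1) * 2 ^ 4 / (4::real)" by simp
  also have "\<dots> \<le> mass 2" using mass_lower[of 2] by simp
  also have "\<dots> \<le> mass r" by (rule mass_mono) (use False in auto)
  finally have "1 / r ^ 3 \<le> mass r / r ^ 3" using assms by (intro divide_right_mono) auto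
  moreover have "y / 12 \<le> y" if "0 \<le> y" for y :: real using that by simp
  then have "1 / r ^ 3 / 12 \<le> 1 / r ^ 3" using assms by (meson less_imp_le zero_less_divide_1_iff zero_less_power)
  moreover have "min r (1 / r ^ 3) / 12 \<le> 1 / r ^ 3 / 12" by simp
  ultimately show ?thesis by (meson order_trans)
qed

text \<open>Over the second half of \<open>{x..x + h}\<close> the argument is at least \<open>h / 2\<close>, so the slope is not degenerate
  there even if \<open>x\<close> is close to the origin.\<close>

lemma sigma_drop:
  assumes x: "0 < x" and h: "0 < h" "x + h \<le> y" and S: "x + h \<le> S"
  shows "sigma x - sigma y \<ge> h / 2 * (min (h / 2) (1 / S ^ 3) / 12)"
proof -
  have "x + h/2 < x + h" using h by simp
  moreover have "(sigma has_real_derivative - (mass z / z ^ 3)) (at z)" if "x + h / 2 \<le> z" for z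
    by (rule sigma_deriv) (use that x h in auto)
  ultimately obtain z where z: "x + h / 2 < z" "z < x + h" "sigma (x + h) - sigma (x + h/2) = (x + h - (x + h/2)) * - (mass z / z ^ 3)"
    using MVT2[of "x + h/2" "x + h" sigma "\<lambda>z. - (mass z / z ^ 3)"] by auto
  have z0: "z > 0" using z x h by auto
  have "1 / S ^ 3 \<le> 1 / z ^ 3" using z z0 S by (intro divide_left_mono power_mono) auto
  then have "min (h / 2) (1 / S ^ 3) / 12 \<le> min z (1 / z ^ 3) / 12" using z x by auto
  also have "\<dots> \<le> mass z / z ^ 3" by (rule sigma_slope[OF z0])
  finally have "h / 2 * (min (h / 2) (1 / S ^ 3) / 12) \<le> h / 2 * (mass z / z ^ 3)"
    using h by (intro mult_left_mono) auto
  also have "\<dots> = sigma (x + h/2) - sigma (x + h)" using z(3) by simp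
  also have "\<dots> \<le> sigma x - sigma y"
    using sigma_decreasing[of x "x + h/2"] sigma_decreasing[of "x + h" y] x h by auto
  finally show ?thesis .
qed

lemma sigma_surj:
  assumes "0 < \<mu>" "\<mu> < 1"
  obtains r where "0 < r" "sigma r = \<mu>"
proof -
  define a where "a = sqrt (4 * (1 - \<mu>))"
  define b where "b = max a (2 / sqrt \<mu>)"
  have a: "a > 0" "a\<^sup>2 = 4 * (1 - \<mu>)" unfolding a_def using assms by auto
  have b: "b > 0" "a \<le> b" unfolding b_def using a by auto
  have "(2 / sqrt \<mu>)\<^sup>2 \<le> b\<^sup>2" unfolding b_def using assms a by (intro power_mono) auto
  then have b2: "4 / \<mu> \<le> b\<^sup>2" using assms by (simp add: power_divide)
  have "sigma a \<ge> \<mu>"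
  proof -
    define t where "t = 1 - \<mu>"
    have t: "0 < t" "t < 1" using assms unfolding t_def by auto
    have e: "exp (- t) \<le> 1 / (1 + t)"
      using exp_ge_add_one_self[of t] t by (simp add: exp_minus field_simps)
    have "1 - 1 / (1 + t) = t / (1 + t)" using t by (simp add: field_simps)
    then have "t / (1 + t) \<le> 1 - exp (- t)" using e by linarith
    then have "t / (1 + t) / t \<le> (1 - exp (- t)) / t" using t by (intro divide_right_mono) auto
    moreover have "t / (1 + t) / t = 1 / (1 + t)" using t by simp
    moreover have "1 / (1 + t) \<ge> 1 - t" using t by (simp add: field_simps)
    moreover have "sigma a = (1 - exp (- t)) / t"
    proof -
      have "a\<^sup>2 / 4 = t" unfolding a(2) t_def by simp
      then show ?thesis unfolding sigma_def by simp
    qed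
    ultimately show ?thesis unfolding t_def by linarith
  qed
  moreover have "sigma b \<le> \<mu>"
  proof -
    have "sigma b \<le> 1 / (b\<^sup>2 / 4)" unfolding sigma_def using b by (intro divide_right_mono) auto
    also have "\<dots> \<le> \<mu>" using b2 assms b by (simp add: field_simps)
    finally show ?thesis .
  qed
  moreover have "\<forall>x. a \<le> x \<and> x \<le> b \<longrightarrow> isCont sigma x"
    using sigma_deriv DERIV_isCont a by (meson less_le_trans)
  ultimately obtain r where "a \<le> r" "r \<le> b" "sigma r = \<mu>"
    using IVT2[of sigma b \<mu> a] b by blast
  then show ?thesis by (intro that[of r]) (use a in auto)
qed

text \<open>A regularised sign of \<open>sigma - \<mu>\<close> on the length scale \<open>d\<close>, here \<open>arctan ((r0 - r) / d)\<close> with \<open>sigma r0 = \<mu>\<close>.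
  If \<open>\<mu> \<ge> 1\<close> the critical radius is moved to 0, and if \<open>\<mu> \<le> 0\<close> the multiplier is constant. The quantity
  \<open>\<kappa>\<close> bounds the oscillation of \<open>sigma\<close> over a distance \<open>d / 2\<close> inside \<open>r \<le> R + d\<close> from below.\<close>

lemma multiplier_exists:
  assumes d: "0 < d" and R: "0 < R"
  defines "\<kappa> \<equiv> d / 4 * (min (d / 4) (1 / (R + d) ^ 3) / 12)"
  obtains ch ch' r0 where
    "\<And>r. (ch has_real_derivative ch' r) (at r)" "continuous_on UNIV ch'"
    "\<And>r. \<bar>ch r\<bar> \<le> 2" "\<And>r. \<bar>ch' r\<bar> \<le> 1 / d"
    "\<And>r. 0 < r \<Longrightarrow> ch r * (sigma r - \<mu>) \<ge> 0"
    "\<And>r. 0 < r \<Longrightarrow> r \<le> R \<Longrightarrow> d \<le> \<bar>r - r0\<bar> \<Longrightarrow> ch r * (sigma r - \<mu>) \<ge> \<kappa> / 2"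
proof -
  have k0: "\<kappa> \<ge> 0" unfolding \<kappa>_def using d R by auto
  have drop: "sigma x - sigma y \<ge> \<kappa>" if "0 < x" "x + d / 2 \<le> y" "x + d / 2 \<le> R + d" for x y
    using sigma_drop[of x "d/2" y "R + d"] that d unfolding \<kappa>_def by simp
  \<comment> \<open>At distance at least \<open>d\<close> from \<open>r0\<close> the multiplier is at least \<open>pi / 4\<close> in modulus.\<close>
  define X where "X = (\<lambda>r0 r. arctan ((r0 - r) / d))"
  define X' where "X' = (\<lambda>r0 r. - (1 / d) / (1 + ((r0 - r) / d)\<^sup>2))"
  have Xd: "(X r0 has_real_derivative X' r0 r) (at r)" for r0 r
    unfolding X_def X'_def using d by (auto intro!: derivative_eq_intros simp: divide_simps)
  have Xc: "continuous_on UNIV (X' r0)" for r0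
  proof -
    have y: "1 + y\<^sup>2 \<noteq> 0" for y :: real by (smt (verit) zero_le_power2)
    have dn: "d \<noteq> 0" using d by simp
    show ?thesis unfolding X'_def by (intro continuous_intros ballI) (simp_all only: dn y not_False_eq_True)
  qed
  have Xb: "\<bar>X r0 r\<bar> \<le> 2" for r0 r
    using arctan_bounded[of "(r0 - r) / d"] pi_less_4 unfolding X_def by linarith
  have Xb': "\<bar>X' r0 r\<bar> \<le> 1 / d" for r0 r
  proof -
    have "1 / d / (1 + ((r0 - r) / d)\<^sup>2) \<le> 1 / d / 1"
      using d by (intro divide_left_mono) (auto intro: add_pos_nonneg)
    then show ?thesis unfolding X'_def using d by (simp add: abs_mult)
  qed
  have big: "X r0 r \<ge> 1 / 2" if "r + d \<le> r0" for r r0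
  proof -
    have "1 \<le> (r0 - r) / d" using that d by (simp add: field_simps)
    then have "arctan 1 \<le> X r0 r" unfolding X_def by (rule arctan_monotone')
    then show ?thesis using pi_gt3 by (simp add: arctan_one)
  qed
  have small: "X r0 r \<le> - 1 / 2" if "r0 + d \<le> r" for r r0
  proof -
    have "(r0 - r) / d \<le> - 1" using that d by (simp add: field_simps)
    then have "X r0 r \<le> arctan (-1)" unfolding X_def by (rule arctan_monotone')
    then show ?thesis using pi_gt3 by (simp add: arctan_one arctan_minus)
  qed
  have nn: "X r0 r \<ge> 0" if "r \<le> r0" for r r0
    unfolding X_def using that d by simp
  have np: "X r0 r \<le> 0" if "r0 \<le> r" for r r0
    unfolding X_def using that d by (simp add: divide_nonpos_pos)
  have pos: "X r0 r * y \<ge> \<kappa> / 2" if "r + d \<le> r0" "y \<ge> \<kappa>" for r r0 y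
  proof -
    have "1 / 2 * \<kappa> \<le> X r0 r * y" by (rule mult_mono) (use big[OF that(1)] that k0 in auto)
    then show ?thesis by simp
  qed
  have neg: "X r0 r * y \<ge> \<kappa> / 2" if "r0 + d \<le> r" "y \<le> - \<kappa>" for r r0 y
  proof -
    have "1 / 2 * \<kappa> \<le> (- X r0 r) * (- y)" by (rule mult_mono) (use small[OF that(1)] that k0 in auto)
    then show ?thesis by simp
  qed
  consider "\<mu> \<le> 0" | "1 \<le> \<mu>" | "0 < \<mu>" "\<mu> < 1" by linarith
  then show ?thesis
  proof cases
    case 1
    show ?thesis
    proof (rule that[of "\<lambda>_. 1" "\<lambda>_. 0" 0])
      fix r :: real assume r: "0 < r"
      show "1 * (sigma r - \<mu>) \<ge> 0" using sigma_pos[OF r] 1 by simp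
      assume "r \<le> R"
      then have "\<kappa> \<le> sigma r - sigma (r + d)" using drop[of r "r + d"] r d by simp
      then show "\<kappa> / 2 \<le> 1 * (sigma r - \<mu>)" using sigma_pos[of "r + d"] r d 1 k0 by simp
    qed (use d in auto)
  next
    case 2
    show ?thesis
    proof (rule that[OF Xd Xc Xb Xb', of 0])
      fix r :: real assume r: "0 < r"
      show "X 0 r * (sigma r - \<mu>) \<ge> 0"
        using np[of 0 r] r sigma_le_1[OF r] 2 by (intro mult_nonpos_nonpos) auto
      assume rR: "r \<le> R" and rd: "d \<le> \<bar>r - 0\<bar>"
      have "\<kappa> \<le> sigma (r/2) - sigma r" using drop[of "r/2" r] r rR rd d by simp
      then have "sigma r - \<mu> \<le> - \<kappa>" using sigma_le_1[of "r/2"] r 2 by simp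
      then show "\<kappa> / 2 \<le> X 0 r * (sigma r - \<mu>)" using neg[of 0 r] rd r by simp
    qed
  next
    case 3
    then obtain r0 where r0: "0 < r0" "sigma r0 = \<mu>" by (rule sigma_surj)
    show ?thesis
    proof (rule that[OF Xd Xc Xb Xb', of r0])
      fix r :: real assume r: "0 < r"
      show "X r0 r * (sigma r - \<mu>) \<ge> 0"
      proof (cases "r \<le> r0")
        case True
        then show ?thesis using nn[OF True] sigma_decreasing[OF r True] r0 by simp
      next
        case False
        then show ?thesis using np[of r0 r] sigma_decreasing[OF r0(1), of r] r0
          by (intro mult_nonpos_nonpos) auto
      qed
      assume rR: "r \<le> R" and rd: "d \<le> \<bar>r - r0\<bar>"
      show "\<kappa> / 2 \<le> X r0 r * (sigma r - \<mu>)"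
      proof (cases "r \<le> r0")
        case True
        then have "r + d \<le> r0" using rd by simp
        moreover have "\<kappa> \<le> sigma r - \<mu>" using drop[of r r0] r rR d \<open>r + d \<le> r0\<close> r0 by simp
        ultimately show ?thesis by (rule pos)
      next
        case False
        then have "r0 + d \<le> r" using rd by simp
        moreover have "sigma r - \<mu> \<le> - \<kappa>" using drop[of r0 r] r0 rR d \<open>r0 + d \<le> r\<close> by simp
        ultimately show ?thesis by (rule neg)
      qed
    qed
  qed
qed


section \<open>The resolvent estimate for a local half-line operator\<close>

lemma set_integral_mono_set:
  fixes f :: "real \<Rightarrow> real"
  assumes "set_integrable M B f" "A \<in> sets M" "A \<subseteq> B" "\<And>x. x \<in> B \<Longrightarrow> 0 \<le> f x"
  shows "(LINT x:A|M. f x) \<le> (LINT x:B|M. f x)"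
  unfolding set_lebesgue_integral_def
  by (rule integral_mono)
     (use assms set_integrable_subset[OF assms(1-3)] in \<open>auto simp: set_integrable_def indicator_def\<close>)

lemma set_integral_nonneg:
  fixes f :: "real \<Rightarrow> real"
  assumes "\<And>x. x \<in> A \<Longrightarrow> 0 \<le> f x"
  shows "0 \<le> (LINT x:A|M. f x)"
  unfolding set_lebesgue_integral_def
  by (rule Bochner_Integration.integral_nonneg) (auto simp: indicator_def assms)

lemma set_integral_Re:
  assumes "set_integrable M A f"
  shows "set_integrable M A (\<lambda>x. Re (f x))" "(LINT x:A|M. Re (f x)) = Re (LINT x:A|M. f x)"
proof -
  have eq: "(\<lambda>x. indicator A x *\<^sub>R Re (f x)) = (\<lambda>x. Re (indicator A x *\<^sub>R f x))" by auto
  show "set_integrable M A (\<lambda>x. Re (f x))"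
    using integrable_Re[OF assms[unfolded set_integrable_def]] unfolding set_integrable_def eq .
  show "(LINT x:A|M. Re (f x)) = Re (LINT x:A|M. f x)"
    using integral_Re[OF assms[unfolded set_integrable_def]] unfolding set_lebesgue_integral_def eq .
qed

lemma set_integral_Im:
  assumes "set_integrable M A f"
  shows "set_integrable M A (\<lambda>x. Im (f x))" "(LINT x:A|M. Im (f x)) = Im (LINT x:A|M. f x)"
proof -
  have eq: "(\<lambda>x. indicator A x *\<^sub>R Im (f x)) = (\<lambda>x. Im (indicator A x *\<^sub>R f x))" by auto
  show "set_integrable M A (\<lambda>x. Im (f x))"
    using integrable_Im[OF assms[unfolded set_integrable_def]] unfolding set_integrable_def eq .
  show "(LINT x:A|M. Im (f x)) = Im (LINT x:A|M. f x)"
    using integral_Im[OF assms[unfolded set_integrable_def]] unfolding set_lebesgue_integral_def eq .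
qed

lemma exhaust_half_line:
  fixes f :: "real \<Rightarrow> 'a :: {banach, second_countable_topology}"
  assumes "set_integrable lborel {0<..} f"
  shows "(\<lambda>k. LINT x:{1 / Suc k..Suc k}|lborel. f x) \<longlonglongrightarrow> (LINT x:{0<..}|lborel. f x)"
proof -
  have un: "(\<Union>k. {1 / real (Suc k)..real (Suc k)}) = {0<..}"
  proof (intro set_eqI iffI)
    fix x :: real assume "x \<in> {0<..}"
    then have "0 < x" by simp
    then obtain m where "\<And>k. m \<le> k \<Longrightarrow> x \<in> {1 / real (Suc k)..real (Suc k)}"
      by (rule exhaust_eventually) (rule that)
    then show "x \<in> (\<Union>k. {1 / real (Suc k)..real (Suc k)})" by blast
  qed (use exhaust_pos in blast)
  have inc: "incseq (\<lambda>k. {1 / real (Suc k)..real (Suc k)})"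
    by (rule incseq_SucI) (auto simp: divide_simps intro: order_trans)
  show ?thesis
    using set_integral_cont_up[OF _ inc, of lborel f] assms unfolding un by simp
qed

lemma half_line_integral_le:
  fixes f :: "real \<Rightarrow> real"
  assumes "set_integrable lborel {0<..} f"
    and le: "\<And>a b. 0 < a \<Longrightarrow> a \<le> b \<Longrightarrow> (LINT x:{a..b}|lborel. f x) \<le> K"
  shows "(LINT x:{0<..}|lborel. f x) \<le> K"
proof (rule LIMSEQ_le_const2[OF exhaust_half_line[OF assms(1)]])
  show "\<exists>N. \<forall>k\<ge>N. (LINT x:{1 / real (Suc k)..real (Suc k)}|lborel. f x) \<le> K"
    by (intro exI[of _ 0] allI impI le exhaust_interval)
qed

lemma set_integrable_const_Icc: "set_integrable lborel {a..b::real} (\<lambda>_. c :: real)"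
  by (rule borel_integrable_atLeastAtMost'[OF continuous_on_const])

text \<open>This supplies cut-off radii at which boundary terms are negligible: an integrable nonnegative quantity
  cannot stay above \<open>e\<close>.\<close>

lemma small_at_infinity:
  fixes h :: "real \<Rightarrow> real"
  assumes e: "0 < e" and K: "\<And>x. b \<le> x \<Longrightarrow> (LINT t:{b..x}|lborel. h t) \<le> K"
    and i: "\<And>x. b \<le> x \<Longrightarrow> set_integrable lborel {b..x} h"
  shows "\<exists>x\<ge>b. h x \<le> e"
proof (rule ccontr)
  assume "\<not> ?thesis"
  then have h: "h x \<ge> e" if "b \<le> x" for x using that by (meson linear not_le)
  define x where "x = b + \<bar>K\<bar> / e + 1"
  have x: "b \<le> x" unfolding x_def using e by (simp add: add_increasing2)
  have "e * (x - b) = (LINT t:{b..x}|lborel. e)" using x by (simp add: set_integral_const)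
  also have "\<dots> \<le> (LINT t:{b..x}|lborel. h t)"
    by (rule set_integral_mono[OF _ i[OF x]]) (use h set_integrable_const_Icc in auto)
  also have "\<dots> \<le> K" by (rule K[OF x])
  finally have "e * (\<bar>K\<bar> / e + 1) \<le> K" unfolding x_def by simp
  then have "\<bar>K\<bar> + e \<le> K" using e by (simp add: distrib_left)
  then show False using e by linarith
qed

lemma near_zero:
  assumes "((f :: real \<Rightarrow> real) \<longlongrightarrow> 0) (at_right 0)" "0 < e" "0 < a"
  obtains x where "0 < x" "x \<le> a" "\<bar>f x\<bar> \<le> e"
proof -
  have "eventually (\<lambda>x. dist (f x) 0 < e) (at_right 0)" by (rule tendstoD[OF assms(1,2)])
  moreover have "eventually (\<lambda>x. x \<in> {0<..<a}) (at_right (0::real))"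
    by (rule eventually_at_right_real) (use assms(3) in auto)
  ultimately have "eventually (\<lambda>x. 0 < x \<and> x \<le> a \<and> \<bar>f x\<bar> \<le> e) (at_right 0)"
    by eventually_elim auto
  then obtain x where "0 < x \<and> x \<le> a \<and> \<bar>f x\<bar> \<le> e"
    using eventually_happens'[of "at_right (0::real)"] by auto
  then show ?thesis using that by blast
qed

text \<open>A solution of \<open>- u'' + W * u + \<i> * q * u = G\<close> with real coefficients and square integrable data whose
  boundary terms at the origin vanish.\<close>

locale resolvent_solution =
  fixes u u1 G :: "real \<Rightarrow> complex" and W q :: "real \<Rightarrow> real"
  assumes u: "ac_deriv u u1"
    and u1: "ac_deriv u1 (\<lambda>r. (complex_of_real (W r) + \<i> * complex_of_real (q r)) * u r - G r)"
    and W_cont: "continuous_on {0<..} W" and q_cont: "continuous_on {0<..} q"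
    and u_L2: "set_integrable lborel {0<..} (\<lambda>r. (cmod (u r))\<^sup>2)"
    and G_L2: "set_integrable lborel {0<..} (\<lambda>r. (cmod (G r))\<^sup>2)"
    and u_0: "((\<lambda>r. cmod (u r)) \<longlongrightarrow> 0) (at_right 0)"
    and bdry_0: "((\<lambda>r. cmod (u1 r) * cmod (u r)) \<longlongrightarrow> 0) (at_right 0)"
begin

lemma u_cont: "continuous_on {0<..} u" and u1_cont: "continuous_on {0<..} u1"
  using ac_deriv_continuous[OF u] ac_deriv_continuous[OF u1] .

lemma cont_integrable:
  fixes f :: "real \<Rightarrow> 'c :: {banach, second_countable_topology}"
  assumes "continuous_on {0<..} f" "0 < a"
  shows "set_integrable lborel {a..b} f"
  by (rule borel_integrable_atLeastAtMost'[OF continuous_on_subset[OF assms(1)]]) (use assms(2) in auto)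

text \<open>The derivative of \<open>c * u1 * cnj u\<close>, arranged so that its real part contains the energy density and its
  imaginary part contains \<open>c * q * \<bar>u\<bar>\<^sup>2\<close>.\<close>

definition energy :: "(real \<Rightarrow> real) \<Rightarrow> (real \<Rightarrow> real) \<Rightarrow> real \<Rightarrow> complex" where
  "energy c c' x = complex_of_real (c x * ((cmod (u1 x))\<^sup>2 + W x * (cmod (u x))\<^sup>2))
     + \<i> * complex_of_real (c x * q x * (cmod (u x))\<^sup>2)
     + complex_of_real (c' x) * (u1 x * cnj (u x)) - complex_of_real (c x) * (G x * cnj (u x))"

lemma multiplier_identity:
  assumes c: "\<And>x. (c has_real_derivative c' x) (at x)" "continuous_on UNIV c'"
    and ab: "0 < a" "a \<le> b"
  shows "set_integrable lborel {a..b} (energy c c')"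
    and "(LINT x:{a..b}|lborel. energy c c' x) =
      complex_of_real (c b) * (u1 b * cnj (u b)) - complex_of_real (c a) * (u1 a * cnj (u a))"
proof -
  have cc: "ac_deriv (\<lambda>x. complex_of_real (c x)) (\<lambda>x. complex_of_real (c' x))"
    by (rule ac_deriv_C1)
       (use c in \<open>auto intro!: has_vector_derivative_of_real continuous_intros elim: continuous_on_subset\<close>)
  note m = ac_deriv_mult[OF cc ac_deriv_mult[OF u1 ac_deriv_cnj[OF u]]]
  have m': "ac_deriv (\<lambda>x. complex_of_real (c x) * (u1 x * cnj (u x))) (energy c c')"
  proof (rule ac_deriv_cong[OF m])
    fix x :: real
    have n: "complex_of_real ((cmod z)\<^sup>2) = z * cnj z" for z by (rule complex_norm_square)
    show "complex_of_real (c' x) * (u1 x * cnj (u x)) + complex_of_real (c x) *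
        (((complex_of_real (W x) + \<i> * complex_of_real (q x)) * u x - G x) * cnj (u x) + u1 x * cnj (u1 x)) = energy c c' x"
      unfolding energy_def of_real_mult of_real_add n by (simp add: algebra_simps)
  qed simp
  show "set_integrable lborel {a..b} (energy c c')"
    and "(LINT x:{a..b}|lborel. energy c c' x) =
      complex_of_real (c b) * (u1 b * cnj (u b)) - complex_of_real (c a) * (u1 a * cnj (u a))"
    using ac_derivD[OF m' ab] by auto
qed

definition norm_sq :: real where "norm_sq = (LINT r:{0<..}|lborel. (cmod (u r))\<^sup>2)"

lemma norm_sq_ge: "0 < a \<Longrightarrow> (LINT r:{a..b}|lborel. (cmod (u r))\<^sup>2) \<le> norm_sq"
  unfolding norm_sq_def by (rule set_integral_mono_set[OF u_L2]) auto

text \<open>A pointwise majorant of \<open>\<bar>G * u\<bar>\<close> whose integral is the Cauchy--Schwarz bound when \<open>s\<^sup>2\<close> is the ratio of the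
  norms of \<open>G\<close> and \<open>u\<close>.\<close>

definition source :: "real \<Rightarrow> real \<Rightarrow> real" where
  "source s r = (cmod (G r))\<^sup>2 / (2 * s\<^sup>2) + s\<^sup>2 / 2 * (cmod (u r))\<^sup>2"

context
  fixes s :: real
  assumes s: "0 < s"
    and G_le: "(LINT r:{0<..}|lborel. (cmod (G r))\<^sup>2) \<le> s ^ 4 * norm_sq"
begin

lemma source_bound: "cmod (G r * cnj (u r)) \<le> source s r"
proof -
  have "0 \<le> (cmod (G r) / s - s * cmod (u r))\<^sup>2" by simp
  then show ?thesis using s unfolding source_def
    by (simp add: power2_diff power_mult_distrib power_divide norm_mult field_simps power2_eq_square power4_eq_xxxx)
qed

lemma source_integrable: "set_integrable lborel {0<..} (source s)"
  unfolding source_def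
  by (intro set_integral_add set_integrable_divide set_integrable_mult_right G_L2 u_L2)

lemma source_integral: "0 < a \<Longrightarrow> (LINT r:{a..b}|lborel. source s r) \<le> s\<^sup>2 * norm_sq"
proof -
  assume a: "0 < a"
  have "(LINT r:{a..b}|lborel. source s r) \<le> (LINT r:{0<..}|lborel. source s r)"
    by (rule set_integral_mono_set[OF source_integrable]) (use a in \<open>auto simp: source_def\<close>)
  also have "\<dots> = (LINT r:{0<..}|lborel. (cmod (G r))\<^sup>2) / (2 * s\<^sup>2) + s\<^sup>2 / 2 * norm_sq"
    unfolding source_def norm_sq_def
    by (subst set_integral_add(2))
       (auto intro!: set_integrable_divide set_integrable_mult_right G_L2 u_L2)
  also have "\<dots> \<le> s ^ 4 * norm_sq / (2 * s\<^sup>2) + s\<^sup>2 / 2 * norm_sq"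
    using G_le s by (intro add_right_mono divide_right_mono) auto
  also have "\<dots> = s\<^sup>2 * norm_sq" using s by (simp add: field_simps power2_eq_square power4_eq_xxxx)
  finally show ?thesis .
qed

lemma source_integrable_Icc: "0 < a \<Longrightarrow> set_integrable lborel {a..b} (source s)"
  by (rule set_integrable_subset[OF source_integrable]) auto

text \<open>Real part of the identity with multiplier one. The boundary term at infinity is \<open>(\<bar>u\<bar>\<^sup>2)' / 2\<close>; if it stayed
  above a positive constant then \<open>\<bar>u\<bar>\<^sup>2\<close> would grow linearly and \<open>u\<close> would not be square integrable.\<close>

lemma energy_bound:
  assumes W0: "\<And>r. 0 < r \<Longrightarrow> 0 \<le> W r" and ab: "0 < a" "a \<le> b"
  shows "(LINT r:{a..b}|lborel. (cmod (u1 r))\<^sup>2 + W r * (cmod (u r))\<^sup>2) \<le> s\<^sup>2 * norm_sq"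
proof -
  let ?E = "\<lambda>r. (cmod (u1 r))\<^sup>2 + W r * (cmod (u r))\<^sup>2"
  let ?P = "\<lambda>r. Re (u1 r * cnj (u r))"
  have Ec: "continuous_on {0<..} ?E"
    by (intro continuous_intros u_cont u1_cont W_cont)
  have Ac: "continuous_on {0<..} (\<lambda>r. (cmod (u r))\<^sup>2)"
    by (intro continuous_intros u_cont)
  have main: "(LINT r:{a..b}|lborel. ?E r) \<le> ?P b - ?P a + s\<^sup>2 * norm_sq" if ab: "0 < a" "a \<le> b" for a b
  proof -
    note mi = multiplier_identity[where c="\<lambda>_. 1" and c'="\<lambda>_. 0", OF _ _ ab]
    have i: "set_integrable lborel {a..b} (energy (\<lambda>_. 1) (\<lambda>_. 0))"
      and v: "(LINT x:{a..b}|lborel. energy (\<lambda>_. 1) (\<lambda>_. 0) x) = u1 b * cnj (u b) - u1 a * cnj (u a)"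
      using mi by auto
    have "(LINT r:{a..b}|lborel. ?E r) \<le> (LINT r:{a..b}|lborel. Re (energy (\<lambda>_. 1) (\<lambda>_. 0) r) + source s r)"
    proof (rule set_integral_mono)
      show "set_integrable lborel {a..b} ?E" by (rule cont_integrable[OF Ec ab(1)])
      show "set_integrable lborel {a..b} (\<lambda>r. Re (energy (\<lambda>_. 1) (\<lambda>_. 0) r) + source s r)"
        by (intro set_integral_add set_integral_Re i source_integrable_Icc ab)
      fix r
      have "Re (G r * cnj (u r)) \<le> source s r"
        using source_bound[of r] complex_Re_le_cmod[of "G r * cnj (u r)"] by linarith
      then show "?E r \<le> Re (energy (\<lambda>_. 1) (\<lambda>_. 0) r) + source s r"
        unfolding energy_def by simp
    qed
    also have "\<dots> = Re (LINT r:{a..b}|lborel. energy (\<lambda>_. 1) (\<lambda>_. 0) r) + (LINT r:{a..b}|lborel. source s r)"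
      using set_integral_Re[OF i] source_integrable_Icc[OF ab(1)] by (simp add: set_integral_add(2))
    also have "\<dots> \<le> ?P b - ?P a + s\<^sup>2 * norm_sq"
      unfolding v using source_integral[OF ab(1), of b] by simp
    finally show ?thesis .
  qed
  have end_point: "\<exists>x\<ge>b. ?P x \<le> e" if "0 < e" "0 < b" for e b :: real
  proof (rule ccontr)
    assume "\<not> ?thesis"
    then have P: "?P x \<ge> e" if "b \<le> x" for x using that by (meson linear not_le)
    have grow: "(cmod (u x))\<^sup>2 \<ge> 2 * e * (x - b)" if x: "b \<le> x" for x
    proof -
      note m = ac_derivD[OF ac_deriv_mult[OF u ac_deriv_cnj[OF u]] \<open>0 < b\<close> x]
      have "2 * e * (x - b) = (LINT t:{b..x}|lborel. 2 * e)" using x by (simp add: set_integral_const)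
      also have "\<dots> \<le> (LINT t:{b..x}|lborel. Re (u1 t * cnj (u t) + u t * cnj (u1 t)))"
      proof (rule set_integral_mono[OF set_integrable_const_Icc set_integral_Re(1)[OF m(1)]])
        fix t assume "t \<in> {b..x}"
        then have "e \<le> ?P t" by (intro P) simp
        moreover have "Re (u1 t * cnj (u t) + u t * cnj (u1 t)) = 2 * ?P t" by (simp add: algebra_simps)
        ultimately show "2 * e \<le> Re (u1 t * cnj (u t) + u t * cnj (u1 t))" by linarith
      qed
      also have "\<dots> = (cmod (u x))\<^sup>2 - (cmod (u b))\<^sup>2"
        unfolding set_integral_Re(2)[OF m(1)] m(2) by (simp only: complex_norm_square[symmetric] minus_complex.sel Re_complex_of_real)
      also have "\<dots> \<le> (cmod (u x))\<^sup>2" by simp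
      finally show ?thesis .
    qed
    have "\<exists>x\<ge>b+1. (cmod (u x))\<^sup>2 \<le> e"
      by (rule small_at_infinity[OF that(1), where K=norm_sq]) 
         (use that in \<open>auto intro!: norm_sq_ge cont_integrable[OF Ac]\<close>)
    then obtain x where x: "x \<ge> b + 1" "(cmod (u x))\<^sup>2 \<le> e" by blast
    have "2 * e * 1 \<le> 2 * e * (x - b)" using x that by (intro mult_left_mono) auto
    then show False using grow[of x] x that by linarith
  qed
  show ?thesis
  proof (rule field_le_epsilon)
    fix e :: real assume e: "0 < e"
    then have e2: "0 < e / 2" by simp
    obtain a' where a': "0 < a'" "a' \<le> a" "\<bar>cmod (u1 a') * cmod (u a')\<bar> \<le> e / 2"
      using near_zero[OF bdry_0 e2 ab(1)] by blast
    obtain b' where b': "b \<le> b'" "?P b' \<le> e / 2" using end_point[OF e2, of b] ab by auto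
    have "(LINT r:{a..b}|lborel. ?E r) \<le> (LINT r:{a'..b'}|lborel. ?E r)"
      by (rule set_integral_mono_set[OF cont_integrable[OF Ec a'(1)]]) (use a' b' W0 in auto)
    also have "\<dots> \<le> ?P b' - ?P a' + s\<^sup>2 * norm_sq"
      by (rule main) (use a' b' ab in auto)
    also have "- ?P a' \<le> e / 2"
      using abs_Re_le_cmod[of "u1 a' * cnj (u a')"] a'(3) by (simp add: norm_mult)
    then have "?P b' - ?P a' + s\<^sup>2 * norm_sq \<le> s\<^sup>2 * norm_sq + e" using b'(2) by linarith
    finally show "(LINT r:{a..b}|lborel. ?E r) \<le> s\<^sup>2 * norm_sq + e" .
  qed
qed

context
  fixes c0 :: real
  assumes c0: "0 < c0" and coercive: "\<And>r. 0 < r \<Longrightarrow> c0 * (1 + r\<^sup>2) \<le> W r"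
begin

lemma W_nonneg: "0 < r \<Longrightarrow> 0 \<le> W r"
  using coercive[of r] c0 by (smt (verit) mult_nonneg_nonneg zero_le_power2)

text \<open>Consequently \<open>u\<close> varies on the length scale \<open>1 / s\<close> and is concentrated on radii of order \<open>s\<close>.\<close>

lemma energy_parts:
  assumes ab: "0 < a" "a \<le> b"
  shows "(LINT r:{a..b}|lborel. (cmod (u1 r))\<^sup>2) \<le> s\<^sup>2 * norm_sq"
    and "(LINT r:{a..b}|lborel. r\<^sup>2 * (cmod (u r))\<^sup>2) \<le> s\<^sup>2 * norm_sq / c0"
    and "(LINT r:{a..b}|lborel. (cmod (u r))\<^sup>2) \<le> s\<^sup>2 * norm_sq / c0"
proof -
  let ?E = "\<lambda>r. (cmod (u1 r))\<^sup>2 + W r * (cmod (u r))\<^sup>2"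
  note eb = energy_bound[OF W_nonneg ab]
  have part: "(LINT r:{a..b}|lborel. f r) \<le> s\<^sup>2 * norm_sq"
    if "continuous_on {0<..} f" "\<And>r. 0 < r \<Longrightarrow> f r \<le> ?E r" for f
  proof -
    have "(LINT r:{a..b}|lborel. f r) \<le> (LINT r:{a..b}|lborel. ?E r)"
      by (rule set_integral_mono)
         (use that ab in \<open>auto intro!: cont_integrable continuous_intros u_cont u1_cont W_cont\<close>)
    then show ?thesis using eb by linarith
  qed
  have low: "c0 * (cmod (u r))\<^sup>2 + c0 * (r\<^sup>2 * (cmod (u r))\<^sup>2) \<le> W r * (cmod (u r))\<^sup>2" if "0 < r" for r
    using mult_right_mono[OF coercive[OF that], of "(cmod (u r))\<^sup>2"] by (simp add: algebra_simps)
  show "(LINT r:{a..b}|lborel. (cmod (u1 r))\<^sup>2) \<le> s\<^sup>2 * norm_sq"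
    by (rule part) (use W_nonneg in \<open>auto intro!: continuous_intros u1_cont\<close>)
  have "(LINT r:{a..b}|lborel. c0 * (r\<^sup>2 * (cmod (u r))\<^sup>2)) \<le> s\<^sup>2 * norm_sq"
  proof (rule part)
    show "c0 * (r\<^sup>2 * (cmod (u r))\<^sup>2) \<le> ?E r" if "0 < r" for r
      using low[OF that] c0 by (smt (verit) mult_nonneg_nonneg zero_le_power2)
  qed (intro continuous_intros u_cont)
  then show "(LINT r:{a..b}|lborel. r\<^sup>2 * (cmod (u r))\<^sup>2) \<le> s\<^sup>2 * norm_sq / c0"
    using c0 by (simp add: field_simps)
  have "(LINT r:{a..b}|lborel. c0 * (cmod (u r))\<^sup>2) \<le> s\<^sup>2 * norm_sq"
  proof (rule part)
    show "c0 * (cmod (u r))\<^sup>2 \<le> ?E r" if "0 < r" for r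
      using low[OF that] c0 by (smt (verit) mult_nonneg_nonneg zero_le_power2)
  qed (intro continuous_intros u_cont)
  then show "(LINT r:{a..b}|lborel. (cmod (u r))\<^sup>2) \<le> s\<^sup>2 * norm_sq / c0"
    using c0 by (simp add: field_simps)
qed

lemma spectral_gap:
  assumes "0 < norm_sq"
  shows "c0 \<le> s\<^sup>2"
proof -
  have "norm_sq \<le> s\<^sup>2 * norm_sq / c0"
    unfolding norm_sq_def by (rule half_line_integral_le[OF u_L2]) (rule energy_parts[unfolded norm_sq_def])
  then show ?thesis using assms c0 by (simp add: field_simps)
qed

lemma flux_bound:
  assumes ab: "0 < a" "a \<le> b"
  shows "(LINT r:{a..b}|lborel. cmod (u1 r) * cmod (u r)) \<le> s * norm_sq"
proof -
  have "(LINT r:{a..b}|lborel. cmod (u1 r) * cmod (u r)) \<le>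
        (LINT r:{a..b}|lborel. 1 / (2 * s) * (cmod (u1 r))\<^sup>2 + s / 2 * (cmod (u r))\<^sup>2)"
  proof (rule set_integral_mono)
    fix r
    have "0 \<le> (cmod (u1 r) - s * cmod (u r))\<^sup>2" by simp
    then show "cmod (u1 r) * cmod (u r) \<le> 1 / (2 * s) * (cmod (u1 r))\<^sup>2 + s / 2 * (cmod (u r))\<^sup>2"
      using s by (simp add: power2_diff power_mult_distrib field_simps power2_eq_square)
  qed (use ab s in \<open>auto intro!: cont_integrable continuous_intros u_cont u1_cont\<close>)
  also have "\<dots> = 1 / (2 * s) * (LINT r:{a..b}|lborel. (cmod (u1 r))\<^sup>2) + s / 2 * (LINT r:{a..b}|lborel. (cmod (u r))\<^sup>2)"
    by (subst set_integral_add(2)) (use ab s in \<open>auto intro!: cont_integrable continuous_intros u_cont u1_cont\<close>)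
  also have "\<dots> \<le> 1 / (2 * s) * (s\<^sup>2 * norm_sq) + s / 2 * norm_sq"
    using s by (intro add_mono mult_left_mono energy_parts ab norm_sq_ge) auto
  also have "\<dots> = s * norm_sq" using s by (simp add: field_simps power2_eq_square)
  finally show ?thesis .
qed

text \<open>\<open>\<bar>u\<bar>\<^sup>2\<close> vanishes at the origin and its derivative is at most \<open>2 * \<bar>u1 * u\<bar>\<close>.\<close>

lemma sup_bound:
  assumes x: "0 < x"
  shows "(cmod (u x))\<^sup>2 \<le> 2 * s * norm_sq"
proof (rule field_le_epsilon)
  fix e :: real assume e: "0 < e"
  have "((\<lambda>r. (cmod (u r))\<^sup>2) \<longlongrightarrow> 0) (at_right 0)" using tendsto_power[OF u_0, of 2] by simp
  then obtain a where a: "0 < a" "a \<le> x" "\<bar>(cmod (u a))\<^sup>2\<bar> \<le> e" using near_zero e x by blast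
  note m = ac_derivD[OF ac_deriv_mult[OF u ac_deriv_cnj[OF u]] a(1,2)]
  have "(cmod (u x))\<^sup>2 - (cmod (u a))\<^sup>2 = (LINT t:{a..x}|lborel. Re (u1 t * cnj (u t) + u t * cnj (u1 t)))"
    unfolding set_integral_Re(2)[OF m(1)] m(2) by (simp only: complex_norm_square[symmetric] minus_complex.sel Re_complex_of_real)
  also have "\<dots> \<le> (LINT t:{a..x}|lborel. 2 * (cmod (u1 t) * cmod (u t)))"
  proof (rule set_integral_mono[OF set_integral_Re(1)[OF m(1)]])
    show "set_integrable lborel {a..x} (\<lambda>t. 2 * (cmod (u1 t) * cmod (u t)))"
      using a by (intro cont_integrable continuous_intros u_cont u1_cont) auto
    fix t
    have "Re (u1 t * cnj (u t) + u t * cnj (u1 t)) = 2 * Re (u1 t * cnj (u t))" by (simp add: algebra_simps)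
    also have "\<dots> \<le> 2 * (cmod (u1 t) * cmod (u t))"
      using complex_Re_le_cmod[of "u1 t * cnj (u t)"] by (simp add: norm_mult)
    finally show "Re (u1 t * cnj (u t) + u t * cnj (u1 t)) \<le> 2 * (cmod (u1 t) * cmod (u t))" .
  qed
  also have "\<dots> \<le> 2 * (s * norm_sq)" using flux_bound[OF a(1,2)] by simp
  finally show "(cmod (u x))\<^sup>2 \<le> 2 * s * norm_sq + e" using a(3) by simp
qed

text \<open>Imaginary part of the identity with a multiplier of the sign of \<open>q\<close>: the potential \<open>W\<close> drops out, and the
  second derivative contributes only the commutator term with \<open>c'\<close>.\<close>

lemma multiplier_bound:
  assumes c: "\<And>x. (c has_real_derivative c' x) (at x)" "continuous_on UNIV c'"
    and cb: "\<And>x. \<bar>c x\<bar> \<le> 2" "\<And>x. \<bar>c' x\<bar> \<le> D" and cq: "\<And>x. 0 < x \<Longrightarrow> 0 \<le> c x * q x"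
    and ab: "0 < a" "a \<le> b"
  shows "(LINT r:{a..b}|lborel. c r * q r * (cmod (u r))\<^sup>2) \<le> 2 * s\<^sup>2 * norm_sq + D * s * norm_sq"
proof (rule field_le_epsilon)
  fix e :: real assume e: "0 < e"
  then have e4: "0 < e / 4" by simp
  let ?F = "\<lambda>r. cmod (u1 r) * cmod (u r)"
  let ?Q = "\<lambda>r. c r * q r * (cmod (u r))\<^sup>2"
  have D0: "0 \<le> D" using cb(2)[of 0] by linarith
  have cc: "continuous_on A c" for A
    using c(1) DERIV_isCont by (blast intro: continuous_at_imp_continuous_on)
  have Fc: "continuous_on {0<..} ?F" by (intro continuous_intros u_cont u1_cont)
  have Qc: "continuous_on {0<..} ?Q" by (intro continuous_intros u_cont q_cont cc)
  obtain a' where a': "0 < a'" "a' \<le> a" "\<bar>?F a'\<bar> \<le> e / 4"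
    using near_zero[OF bdry_0 e4 ab(1)] by blast
  have "\<exists>x\<ge>b. ?F x \<le> e / 4"
    by (rule small_at_infinity[OF e4, where K="s * norm_sq"])
       (use ab in \<open>auto intro!: flux_bound cont_integrable Fc\<close>)
  then obtain b' where b': "b \<le> b'" "?F b' \<le> e / 4" by blast
  have ab': "0 < a'" "a' \<le> b'" using a' b' ab by auto
  note mi = multiplier_identity[OF c ab']
  have "(LINT r:{a..b}|lborel. ?Q r) \<le> (LINT r:{a'..b'}|lborel. ?Q r)"
    by (rule set_integral_mono_set[OF cont_integrable[OF Qc a'(1)]]) (use a' b' cq in auto)
  also have "\<dots> \<le> (LINT r:{a'..b'}|lborel. Im (energy c c' r) + (2 * source s r + D * ?F r))"
  proof (rule set_integral_mono)
    show "set_integrable lborel {a'..b'} ?Q" by (rule cont_integrable[OF Qc a'(1)])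
    show "set_integrable lborel {a'..b'} (\<lambda>r. Im (energy c c' r) + (2 * source s r + D * ?F r))"
      by (intro set_integral_add set_integral_Im mi set_integrable_mult_right source_integrable_Icc cont_integrable[OF Fc] a')
    fix r
    have 1: "\<bar>c r * Im (G r * cnj (u r))\<bar> \<le> 2 * source s r"
    proof -
      have "\<bar>c r\<bar> * \<bar>Im (G r * cnj (u r))\<bar> \<le> 2 * source s r"
        using source_bound[of r] abs_Im_le_cmod[of "G r * cnj (u r)"] by (intro mult_mono cb) auto
      then show ?thesis by (simp only: abs_mult)
    qed
    have 2: "\<bar>c' r * Im (u1 r * cnj (u r))\<bar> \<le> D * ?F r"
    proof -
      have "\<bar>c' r\<bar> * \<bar>Im (u1 r * cnj (u r))\<bar> \<le> D * ?F r"
        using abs_Im_le_cmod[of "u1 r * cnj (u r)"] D0 by (intro mult_mono cb) (auto simp: norm_mult)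
      then show ?thesis by (simp only: abs_mult)
    qed
    have "Im (energy c c' r) = ?Q r + c' r * Im (u1 r * cnj (u r)) - c r * Im (G r * cnj (u r))"
      unfolding energy_def by (simp only: plus_complex.sel minus_complex.sel Im_complex_of_real times_complex.sel Re_complex_of_real imaginary_unit.sel)
    then show "?Q r \<le> Im (energy c c' r) + (2 * source s r + D * ?F r)" using 1 2 by linarith
  qed
  also have "\<dots> = Im (LINT r:{a'..b'}|lborel. energy c c' r) + (2 * (LINT r:{a'..b'}|lborel. source s r) + D * (LINT r:{a'..b'}|lborel. ?F r))"
  proof -
    have i1: "set_integrable lborel {a'..b'} (\<lambda>r. 2 * source s r)" and i2: "set_integrable lborel {a'..b'} (\<lambda>r. D * ?F r)"
      by (intro set_integrable_mult_right source_integrable_Icc cont_integrable[OF Fc] a')+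
    show ?thesis
      unfolding set_integral_add(2)[OF set_integral_Im(1)[OF mi(1)] set_integral_add(1)[OF i1 i2]]
        set_integral_add(2)[OF i1 i2] set_integral_Im(2)[OF mi(1)] by simp
  qed
  also have "\<dots> \<le> e + (2 * (s\<^sup>2 * norm_sq) + D * (s * norm_sq))"
  proof (intro add_mono mult_left_mono source_integral flux_bound ab' D0)
    have "\<bar>Im (complex_of_real (c x) * (u1 x * cnj (u x)))\<bar> \<le> 2 * ?F x" for x
    proof -
      have "\<bar>Im (complex_of_real (c x) * (u1 x * cnj (u x)))\<bar> \<le> cmod (complex_of_real (c x) * (u1 x * cnj (u x)))"
        by (rule abs_Im_le_cmod)
      also have "\<dots> = \<bar>c x\<bar> * ?F x" by (simp add: norm_mult)
      also have "\<dots> \<le> 2 * ?F x" by (intro mult_right_mono cb) auto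
      finally show ?thesis .
    qed
    from this[of a'] this[of b'] show "Im (LINT r:{a'..b'}|lborel. energy c c' r) \<le> e"
      unfolding mi(2) minus_complex.sel using a'(3) b'(2) by linarith
  qed simp
  finally show "(LINT r:{a..b}|lborel. ?Q r) \<le> 2 * s\<^sup>2 * norm_sq + D * s * norm_sq + e" by (simp add: algebra_simps)
qed

end

text \<open>The strip of width \<open>2 * d = 1 / (8 * s)\<close> around the critical radius carries at most a quarter of the mass by
  \<open>sup_bound\<close>, and so does the region beyond \<open>R = 40 * s\<close> by \<open>energy_parts\<close>. On the rest
  \<open>\<bar>sigma - \<mu>\<bar>\<close> is at least of order \<open>d * R powr (- 3)\<close>, that is \<open>s powr (- 4)\<close>, whereas \<open>multiplier_bound\<close>
  limits the mean of \<open>\<bar>\<beta> * (sigma - \<mu>)\<bar>\<close> to order \<open>s\<^sup>2\<close>.\<close>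

lemma resolvent_lower_bound:
  assumes coercive: "\<And>r. 0 < r \<Longrightarrow> (1 + r\<^sup>2) / 400 \<le> W r"
    and q: "\<And>r. 0 < r \<Longrightarrow> q r = \<beta> * (sigma r - \<mu>)" and n: "0 < norm_sq"
  shows "\<bar>\<beta>\<bar> \<le> (2600 * s\<^sup>2) ^ 3"
proof (cases "\<beta> = 0")
  case True
  then show ?thesis by simp
next
  case False
  have c0: "(0::real) < 1 / 400" and co: "\<And>r. 0 < r \<Longrightarrow> 1 / 400 * (1 + r\<^sup>2) \<le> W r"
    using coercive by auto
  have s400: "1 / 400 \<le> s\<^sup>2" by (rule spectral_gap[OF c0 co n])
  define d where "d = 1 / (16 * s)"
  define R where "R = 40 * s"
  define \<kappa> where "\<kappa> = d / 4 * (min (d / 4) (1 / (R + d) ^ 3) / 12)"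
  have d: "0 < d" and R: "0 < R" unfolding d_def R_def using s by auto
  obtain ch ch' r0 where
    ch: "\<And>r. (ch has_real_derivative ch' r) (at r)" "continuous_on UNIV ch'"
    "\<And>r. \<bar>ch r\<bar> \<le> 2" "\<And>r. \<bar>ch' r\<bar> \<le> 1 / d"
    "\<And>r. 0 < r \<Longrightarrow> ch r * (sigma r - \<mu>) \<ge> 0"
    "\<And>r. 0 < r \<Longrightarrow> r \<le> R \<Longrightarrow> d \<le> \<bar>r - r0\<bar> \<Longrightarrow> ch r * (sigma r - \<mu>) \<ge> \<kappa> / 2"
    using multiplier_exists[OF d R, of \<mu>] unfolding \<kappa>_def by metis
  define c where "c = (\<lambda>r. sgn \<beta> * ch r)"
  define c' where "c' = (\<lambda>r. sgn \<beta> * ch' r)"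
  have sg: "\<bar>sgn \<beta>\<bar> = 1" using False by (simp add: abs_sgn_eq)
  have cq: "c r * q r = \<bar>\<beta>\<bar> * (ch r * (sigma r - \<mu>))" if "0 < r" for r
    unfolding c_def q[OF that] by (simp add: sgn_if)
  have cd: "(c has_real_derivative c' r) (at r)" for r
    unfolding c_def c'_def by (rule DERIV_cmult[OF ch(1)])
  have cc: "continuous_on UNIV c'" unfolding c'_def by (intro continuous_intros ch(2))
  have cb: "\<bar>c r\<bar> \<le> 2" "\<bar>c' r\<bar> \<le> 16 * s" for r
    using ch(3)[of r] ch(4)[of r] s unfolding c_def c'_def abs_mult sg d_def by auto
  have cq0: "0 \<le> c r * q r" if "0 < r" for r using cq[OF that] ch(5)[OF that] by simp
  have d4: "d / 4 = 1 / (64 * s)" unfolding d_def by simp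
  have "1 / (16 * s) \<le> 25 * s" using s400 s by (simp add: field_simps power2_eq_square)
  then have Rd: "R + d \<le> 65 * s" unfolding R_def d_def by simp
  have "1 / (65 * s) ^ 3 \<le> 1 / (R + d) ^ 3"
    using Rd R d s by (intro divide_left_mono power_mono mult_pos_pos zero_less_power) auto
  moreover have "1 / (65 * s) ^ 3 \<le> d / 4"
    unfolding d4 using s400 s by (simp add: field_simps power2_eq_square power3_eq_cube)
  ultimately have "1 / (64 * s) * (1 / (65 * s) ^ 3 / 12) \<le> \<kappa>"
    unfolding \<kappa>_def d4 using s by (intro mult_left_mono divide_right_mono) auto
  then have k: "1 / (210912000 * s ^ 4) \<le> \<kappa>"
    using s by (simp add: power_mult_distrib power3_eq_cube power4_eq_xxxx)
  have k0: "0 < \<kappa>" by (rule less_le_trans[OF _ k]) (use s in auto)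
  define \<kappa>' where "\<kappa>' = \<bar>\<beta>\<bar> * \<kappa> / 2"
  have k'0: "0 < \<kappa>'" unfolding \<kappa>'_def using False k0 by simp
  define S where "S = {r0 - d..r0 + d}"
  let ?I = "\<lambda>r. (2 * s * norm_sq) * indicat_real S r"
  let ?Y = "\<lambda>r. 1 / R\<^sup>2 * (r\<^sup>2 * (cmod (u r))\<^sup>2)"
  let ?Z = "\<lambda>r. 1 / \<kappa>' * (c r * q r * (cmod (u r))\<^sup>2)"
  \<comment> \<open>The three terms dominate the mass in the strip, beyond \<open>R\<close>, and elsewhere.\<close>
  have point: "(cmod (u r))\<^sup>2 \<le> ?I r + (?Y r + ?Z r)" if r: "0 < r" for r
  proof -
    have I: "0 \<le> ?I r" using s n by simp
    have Y: "0 \<le> ?Y r" by simp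
    have Z: "0 \<le> ?Z r" using cq0[OF r] k'0 by simp
    \<comment> \<open>One of the three terms alone majorises, the others are nonnegative.\<close>
    consider "r \<in> S" | "R < r" | "r \<notin> S" "r \<le> R" by linarith
    then show ?thesis
    proof cases
      case 1
      then have "?I r = 2 * s * norm_sq" by simp
      then show ?thesis using sup_bound[OF c0 co r] Y Z by linarith
    next
      case 2
      then have "1 \<le> r\<^sup>2 / R\<^sup>2" using R by (simp add: power_mono)
      then have "1 * (cmod (u r))\<^sup>2 \<le> r\<^sup>2 / R\<^sup>2 * (cmod (u r))\<^sup>2" by (rule mult_right_mono) simp
      then have "(cmod (u r))\<^sup>2 \<le> ?Y r" by simp
      then show ?thesis using I Z by linarith
    next
      case 3
      then have "d \<le> \<bar>r - r0\<bar>" unfolding S_def by auto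
      then have "\<kappa>' \<le> c r * q r" using ch(6)[OF r 3(2)] mult_left_mono[of "\<kappa> / 2" "ch r * (sigma r - \<mu>)" "\<bar>\<beta>\<bar>"]
        unfolding cq[OF r] \<kappa>'_def by simp
      then have "1 \<le> 1 / \<kappa>' * (c r * q r)" using k'0 by (simp add: field_simps)
      then have "1 * (cmod (u r))\<^sup>2 \<le> 1 / \<kappa>' * (c r * q r) * (cmod (u r))\<^sup>2" by (rule mult_right_mono) simp
      then have "(cmod (u r))\<^sup>2 \<le> ?Z r" by simp
      then show ?thesis using I Y by linarith
    qed
  qed
  have chc: "continuous_on A c" for A
    using cd DERIV_isCont by (blast intro: continuous_at_imp_continuous_on)
  have "norm_sq \<le> norm_sq / 4 + (norm_sq / 4 + 18 * s\<^sup>2 * norm_sq / \<kappa>')"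
    unfolding norm_sq_def
  proof (rule half_line_integral_le[OF u_L2], unfold norm_sq_def[symmetric])
    fix a b :: real assume ab: "0 < a" "a \<le> b"
    have iI0: "integrable lborel (indicat_real S)"
      using set_integrable_const_Icc[of "r0 - d" "r0 + d" 1] unfolding set_integrable_def S_def by simp
    have iI: "set_integrable lborel {a..b} ?I"
      using integrable_mult_indicator[OF _ integrable_mult_right[OF iI0, of "2 * s * norm_sq"], of "{a..b}"]
      unfolding set_integrable_def by simp
    have iY: "set_integrable lborel {a..b} ?Y"
      by (rule cont_integrable) (intro continuous_intros u_cont, rule ab)
    have iZ: "set_integrable lborel {a..b} ?Z"
      by (rule cont_integrable) (intro continuous_intros u_cont q_cont chc, rule ab)
    have "(LINT r:{a..b}|lborel. (cmod (u r))\<^sup>2) \<le> (LINT r:{a..b}|lborel. ?I r + (?Y r + ?Z r))"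
    proof (rule set_integral_mono)
      show "set_integrable lborel {a..b} (\<lambda>r. (cmod (u r))\<^sup>2)"
        by (rule cont_integrable) (intro continuous_intros u_cont, rule ab)
      show "set_integrable lborel {a..b} (\<lambda>r. ?I r + (?Y r + ?Z r))"
        by (rule set_integral_add(1)[OF iI set_integral_add(1)[OF iY iZ]])
    qed (use point ab in auto)
    also have "\<dots> = (LINT r:{a..b}|lborel. ?I r) + ((LINT r:{a..b}|lborel. ?Y r) + (LINT r:{a..b}|lborel. ?Z r))"
      unfolding set_integral_add(2)[OF iI set_integral_add(1)[OF iY iZ]] set_integral_add(2)[OF iY iZ] ..
    also have "\<dots> \<le> norm_sq / 4 + (norm_sq / 4 + 18 * s\<^sup>2 * norm_sq / \<kappa>')"
    proof (intro add_mono)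
      have "(LINT r:{a..b}|lborel. ?I r) \<le> (LINT r|lborel. ?I r)"
        unfolding set_lebesgue_integral_def
        by (rule integral_mono[OF iI[unfolded set_integrable_def] integrable_mult_right[OF iI0]])
           (use s n in \<open>auto simp: indicator_def\<close>)
      also have "\<dots> = 2 * s * norm_sq * (2 * d)" using d by (simp add: S_def)
      also have "\<dots> = norm_sq / 4" using s by (simp add: d_def)
      finally show "(LINT r:{a..b}|lborel. ?I r) \<le> norm_sq / 4" .
      have "(LINT r:{a..b}|lborel. ?Y r) = 1 / R\<^sup>2 * (LINT r:{a..b}|lborel. r\<^sup>2 * (cmod (u r))\<^sup>2)"
        by (rule set_integral_mult_right)
      also have "\<dots> \<le> 1 / R\<^sup>2 * (s\<^sup>2 * norm_sq / (1 / 400))"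
        by (intro mult_left_mono energy_parts(2)[OF c0 co ab]) auto
      also have "\<dots> = norm_sq / 4" using s by (simp add: R_def field_simps power2_eq_square)
      finally show "(LINT r:{a..b}|lborel. ?Y r) \<le> norm_sq / 4" .
      have "(LINT r:{a..b}|lborel. ?Z r) = 1 / \<kappa>' * (LINT r:{a..b}|lborel. c r * q r * (cmod (u r))\<^sup>2)"
        by (rule set_integral_mult_right)
      also have "\<dots> \<le> 1 / \<kappa>' * (2 * s\<^sup>2 * norm_sq + 16 * s * s * norm_sq)"
        using k'0 by (intro mult_left_mono multiplier_bound[OF c0 co cd cc cb cq0 ab]) auto
      also have "\<dots> = 18 * s\<^sup>2 * norm_sq / \<kappa>'" by (simp add: power2_eq_square)
      finally show "(LINT r:{a..b}|lborel. ?Z r) \<le> 18 * s\<^sup>2 * norm_sq / \<kappa>'" .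
    qed
    finally show "(LINT r:{a..b}|lborel. (cmod (u r))\<^sup>2) \<le> norm_sq / 4 + (norm_sq / 4 + 18 * s\<^sup>2 * norm_sq / \<kappa>')" .
  qed
  then have "norm_sq * 1 \<le> 2 * (18 * s\<^sup>2 * norm_sq / \<kappa>')" by linarith
  also have "\<dots> = norm_sq * (36 * s\<^sup>2 / \<kappa>')" by simp
  finally have "norm_sq * 1 \<le> norm_sq * (36 * s\<^sup>2 / \<kappa>')" .
  then have "1 \<le> 36 * s\<^sup>2 / \<kappa>'" using n by (simp only: mult_le_cancel_left_pos)
  then have "\<kappa>' \<le> 36 * s\<^sup>2" using k'0 by (simp add: field_simps)
  then have bk: "\<bar>\<beta>\<bar> * \<kappa> \<le> 72 * s\<^sup>2" unfolding \<kappa>'_def by simp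
  have "\<bar>\<beta>\<bar> * (1 / (210912000 * s ^ 4)) \<le> \<bar>\<beta>\<bar> * \<kappa>" by (rule mult_left_mono[OF k]) simp
  then have "\<bar>\<beta>\<bar> * (1 / (210912000 * s ^ 4)) \<le> 72 * s\<^sup>2" using bk by linarith
  then have "\<bar>\<beta>\<bar> \<le> 72 * s\<^sup>2 * (210912000 * s ^ 4)" using s by (simp add: pos_divide_le_eq)
  also have "\<dots> = 15185664000 * s ^ 6" by (simp add: power_add[symmetric])
  also have "\<dots> \<le> 17576000000 * s ^ 6" by (rule mult_right_mono) auto
  also have "\<dots> = (2600 * s\<^sup>2) ^ 3" by (simp add: power_mult_distrib power_mult[symmetric])
  finally show ?thesis .
qed

end
end


section \<open>The Darboux transform removes the nonlocal term\<close>

lemma set_integrable_half_line: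
  fixes f :: "real \<Rightarrow> real"
  assumes i: "\<And>a b. 0 < a \<Longrightarrow> a \<le> b \<Longrightarrow> set_integrable lborel {a..b} f"
    and le: "\<And>a b. 0 < a \<Longrightarrow> a \<le> b \<Longrightarrow> (LINT x:{a..b}|lborel. f x) \<le> K"
    and nn: "\<And>x. 0 < x \<Longrightarrow> 0 \<le> f x"
  shows "set_integrable lborel {0<..} f"
proof -
  let ?I = "\<lambda>k. {1 / real (Suc k)..real (Suc k)}"
  note ab = exhaust_interval
  have sub: "?I j \<subseteq> ?I k" if "j \<le> k" for j k
    using that by (auto simp: divide_simps intro: order_trans)
  have mono: "incseq (\<lambda>k. LINT x:?I k|lborel. f x)"
  proof (rule incseq_SucI)
    fix k show "(LINT x:?I k|lborel. f x) \<le> (LINT x:?I (Suc k)|lborel. f x)"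
    proof (rule set_integral_mono_set[OF i[OF ab]])
      fix x assume "x \<in> ?I (Suc k)"
      then have "0 < x" by (rule exhaust_pos)
      then show "0 \<le> f x" by (rule nn)
    qed (use sub[of k "Suc k"] in auto)
  qed
  have "Bseq (\<lambda>k. LINT x:?I k|lborel. f x)"
  proof (rule BseqI'[of _ "\<bar>K\<bar>"])
    fix k :: nat
    have "0 \<le> (LINT x:?I k|lborel. f x)"
    proof (rule set_integral_nonneg)
      fix x assume "x \<in> ?I k"
      then have "0 < x" by (rule exhaust_pos)
      then show "0 \<le> f x" by (rule nn)
    qed
    then show "norm (LINT x:?I k|lborel. f x) \<le> \<bar>K\<bar>" using le[OF ab, of k] by simp
  qed
  then obtain L where L: "(\<lambda>k. LINT x:?I k|lborel. f x) \<longlonglongrightarrow> L"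
    using Bseq_mono_convergent[of "\<lambda>k. LINT x:?I k|lborel. f x"] mono unfolding incseq_def convergent_def by blast
  note conv = exhaust_indicator[where f=f]
  show ?thesis
    unfolding set_integrable_def
  proof (rule integrable_monotone_convergence)
    show "integrable lborel (\<lambda>x. indicator (?I k) x *\<^sub>R f x)" for k
      using i[OF ab] unfolding set_integrable_def .
    show "AE x in lborel. mono (\<lambda>k. indicator (?I k) x *\<^sub>R f x)"
    proof (rule AE_I2, rule monoI)
      fix x and j k :: nat assume jk: "j \<le> k"
      show "indicator (?I j) x *\<^sub>R f x \<le> indicator (?I k) x *\<^sub>R f x"
      proof (cases "x \<in> ?I k")
        case True
        then have "0 < x" by (rule exhaust_pos)
        then show ?thesis using True nn[of x] by (simp add: indicator_def)
      next
        case False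
        then have "x \<notin> ?I j" using sub[OF jk] by blast
        then show ?thesis unfolding indicator_simps(2)[OF False] indicator_simps(2)[OF \<open>x \<notin> ?I j\<close>] by simp
      qed
    qed
    show "AE x in lborel. (\<lambda>k. indicator (?I k) x *\<^sub>R f x) \<longlonglongrightarrow> indicator {0<..} x *\<^sub>R f x"
      using conv by simp
    show "(\<lambda>k. \<integral>x. indicator (?I k) x *\<^sub>R f x \<partial>lborel) \<longlonglongrightarrow> L"
      using L unfolding set_lebesgue_integral_def .
    show "(\<lambda>x. indicator {0<..} x *\<^sub>R f x) \<in> borel_measurable lborel"
      by (rule borel_measurable_LIMSEQ_real[OF conv])
         (use i[OF ab] in \<open>auto simp: set_integrable_def\<close>)
  qed
qed

subsection \<open>Primitives from the origin\<close>

text \<open>The primitive that vanishes at the origin, for functions integrable up to 0.\<close>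

definition primitive0 :: "(real \<Rightarrow> complex) \<Rightarrow> real \<Rightarrow> complex" where
  "primitive0 h r = (LINT s:{0<..r}|lborel. h s)"

lemma primitive0_ac_deriv:
  assumes h: "set_integrable lborel {0<..} h"
  shows "ac_deriv (primitive0 h) h"
  unfolding ac_deriv_def
proof (intro allI impI conjI)
  fix a b :: real assume ab: "0 < a" "a \<le> b"
  show i2: "set_integrable lborel {a..b} h" by (rule set_integrable_subset[OF h]) (use ab in auto)
  have i1: "set_integrable lborel {0<..a} h" by (rule set_integrable_subset[OF h]) auto
  have "AE t in lborel. t \<noteq> a" by (rule AE_lborel_singleton)
  then have ae: "AE t in lborel. \<not> (t \<in> {0<..a} \<and> t \<in> {a..b})" by eventually_elim auto
  have "{0<..b} = {0<..a} \<union> {a..b}" using ab by auto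
  then have "primitive0 h b = primitive0 h a + (LINT x:{a..b}|lborel. h x)"
    unfolding primitive0_def using set_integral_Un_AE[OF ae _ _ i1 i2] by simp
  then show "primitive0 h b - primitive0 h a = (LINT x:{a..b}|lborel. h x)" by simp
qed

lemma primitive0_tendsto:
  assumes h: "set_integrable lborel {0<..} h"
  shows "(\<lambda>k. primitive0 h (real k)) \<longlonglongrightarrow> (LINT s:{0<..}|lborel. h s)"
proof -
  have un: "(\<Union>k. {0<..real k}) = {0<..}" using real_arch_simple by auto
  have inc: "incseq (\<lambda>k. {0<..real k})" by (rule incseq_SucI) auto
  show ?thesis unfolding primitive0_def using set_integral_cont_up[OF _ inc, of lborel h] h unfolding un by simp
qed

lemma norm_set_integral_le:
  fixes h :: "real \<Rightarrow> complex"
  assumes "set_integrable lborel A f" "A \<in> sets lborel" "\<And>s. s \<in> A \<Longrightarrow> cmod (h s) \<le> f s"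
    "set_integrable lborel A h"
  shows "cmod (LINT s:A|lborel. h s) \<le> (LINT s:A|lborel. f s)"
  unfolding set_lebesgue_integral_def
proof (rule order_trans[OF integral_norm_bound integral_mono])
  show "integrable lborel (\<lambda>s. norm (indicator A s *\<^sub>R h s))"
    using assms(4) unfolding set_integrable_def by (rule integrable_norm)
  show "integrable lborel (\<lambda>s. indicator A s *\<^sub>R f s)" using assms(1) unfolding set_integrable_def .
qed (use assms(3) in \<open>auto simp: indicator_def\<close>)

lemma primitive0_bound:
  assumes h: "set_integrable lborel {0<..} h" and r: "0 < r" and le: "\<And>s. 0 < s \<Longrightarrow> s \<le> r \<Longrightarrow> cmod (h s) \<le> B"
  shows "cmod (primitive0 h r) \<le> B * r"
proof -
  have i: "set_integrable lborel {0<..r} (\<lambda>_. B)"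
    by (rule set_integrable_subset[OF set_integrable_const_Icc[of 0 r B]]) auto
  have "cmod (primitive0 h r) \<le> (LINT s:{0<..r}|lborel. B)"
    unfolding primitive0_def
    by (rule norm_set_integral_le[OF i]) (use le in \<open>auto intro: set_integrable_subset[OF h]\<close>)
  also have "\<dots> = B * r" using r by (simp add: set_lebesgue_integral_def)
  finally show ?thesis .
qed

subsection \<open>The ground state\<close>

definition ground :: "real \<Rightarrow> real" where
  "ground r = r powr (3 / 2) * gauss r"

text \<open>The logarithmic derivative of the ground state.\<close>

definition slope :: "real \<Rightarrow> real" where
  "slope r = 3 / (2 * r) - r / 4"

lemma ground_sq: "(ground r)\<^sup>2 = r ^ 3 * exp (- (r\<^sup>2 / 4))" if "0 < r"
proof -
  have "(r powr (3 / 2))\<^sup>2 = r ^ 3"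
    using that by (simp add: power2_eq_square powr_add[symmetric] powr_numeral)
  moreover have "(gauss r)\<^sup>2 = exp (- (r\<^sup>2 / 4))"
    unfolding gauss_def by (simp add: power2_eq_square exp_add[symmetric])
  ultimately show ?thesis unfolding ground_def power_mult_distrib by simp
qed

lemma ground_pos: "0 < r \<Longrightarrow> 0 < ground r"
  unfolding ground_def gauss_def by simp

lemma ground_deriv: "(ground has_real_derivative ground r * slope r) (at r)" if "0 < r"
proof -
  have "r powr (1 / 2) * r = r powr (3 / 2)" using that powr_add[of r "1/2" 1] by simp
  then have e: "r powr (1 / 2) = r powr (3 / 2) / r" using that by (simp add: field_simps)
  have "((\<lambda>r. r powr (3 / 2) * exp (- (r\<^sup>2 / 8))) has_real_derivative
     (3 / 2 * r powr (1 / 2)) * exp (- (r\<^sup>2 / 8)) + r powr (3 / 2) * (exp (- (r\<^sup>2 / 8)) * (- (r / 4)))) (at r)"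
    using that by (auto intro!: derivative_eq_intros)
  also have "(3 / 2 * r powr (1 / 2)) * exp (- (r\<^sup>2 / 8)) + r powr (3 / 2) * (exp (- (r\<^sup>2 / 8)) * (- (r / 4)))
     = ground r * slope r"
    unfolding ground_def gauss_def slope_def e by (simp add: field_simps)
  finally show ?thesis unfolding ground_def gauss_def .
qed

lemma slope_deriv: "(slope has_real_derivative (- (3 / (2 * r\<^sup>2)) - 1 / 4)) (at r)" if "0 < r"
  unfolding slope_def using that
  by (auto intro!: derivative_eq_intros simp: power2_eq_square field_simps)

text \<open>The Riccati form of the eigenvalue equation of the ground state, whose eigenvalue is \<open>1 / 2\<close>.\<close>

lemma slope_riccati: "(slope r)\<^sup>2 + (- (3 / (2 * r\<^sup>2)) - 1 / 4) = harmonic_pot r - 1 / 2" if "0 < r"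
  unfolding slope_def harmonic_pot_def using that by (simp add: power2_eq_square field_simps)

text \<open>The logarithmic derivative of \<open>mass\<close>.\<close>

definition mass_rate :: "real \<Rightarrow> real" where
  "mass_rate r = (ground r)\<^sup>2 / mass r"

lemma mass_deriv_ground: "(mass has_real_derivative (ground r)\<^sup>2) (at r)" if "0 < r"
  using mass_deriv[of r] ground_sq[OF that] by simp

lemma darboux_pot_mass_rate: "darboux_pot r = 2 * (mass_rate r)\<^sup>2 - 4 * slope r * mass_rate r" if "0 < r"
proof -
  have e: "(3 * r\<^sup>2 - r ^ 4 / 2) * exp (- (r\<^sup>2 / 4)) = (ground r)\<^sup>2 * (2 * slope r)"
    unfolding ground_sq[OF that] slope_def using that
    by (simp add: field_simps power2_eq_square power3_eq_cube power4_eq_xxxx)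
  show ?thesis
    unfolding darboux_pot_def e ground_sq[OF that, symmetric] mass_rate_def
    using mass_pos[OF that] by (simp add: field_simps power2_eq_square)
qed

lemma mass_rate_deriv: "(mass_rate has_real_derivative mass_rate r * (2 * slope r - mass_rate r)) (at r)" if "0 < r"
proof -
  have "((\<lambda>r. (ground r)\<^sup>2 / mass r) has_real_derivative
     (2 * ground r * (ground r * slope r) * mass r - (ground r)\<^sup>2 * (ground r)\<^sup>2) / (mass r * mass r)) (at r)"
    using mass_pos[OF that]
    by (auto intro!: derivative_eq_intros ground_deriv mass_deriv_ground that)
  also have "(2 * ground r * (ground r * slope r) * mass r - (ground r)\<^sup>2 * (ground r)\<^sup>2) / (mass r * mass r) =
     mass_rate r * (2 * slope r - mass_rate r)"
    unfolding mass_rate_def using mass_pos[OF that] by (simp add: field_simps power2_eq_square)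
  finally show ?thesis unfolding mass_rate_def .
qed

definition ground_ratio :: "real \<Rightarrow> real" where
  "ground_ratio r = ground r / mass r"

lemma ground_ratio_deriv: "(ground_ratio has_real_derivative ground_ratio r * (slope r - mass_rate r)) (at r)" if "0 < r"
proof -
  have "((\<lambda>r. ground r / mass r) has_real_derivative
     (ground r * slope r * mass r - ground r * (ground r)\<^sup>2) / (mass r * mass r)) (at r)"
    using mass_pos[OF that]
    by (auto intro!: derivative_eq_intros ground_deriv mass_deriv_ground that)
  also have "(ground r * slope r * mass r - ground r * (ground r)\<^sup>2) / (mass r * mass r) =
     ground_ratio r * (slope r - mass_rate r)"
    unfolding mass_rate_def ground_ratio_def using mass_pos[OF that] by (simp add: field_simps power2_eq_square)
  finally show ?thesis unfolding ground_ratio_def .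
qed

lemma ground_ratio_deriv2: "((\<lambda>r. ground_ratio r * (slope r - mass_rate r)) has_real_derivative
    ground_ratio r * (harmonic_pot r - 1 / 2 + darboux_pot r)) (at r)" if r: "0 < r"
proof -
  have "((\<lambda>r. ground_ratio r * (slope r - mass_rate r)) has_real_derivative
     ground_ratio r * (slope r - mass_rate r) * (slope r - mass_rate r) +
     ((- (3 / (2 * r\<^sup>2)) - 1 / 4) - mass_rate r * (2 * slope r - mass_rate r)) * ground_ratio r) (at r)"
    by (intro DERIV_mult DERIV_diff ground_ratio_deriv slope_deriv mass_rate_deriv r)
  also have "ground_ratio r * (slope r - mass_rate r) * (slope r - mass_rate r) +
     ((- (3 / (2 * r\<^sup>2)) - 1 / 4) - mass_rate r * (2 * slope r - mass_rate r)) * ground_ratio r =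
     ground_ratio r * (((slope r)\<^sup>2 + (- (3 / (2 * r\<^sup>2)) - 1 / 4)) + (2 * (mass_rate r)\<^sup>2 - 4 * slope r * mass_rate r))"
    by (simp add: algebra_simps power2_eq_square)
  also have "\<dots> = ground_ratio r * (harmonic_pot r - 1 / 2 + darboux_pot r)"
    unfolding slope_riccati[OF r] darboux_pot_mass_rate[OF r] ..
  finally show ?thesis .
qed

lemma continuous_on_pos_DERIV:
  "(\<And>r. 0 < r \<Longrightarrow> (f has_real_derivative f' r) (at r)) \<Longrightarrow> continuous_on {0<..} (f :: real \<Rightarrow> real)"
  by (auto intro!: continuous_at_imp_continuous_on DERIV_isCont)

lemmas ground_cont = continuous_on_pos_DERIV[OF ground_deriv]
  and slope_cont = continuous_on_pos_DERIV[OF slope_deriv]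
  and mass_cont = continuous_on_pos_DERIV[OF mass_deriv_ground]
  and mass_rate_cont = continuous_on_pos_DERIV[OF mass_rate_deriv]
  and ground_ratio_cont = continuous_on_pos_DERIV[OF ground_ratio_deriv]
  and sigma_cont = continuous_on_pos_DERIV[OF sigma_deriv]

lemma harmonic_pot_cont: "continuous_on {0<..} harmonic_pot"
  unfolding harmonic_pot_def by (intro continuous_intros) auto

lemma darboux_pot_cont: "continuous_on {0<..} darboux_pot"
proof -
  have "continuous_on {0<..} (\<lambda>r. 2 * (mass_rate r)\<^sup>2 - 4 * slope r * mass_rate r)"
    by (intro continuous_intros mass_rate_cont slope_cont)
  then show ?thesis by (rule continuous_on_eq) (simp add: darboux_pot_mass_rate)
qed

lemma ac_deriv_real:
  assumes "\<And>r. 0 < r \<Longrightarrow> (f has_real_derivative f' r) (at r)" "continuous_on {0<..} f'"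
  shows "ac_deriv (\<lambda>r. complex_of_real (f r)) (\<lambda>r. complex_of_real (f' r))"
  by (rule ac_deriv_C1) (use assms in \<open>auto intro!: has_vector_derivative_of_real continuous_intros\<close>)

lemma ground_sq_Icc:
  assumes ab: "0 < a" "a \<le> b"
  shows "set_integrable lborel {a..b} (\<lambda>r. (ground r)\<^sup>2)" "(LINT r:{a..b}|lborel. (ground r)\<^sup>2) = mass b - mass a"
proof -
  have c: "continuous_on {a..b} (\<lambda>r. (ground r)\<^sup>2)"
    by (rule continuous_on_subset[of "{0<..}"]) (use ab in \<open>auto intro!: continuous_intros ground_cont\<close>)
  then show "set_integrable lborel {a..b} (\<lambda>r. (ground r)\<^sup>2)" by (rule borel_integrable_atLeastAtMost')
  show "(LINT r:{a..b}|lborel. (ground r)\<^sup>2) = mass b - mass a"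
    unfolding set_lebesgue_integral_def
    by (rule integral_FTC_atLeastAtMost[OF ab(2) _ c])
       (use ab mass_deriv_ground in \<open>auto simp: has_real_derivative_iff_has_vector_derivative[symmetric] intro: has_field_derivative_at_within\<close>)
qed

lemma ground_sq_Icc_le: "0 < a \<Longrightarrow> a \<le> b \<Longrightarrow> (LINT r:{a..b}|lborel. (ground r)\<^sup>2) \<le> 8"
  using ground_sq_Icc(2)[of a b] mass_le[of b] mass_pos[of a] by simp

lemma ground_sq_integrable: "set_integrable lborel {0<..} (\<lambda>r. (ground r)\<^sup>2)"
  by (rule set_integrable_half_line[OF ground_sq_Icc(1) ground_sq_Icc_le]) auto

subsection \<open>The transform is a partial isometry\<close>

text \<open>The transform \<open>f - ground_ratio * Jf\<close>, \<open>Jf' = ground * f\<close>, of double commutation is a partial isometry because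
  \<open>\<bar>f - ground_ratio * Jf\<bar>\<^sup>2 = \<bar>f\<bar>\<^sup>2 - (\<bar>Jf\<bar>\<^sup>2 / mass)'\<close>.\<close>

lemma transform_identity:
  assumes J: "ac_deriv Jf (\<lambda>r. complex_of_real (ground r) * f r)"
    and f: "set_integrable lborel {0<..} (\<lambda>r. (cmod (f r))\<^sup>2)" and ab: "0 < a" "a \<le> b"
  shows "set_integrable lborel {a..b} (\<lambda>r. (cmod (f r - complex_of_real (ground_ratio r) * Jf r))\<^sup>2)"
    and "(LINT r:{a..b}|lborel. (cmod (f r - complex_of_real (ground_ratio r) * Jf r))\<^sup>2) =
      (LINT r:{a..b}|lborel. (cmod (f r))\<^sup>2) - (cmod (Jf b))\<^sup>2 / mass b + (cmod (Jf a))\<^sup>2 / mass a"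
proof -
  have id: "((\<lambda>r. 1 / mass r) has_real_derivative - ((ground r)\<^sup>2 / (mass r)\<^sup>2)) (at r)" if "0 < r" for r
    using mass_pos[OF that] mass_deriv_ground[OF that]
    by (auto intro!: derivative_eq_intros simp: power2_eq_square)
  have ic: "continuous_on {0<..} (\<lambda>r. - ((ground r)\<^sup>2 / (mass r)\<^sup>2))"
    by (intro continuous_intros ground_cont mass_cont) (auto dest: mass_pos)
  let ?E = "\<lambda>r. complex_of_real (- ((ground r)\<^sup>2 / (mass r)\<^sup>2)) * (Jf r * cnj (Jf r)) +
    complex_of_real (1 / mass r) * (complex_of_real (ground r) * f r * cnj (Jf r) + Jf r * cnj (complex_of_real (ground r) * f r))"
  have "ac_deriv (\<lambda>r. complex_of_real (1 / mass r) * (Jf r * cnj (Jf r))) ?E"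
    by (rule ac_deriv_mult[OF ac_deriv_real[OF id ic] ac_deriv_mult[OF J ac_deriv_cnj[OF J]]])
  note m = ac_derivD[OF this ab]
  have pt: "(cmod (f r))\<^sup>2 - Re (?E r) = (cmod (f r - complex_of_real (ground_ratio r) * Jf r))\<^sup>2" if "r \<in> {a..b}" for r
  proof -
    have m0: "mass r > 0" using that ab by (intro mass_pos) auto
    show ?thesis
      unfolding cmod_power2 ground_ratio_def using m0
      by (simp add: field_simps power2_eq_square)
  qed
  have fi: "set_integrable lborel {a..b} (\<lambda>r. (cmod (f r))\<^sup>2)"
    by (rule set_integrable_subset[OF f]) (use ab in auto)
  note d = set_integral_diff[OF fi set_integral_Re(1)[OF m(1)]]
  show "set_integrable lborel {a..b} (\<lambda>r. (cmod (f r - complex_of_real (ground_ratio r) * Jf r))\<^sup>2)"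
    by (rule iffD1[OF set_integrable_cong[OF refl refl pt] d(1)])
  have "(LINT r:{a..b}|lborel. (cmod (f r - complex_of_real (ground_ratio r) * Jf r))\<^sup>2) = (LINT r:{a..b}|lborel. (cmod (f r))\<^sup>2 - Re (?E r))"
    by (rule set_lebesgue_integral_cong) (use pt in auto)
  also have "\<dots> = (LINT r:{a..b}|lborel. (cmod (f r))\<^sup>2) - Re (complex_of_real (1 / mass b) * (Jf b * cnj (Jf b)) - complex_of_real (1 / mass a) * (Jf a * cnj (Jf a)))"
    unfolding d(2) set_integral_Re(2)[OF m(1)] m(2) ..
  also have "Re (complex_of_real (1 / mass b) * (Jf b * cnj (Jf b)) - complex_of_real (1 / mass a) * (Jf a * cnj (Jf a))) =
     (cmod (Jf b))\<^sup>2 / mass b - (cmod (Jf a))\<^sup>2 / mass a"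
    unfolding complex_norm_square[symmetric] of_real_mult[symmetric] by simp
  finally show "(LINT r:{a..b}|lborel. (cmod (f r - complex_of_real (ground_ratio r) * Jf r))\<^sup>2) =
      (LINT r:{a..b}|lborel. (cmod (f r))\<^sup>2) - (cmod (Jf b))\<^sup>2 / mass b + (cmod (Jf a))\<^sup>2 / mass a"
    by simp
qed

text \<open>By Cauchy--Schwarz \<open>\<bar>Jf a\<bar>\<^sup>2\<close> is at most \<open>mass a\<close> times the integral of \<open>\<bar>f\<bar>\<^sup>2\<close> over \<open>{0<..a}\<close>; the second factor
  tends to zero with \<open>a\<close>.\<close>

lemma transform_boundary_small:
  assumes J: "ac_deriv Jf (\<lambda>r. complex_of_real (ground r) * f r)"
    and f: "set_integrable lborel {0<..} (\<lambda>r. (cmod (f r))\<^sup>2)"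
    and J0: "((\<lambda>r. cmod (Jf r)) \<longlongrightarrow> 0) (at_right 0)" and e: "0 < e" and a: "0 < a"
  obtains a' where "0 < a'" "a' \<le> a" "(cmod (Jf a'))\<^sup>2 / mass a' \<le> e"
proof -
  let ?f = "\<lambda>r. (cmod (f r))\<^sup>2"
  let ?T = "LINT r:{0<..}|lborel. ?f r"
  have fi: "set_integrable lborel {x..y} ?f" if "0 < x" for x y
    by (rule set_integrable_subset[OF f]) (use that in auto)
  have "(\<lambda>k. LINT r:{1 / Suc k..Suc k}|lborel. ?f r) \<longlonglongrightarrow> ?T" by (rule exhaust_half_line[OF f])
  then have "eventually (\<lambda>k. (LINT r:{1 / Suc k..Suc k}|lborel. ?f r) > ?T - e) sequentially"
    by (rule order_tendstoD) (use e in auto)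
  moreover have "eventually (\<lambda>k. 1 / Suc k < a) sequentially"
    using order_tendstoD(2)[OF LIMSEQ_inverse_real_of_nat a] by (simp add: inverse_eq_divide)
  ultimately have "eventually (\<lambda>k. (LINT r:{1 / Suc k..Suc k}|lborel. ?f r) > ?T - e \<and> 1 / Suc k < a) sequentially"
    by eventually_elim auto
  then obtain k where k: "(LINT r:{1 / Suc k..Suc k}|lborel. ?f r) > ?T - e" "1 / real (Suc k) < a"
    using eventually_happens'[OF sequentially_bot] by blast
  define b where "b = 1 / real (Suc k)"
  have b: "0 < b" "b \<le> real (Suc k)"
  proof -
    show "0 < b" unfolding b_def by simp
    have "b \<le> 1" "1 \<le> real (Suc k)" unfolding b_def by simp_all
    then show "b \<le> real (Suc k)" by (rule order_trans)
  qed
  have small: "(LINT r:{x..b}|lborel. ?f r) \<le> e" if x: "0 < x" "x \<le> b" for x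
  proof -
    have "(LINT r:{x..b}|lborel. ?f r) + (LINT r:{b..Suc k}|lborel. ?f r) = (LINT r:{x..Suc k}|lborel. ?f r)"
      by (rule set_integral_Icc_split[symmetric, OF fi]) (use x b in auto)
    also have "\<dots> \<le> ?T" by (rule set_integral_mono_set[OF f]) (use x in auto)
    finally show ?thesis using k(1) unfolding b_def[symmetric] by simp
  qed
  have m0: "0 < mass b" by (rule mass_pos[OF b(1)])
  \<comment> \<open>The weight that optimises the inequality between arithmetic and geometric mean below.\<close>
  define c where "c = sqrt (e / mass b)"
  have c0: "0 < c" unfolding c_def using e m0 by simp
  have c2: "c * c = e / mass b" unfolding c_def using e m0 by simp
  have "cmod (Jf b) \<le> c * mass b"
  proof (rule field_le_epsilon)
    fix \<delta> :: real assume d: "0 < \<delta>"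
    obtain x where x: "0 < x" "x \<le> b" "\<bar>cmod (Jf x)\<bar> \<le> \<delta>"
      using near_zero[OF J0 d b(1)] by blast
    note JD = ac_derivD[OF J x(1,2)]
    have gi: "set_integrable lborel {x..b} (\<lambda>r. (ground r)\<^sup>2)"
      by (rule set_integrable_subset[OF ground_sq_integrable]) (use x in auto)
    have "cmod (Jf b - Jf x) \<le> (LINT r:{x..b}|lborel. c / 2 * (ground r)\<^sup>2 + 1 / (2 * c) * ?f r)"
      unfolding JD(2)[symmetric]
    proof (rule norm_set_integral_le[OF _ _ _ JD(1)])
      show "set_integrable lborel {x..b} (\<lambda>r. c / 2 * (ground r)\<^sup>2 + 1 / (2 * c) * ?f r)"
        by (intro set_integral_add set_integrable_mult_right gi fi x)
      fix r assume "r \<in> {x..b}"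
      then have g: "0 < ground r" using x by (intro ground_pos) auto
      have "0 \<le> (c * ground r - cmod (f r))\<^sup>2" by simp
      then show "cmod (complex_of_real (ground r) * f r) \<le> c / 2 * (ground r)\<^sup>2 + 1 / (2 * c) * ?f r"
        using c0 g by (simp add: norm_mult power2_diff power_mult_distrib field_simps power2_eq_square)
    qed simp
    also have "\<dots> = c / 2 * (LINT r:{x..b}|lborel. (ground r)\<^sup>2) + 1 / (2 * c) * (LINT r:{x..b}|lborel. ?f r)"
      by (subst set_integral_add(2)) (auto intro!: set_integrable_mult_right gi fi x)
    also have "(LINT r:{x..b}|lborel. (ground r)\<^sup>2) = mass b - mass x" by (rule ground_sq_Icc(2)[OF x(1,2)])
    also have "c / 2 * (mass b - mass x) + 1 / (2 * c) * (LINT r:{x..b}|lborel. ?f r) \<le> c / 2 * mass b + 1 / (2 * c) * e"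
      using c0 mass_pos[OF x(1)] small[OF x(1,2)] by (intro add_mono mult_left_mono) auto
    also have "1 / (2 * c) * e = c / 2 * mass b"
    proof -
      have "e = c * c * mass b" using c2 m0 by simp
      then show ?thesis using c0 by simp
    qed
    finally have "cmod (Jf b - Jf x) \<le> c * mass b" by simp
    then show "cmod (Jf b) \<le> c * mass b + \<delta>"
      using x(3) norm_triangle_ineq2[of "Jf b" "Jf x"] by simp
  qed
  then have "(cmod (Jf b))\<^sup>2 \<le> (c * mass b)\<^sup>2" by (intro power_mono) auto
  also have "\<dots> = e * mass b" using c2 m0 by (simp add: power2_eq_square field_simps)
  finally have "(cmod (Jf b))\<^sup>2 / mass b \<le> e" using m0 by (simp add: field_simps)
  then show ?thesis using that[of b] b k(2) unfolding b_def by simp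
qed

lemma transform_contraction:
  assumes J: "ac_deriv Jf (\<lambda>r. complex_of_real (ground r) * f r)"
    and f: "set_integrable lborel {0<..} (\<lambda>r. (cmod (f r))\<^sup>2)"
    and J0: "((\<lambda>r. cmod (Jf r)) \<longlongrightarrow> 0) (at_right 0)"
  defines "D \<equiv> \<lambda>r. f r - complex_of_real (ground_ratio r) * Jf r"
  shows "set_integrable lborel {0<..} (\<lambda>r. (cmod (D r))\<^sup>2)"
    and "(LINT r:{0<..}|lborel. (cmod (D r))\<^sup>2) \<le> (LINT r:{0<..}|lborel. (cmod (f r))\<^sup>2)"
proof -
  let ?T = "LINT r:{0<..}|lborel. (cmod (f r))\<^sup>2"
  have ti: "set_integrable lborel {a..b} (\<lambda>r. (cmod (D r))\<^sup>2)"
    "(LINT r:{a..b}|lborel. (cmod (D r))\<^sup>2) =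
      (LINT r:{a..b}|lborel. (cmod (f r))\<^sup>2) - (cmod (Jf b))\<^sup>2 / mass b + (cmod (Jf a))\<^sup>2 / mass a"
    if "0 < a" "a \<le> b" for a b
    unfolding D_def using transform_identity[OF J f that] by auto
  have le: "(LINT r:{a..b}|lborel. (cmod (D r))\<^sup>2) \<le> ?T" if ab: "0 < a" "a \<le> b" for a b
  proof (rule field_le_epsilon)
    fix e :: real assume e: "0 < e"
    obtain a' where a': "0 < a'" "a' \<le> a" "(cmod (Jf a'))\<^sup>2 / mass a' \<le> e"
      using transform_boundary_small[OF J f J0 e ab(1)] by blast
    have ab': "0 < a'" "a' \<le> b" using a' ab by auto
    have "(LINT r:{a..b}|lborel. (cmod (D r))\<^sup>2) \<le> (LINT r:{a'..b}|lborel. (cmod (D r))\<^sup>2)"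
      by (rule set_integral_mono_set[OF ti(1)[OF ab']]) (use a' in auto)
    also have "\<dots> = (LINT r:{a'..b}|lborel. (cmod (f r))\<^sup>2) - (cmod (Jf b))\<^sup>2 / mass b + (cmod (Jf a'))\<^sup>2 / mass a'"
      by (rule ti(2)[OF ab'])
    also have "\<dots> \<le> ?T - 0 + e"
      using a' mass_pos[of b] ab
      by (intro add_mono diff_mono set_integral_mono_set[OF f]) auto
    finally show "(LINT r:{a..b}|lborel. (cmod (D r))\<^sup>2) \<le> ?T + e" by simp
  qed
  show i: "set_integrable lborel {0<..} (\<lambda>r. (cmod (D r))\<^sup>2)"
    by (rule set_integrable_half_line[OF ti(1) le]) auto
  show "(LINT r:{0<..}|lborel. (cmod (D r))\<^sup>2) \<le> ?T"
    by (rule half_line_integral_le[OF i le])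
qed

text \<open>The norm can only drop by the limit of \<open>\<bar>Jf\<bar>\<^sup>2 / mass\<close> at infinity, which is zero for functions orthogonal to
  the ground state.\<close>

lemma transform_isometry:
  assumes J: "ac_deriv Jf (\<lambda>r. complex_of_real (ground r) * f r)"
    and f: "set_integrable lborel {0<..} (\<lambda>r. (cmod (f r))\<^sup>2)"
    and J0: "((\<lambda>r. cmod (Jf r)) \<longlongrightarrow> 0) (at_right 0)"
    and Jinf: "(\<lambda>k. Jf (real k)) \<longlonglongrightarrow> 0"
  defines "D \<equiv> \<lambda>r. f r - complex_of_real (ground_ratio r) * Jf r"
  shows "(LINT r:{0<..}|lborel. (cmod (f r))\<^sup>2) \<le> (LINT r:{0<..}|lborel. (cmod (D r))\<^sup>2)"
proof (rule half_line_integral_le[OF f])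
  let ?D = "LINT r:{0<..}|lborel. (cmod (D r))\<^sup>2"
  have ti: "set_integrable lborel {a..b} (\<lambda>r. (cmod (D r))\<^sup>2)"
    "(LINT r:{a..b}|lborel. (cmod (D r))\<^sup>2) =
      (LINT r:{a..b}|lborel. (cmod (f r))\<^sup>2) - (cmod (Jf b))\<^sup>2 / mass b + (cmod (Jf a))\<^sup>2 / mass a"
    if "0 < a" "a \<le> b" for a b
    unfolding D_def using transform_identity[OF J f that] by auto
  have tc: "set_integrable lborel {0<..} (\<lambda>r. (cmod (D r))\<^sup>2)"
    unfolding D_def by (rule transform_contraction(1)[OF J f J0])
  fix a b :: real assume ab: "0 < a" "a \<le> b"
  show "(LINT r:{a..b}|lborel. (cmod (f r))\<^sup>2) \<le> ?D"
  proof (rule field_le_epsilon)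
    fix e :: real assume e: "0 < e"
    have "(\<lambda>k. (cmod (Jf (real k)))\<^sup>2) \<longlonglongrightarrow> (cmod 0)\<^sup>2" by (intro tendsto_intros Jinf)
    then have "eventually (\<lambda>k. (cmod (Jf (real k)))\<^sup>2 < e * mass a) sequentially"
      by (rule order_tendstoD) (use e mass_pos[OF ab(1)] in auto)
    moreover have "eventually (\<lambda>k. b \<le> real k) sequentially"
      by (meson eventually_sequentiallyI nat_ceiling_le_eq)
    ultimately have "eventually (\<lambda>k. (cmod (Jf (real k)))\<^sup>2 < e * mass a \<and> b \<le> real k) sequentially"
      by eventually_elim auto
    then obtain k where k: "(cmod (Jf (real k)))\<^sup>2 < e * mass a" "b \<le> real k"
      using eventually_happens'[OF sequentially_bot] by blast
    have ak: "0 < a" "a \<le> real k" using ab k by auto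
    have "(cmod (Jf (real k)))\<^sup>2 / mass (real k) \<le> (cmod (Jf (real k)))\<^sup>2 / mass a"
      using mass_mono[of a "real k"] mass_pos[OF ab(1)] ak by (intro divide_left_mono) (auto intro!: mult_pos_pos mass_pos)
    also have "\<dots> \<le> e" using k(1) mass_pos[OF ab(1)] by (simp add: field_simps)
    finally have Je: "(cmod (Jf (real k)))\<^sup>2 / mass (real k) \<le> e" .
    have "(LINT r:{a..b}|lborel. (cmod (f r))\<^sup>2) \<le> (LINT r:{a..real k}|lborel. (cmod (f r))\<^sup>2)"
      by (rule set_integral_mono_set[OF set_integrable_subset[OF f]]) (use ab k in auto)
    also have "\<dots> = (LINT r:{a..real k}|lborel. (cmod (D r))\<^sup>2) + (cmod (Jf (real k)))\<^sup>2 / mass (real k) - (cmod (Jf a))\<^sup>2 / mass a"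
      using ti(2)[OF ak] by simp
    also have "\<dots> \<le> ?D + e - 0"
      using Je mass_pos[OF ab(1)] ab by (intro add_mono diff_mono set_integral_mono_set[OF tc]) auto
    finally show "(LINT r:{a..b}|lborel. (cmod (f r))\<^sup>2) \<le> ?D + e" by simp
  qed
qed


subsection \<open>Conjugation of the nonlocal equation\<close>

lemma ground_le: "ground r \<le> r" if "0 < r" "r \<le> 1"
proof -
  have "r powr (3 / 2) \<le> r powr 1" using that by (intro powr_mono') auto
  moreover have "gauss r \<le> 1" unfolding gauss_def by simp
  ultimately have "r powr (3 / 2) * gauss r \<le> r * 1"
    using that by (intro mult_mono) (auto simp: gauss_def)
  then show ?thesis unfolding ground_def by simp
qed

lemma mass_lower_unit: "r ^ 4 / 16 \<le> mass r" if "0 < r" "r \<le> 1"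
proof -
  have "r\<^sup>2 \<le> 1" using that by (simp add: power_le_one)
  then have "1 - r\<^sup>2 / 4 \<ge> 3 / 4" by simp
  then have "exp (- (r\<^sup>2 / 4)) \<ge> 1 / 4" using exp_ge_add_one_self[of "- (r\<^sup>2 / 4)"] by linarith
  then have "1 / 4 * r ^ 4 / 4 \<le> exp (- (r\<^sup>2 / 4)) * r ^ 4 / 4"
    by (intro divide_right_mono mult_right_mono) auto
  then show ?thesis using mass_lower[of r] by simp
qed

lemma ground_sq_le: "(ground r)\<^sup>2 \<le> r ^ 3" if "0 < r"
  unfolding ground_sq[OF that] using that by (simp add: mult_left_le)

lemma mass_rate_le: "0 \<le> mass_rate r" "mass_rate r \<le> 16 / r" if "0 < r" "r \<le> 1"
proof -
  have m: "0 < mass r" by (rule mass_pos[OF that(1)])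
  show "0 \<le> mass_rate r" unfolding mass_rate_def using m by simp
  have "mass_rate r \<le> r ^ 3 / (r ^ 4 / 16)"
    unfolding mass_rate_def using ground_sq_le[OF that(1)] mass_lower_unit[OF that] that
    by (intro frac_le) auto
  also have "\<dots> = 16 / r" using that by (simp add: power3_eq_cube power4_eq_xxxx)
  finally show "mass_rate r \<le> 16 / r" .
qed

lemma slope_le: "\<bar>slope r\<bar> \<le> 2 / r" if r: "0 < r" "r \<le> 1"
proof -
  have "r / 4 \<le> 1 / (2 * r)" using r mult_mono[of r 1 r 1] by (simp add: field_simps)
  moreover have "3 / (2 * r) = 1 / r + 1 / (2 * r)" "2 / r = 1 / r + 1 / r" using r by (simp_all add: field_simps)
  moreover have "1 / (2 * r) \<le> 1 / r" "0 < r / 4" "0 < 1 / r" using r by (simp_all add: field_simps)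
  ultimately show ?thesis unfolding slope_def by linarith
qed

lemma mass_tendsto_0: "(mass \<longlongrightarrow> 0) (at_right 0)"
proof -
  have "isCont mass 0" using mass_deriv by (rule DERIV_isCont)
  then have "(mass \<longlongrightarrow> mass 0) (at_right 0)" unfolding isCont_def by (rule filterlim_at_split[THEN iffD1, THEN conjunct2])
  then show ?thesis by (simp add: mass_def)
qed

definition ground_moment :: "(real \<Rightarrow> complex) \<Rightarrow> real \<Rightarrow> complex" where
  "ground_moment w = primitive0 (\<lambda>s. complex_of_real (ground s) * w s)"

text \<open>The Biot--Savart integral: \<open>K1 (gauss * w)\<close> equals \<open>r powr (3 / 2) * stream w\<close>. Written with primitives it is
  absolutely continuous, and its derivative \<open>- ground_moment w / r ^ 3\<close> is local in \<open>ground_moment w\<close>.\<close>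

definition stream :: "(real \<Rightarrow> complex) \<Rightarrow> real \<Rightarrow> complex" where
  "stream w r = 1 / 2 * (complex_of_real (1 / r\<^sup>2) * ground_moment w r +
     ((LINT s:{0<..}|lborel. complex_of_real (ground s / s\<^sup>2) * w s) - primitive0 (\<lambda>s. complex_of_real (ground s / s\<^sup>2) * w s) r))"

text \<open>Linear vanishing at the origin is the behaviour of domain elements; it makes all moments against the
  ground state and against the singular kernel converge.\<close>

locale half_line_function =
  fixes w w1 :: "real \<Rightarrow> complex" and C :: real
  assumes w: "ac_deriv w w1"
    and w_L2: "set_integrable lborel {0<..} (\<lambda>r. (cmod (w r))\<^sup>2)"
    and w_0: "\<And>r. 0 < r \<Longrightarrow> r \<le> 1 \<Longrightarrow> cmod (w r) \<le> C * r"
begin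

lemma C_nonneg: "0 \<le> C"
  using w_0[of 1] norm_ge_zero[of "w 1"] by linarith

lemma w_meas: "set_borel_measurable lborel {0<..} w"
  by (rule loc_integrable_measurable[OF loc_integrable_continuous[OF ac_deriv_continuous[OF w]]])

lemma weighted_meas:
  assumes "continuous_on {0<..} f"
  shows "set_borel_measurable lborel {0<..} (\<lambda>s. complex_of_real (f s) * w s)"
  by (rule loc_integrable_measurable[OF loc_integrable_continuous])
     (intro continuous_intros assms ac_deriv_continuous[OF w])

lemma moment_integrable: "set_integrable lborel {0<..} (\<lambda>s. complex_of_real (ground s) * w s)"
proof (rule set_integrable_bound)
  show "set_integrable lborel {0<..} (\<lambda>s. 1 / 2 * (ground s)\<^sup>2 + 1 / 2 * (cmod (w s))\<^sup>2)"
    by (intro set_integral_add set_integrable_mult_right ground_sq_integrable w_L2)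
  show "set_borel_measurable lborel {0<..} (\<lambda>s. complex_of_real (ground s) * w s)"
    by (rule weighted_meas[OF ground_cont])
  have "norm (complex_of_real (ground s) * w s) \<le> norm (1 / 2 * (ground s)\<^sup>2 + 1 / 2 * (cmod (w s))\<^sup>2)" for s
  proof -
    have "0 \<le> (\<bar>ground s\<bar> - cmod (w s))\<^sup>2" by simp
    then show ?thesis by (simp add: norm_mult power2_diff)
  qed
  then show "AE s in lborel. s \<in> {0<..} \<longrightarrow> norm (complex_of_real (ground s) * w s) \<le> norm (1 / 2 * (ground s)\<^sup>2 + 1 / 2 * (cmod (w s))\<^sup>2)"
    by simp
qed

lemma tail_integrable: "set_integrable lborel {0<..} (\<lambda>s. complex_of_real (ground s / s\<^sup>2) * w s)"
proof (rule set_integrable_bound)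
  have "integrable lborel (indicat_real {0..1::real})"
    using set_integrable_const_Icc[of 0 1 1] unfolding set_integrable_def by simp
  then have "integrable lborel (\<lambda>s::real. C * indicat_real {0..1} s)" by simp
  then have "set_integrable lborel {0<..} (\<lambda>s::real. C * indicat_real {0..1} s)"
    unfolding set_integrable_def by (rule integrable_mult_indicator[rotated]) simp
  then show "set_integrable lborel {0<..} (\<lambda>s. C * indicat_real {0..1} s + cmod (complex_of_real (ground s) * w s))"
    using set_integrable_norm[OF moment_integrable] by (intro set_integral_add) auto
  show "set_borel_measurable lborel {0<..} (\<lambda>s. complex_of_real (ground s / s\<^sup>2) * w s)"
    by (rule weighted_meas) (intro continuous_intros ground_cont, auto)
  have "norm (complex_of_real (ground s / s\<^sup>2) * w s) \<le> norm (C * indicat_real {0..1} s + cmod (complex_of_real (ground s) * w s))"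
    if s: "0 < s" for s
  proof (cases "s \<le> 1")
    case True
    have "ground s / s\<^sup>2 * cmod (w s) \<le> s / s\<^sup>2 * (C * s)"
      using ground_le[OF s True] w_0[OF s True] ground_pos[OF s] s C_nonneg
      by (intro mult_mono divide_right_mono) auto
    also have "\<dots> = C" using s by (simp add: power2_eq_square)
    finally have "norm (complex_of_real (ground s / s\<^sup>2) * w s) \<le> C"
      using ground_pos[OF s] by (simp add: norm_mult norm_divide norm_power)
    moreover have "0 \<le> cmod (complex_of_real (ground s) * w s)" by simp
    moreover have "C * indicat_real {0..1} s = C" using True s by simp
    ultimately show ?thesis unfolding real_norm_def using C_nonneg by linarith
  next
    case False
    have "ground s / s\<^sup>2 \<le> ground s / 1"
      using False ground_pos[OF s] by (intro divide_left_mono) auto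
    then have "ground s / s\<^sup>2 * cmod (w s) \<le> ground s * cmod (w s)" by (intro mult_right_mono) auto
    then show ?thesis using False ground_pos[OF s] by (simp add: norm_mult norm_divide norm_power)
  qed
  then show "AE s in lborel. s \<in> {0<..} \<longrightarrow> norm (complex_of_real (ground s / s\<^sup>2) * w s)
      \<le> norm (C * indicat_real {0..1} s + cmod (complex_of_real (ground s) * w s))"
    by simp
qed

abbreviation J :: "real \<Rightarrow> complex" where "J \<equiv> ground_moment w"
abbreviation P :: "real \<Rightarrow> complex" where "P \<equiv> stream w"

lemma J_deriv: "ac_deriv J (\<lambda>r. complex_of_real (ground r) * w r)"
  unfolding ground_moment_def by (rule primitive0_ac_deriv[OF moment_integrable])

text \<open>The contributions of \<open>w\<close> from the two halves of the kernel cancel.\<close>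

lemma P_deriv: "ac_deriv P (\<lambda>r. - complex_of_real (1 / r ^ 3) * J r)"
proof -
  have inv2: "ac_deriv (\<lambda>r. complex_of_real (1 / r\<^sup>2)) (\<lambda>r. complex_of_real (- (2 / r ^ 3)))"
    by (rule ac_deriv_real)
       (auto intro!: derivative_eq_intros continuous_intros simp: power2_eq_square power3_eq_cube)
  have "ac_deriv (\<lambda>r. 1 / 2 * (complex_of_real (1 / r\<^sup>2) * J r +
     ((LINT s:{0<..}|lborel. complex_of_real (ground s / s\<^sup>2) * w s) - primitive0 (\<lambda>s. complex_of_real (ground s / s\<^sup>2) * w s) r)))
     (\<lambda>r. 1 / 2 * ((complex_of_real (- (2 / r ^ 3)) * J r + complex_of_real (1 / r\<^sup>2) * (complex_of_real (ground r) * w r))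
       + (0 - complex_of_real (ground r / r\<^sup>2) * w r)))"
    by (intro ac_deriv_cmult ac_deriv_add ac_deriv_diff ac_deriv_mult inv2 J_deriv ac_deriv_const primitive0_ac_deriv tail_integrable)
  then show ?thesis
    by (rule ac_deriv_cong) (auto simp: stream_def)
qed

lemma J_bound: "cmod (J r) \<le> C * B * r" if r: "0 < r" "r \<le> 1" and g: "\<And>s. 0 < s \<Longrightarrow> s \<le> r \<Longrightarrow> ground s * s \<le> B"
  unfolding ground_moment_def
proof (rule primitive0_bound[OF moment_integrable r(1)])
  fix s assume s: "0 < s" "s \<le> r"
  have "ground s * cmod (w s) \<le> ground s * (C * s)"
    using w_0[of s] s r ground_pos[OF s(1)] by (intro mult_left_mono) auto
  also have "\<dots> = C * (ground s * s)" by simp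
  also have "\<dots> \<le> C * B" by (rule mult_left_mono[OF g[OF s] C_nonneg])
  finally show "cmod (complex_of_real (ground s) * w s) \<le> C * B"
    using ground_pos[OF s(1)] by (simp add: norm_mult)
qed

lemma J_bound_sharp: "cmod (J r) \<le> C * (r\<^sup>2 * r powr (3 / 2))" if r: "0 < r" "r \<le> 1"
proof -
  have "cmod (J r) \<le> C * (r powr (3 / 2) * r) * r"
  proof (rule J_bound[OF r])
    fix s assume s: "0 < s" "s \<le> r"
    have "ground s \<le> s powr (3 / 2) * 1"
      unfolding ground_def gauss_def by (intro mult_left_mono) auto
    also have "\<dots> \<le> r powr (3 / 2)" using s by (simp add: powr_mono2)
    finally show "ground s * s \<le> r powr (3 / 2) * r" using s by (intro mult_mono) auto
  qed
  also have "\<dots> = C * (r\<^sup>2 * r powr (3 / 2))" by (simp only: power2_eq_square ac_simps)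
  finally show ?thesis .
qed

lemma J_bound_quad: "cmod (J r) \<le> C * r\<^sup>2" if r: "0 < r" "r \<le> 1"
proof -
  have "r powr (3 / 2) \<le> 1" using r by (simp add: powr_le_one_le powr_le1)
  then have "C * (r\<^sup>2 * r powr (3 / 2)) \<le> C * (r\<^sup>2 * 1)" using C_nonneg by (intro mult_left_mono) auto
  then show ?thesis using J_bound_sharp[OF r] by simp
qed

lemma P_bound:
  obtains K where "0 \<le> K" "\<And>r. 0 < r \<Longrightarrow> cmod (P r) \<le> K"
proof -
  let ?h = "\<lambda>s. complex_of_real (ground s / s\<^sup>2) * w s" and ?g = "\<lambda>s. complex_of_real (ground s) * w s"
  have cb: "cmod (primitive0 f r) \<le> (LINT s:{0<..}|lborel. cmod (f s))" if f: "set_integrable lborel {0<..} f" for f r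
  proof -
    note ni = set_integrable_norm[OF f]
    have "cmod (primitive0 f r) \<le> (LINT s:{0<..r}|lborel. cmod (f s))"
      unfolding primitive0_def
      by (rule norm_set_integral_le[OF set_integrable_subset[OF ni] _ order_refl set_integrable_subset[OF f]]) auto
    also have "\<dots> \<le> (LINT s:{0<..}|lborel. cmod (f s))" by (rule set_integral_mono_set[OF ni]) auto
    finally show ?thesis .
  qed
  let ?M = "cmod (LINT s:{0<..}|lborel. ?h s)"
  let ?B = "LINT s:{0<..}|lborel. cmod (?h s)"
  let ?A = "LINT s:{0<..}|lborel. cmod (?g s)"
  have B: "0 \<le> ?B" "0 \<le> ?A" by (rule set_integral_nonneg, simp)+
  have Jr: "cmod (complex_of_real (1 / r\<^sup>2) * J r) \<le> C + ?A" if r: "0 < r" for r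
  proof -
    have e: "cmod (complex_of_real (1 / r\<^sup>2) * J r) = 1 / r\<^sup>2 * cmod (J r)" by (simp add: norm_mult norm_divide norm_power)
    show ?thesis
    proof (cases "r \<le> 1")
      case True
      have "1 / r\<^sup>2 * cmod (J r) \<le> 1 / r\<^sup>2 * (C * r\<^sup>2)" by (intro mult_left_mono J_bound_quad r True) simp
      also have "\<dots> = C" using r by simp
      finally show ?thesis unfolding e using B by simp
    next
      case False
      have "1 / r\<^sup>2 \<le> 1" using False by simp
      then have "1 / r\<^sup>2 * cmod (J r) \<le> 1 * ?A"
        using cb[OF moment_integrable] unfolding ground_moment_def by (intro mult_mono) auto
      then show ?thesis unfolding e using C_nonneg by simp
    qed
  qed
  show ?thesis
  proof (rule that[of "C + ?A + (?M + ?B)"])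
    show "0 \<le> C + ?A + (?M + ?B)" using B C_nonneg by simp
    fix r :: real assume r: "0 < r"
    have "2 * P r = complex_of_real (1 / r\<^sup>2) * J r + ((LINT s:{0<..}|lborel. ?h s) - primitive0 ?h r)"
      unfolding stream_def by (simp only: mult.assoc[symmetric]) simp
    then have "cmod (2 * P r) \<le> C + ?A + (?M + ?B)"
      using cb[OF tail_integrable, of r] Jr[OF r] by (simp only:) (intro order_trans[OF norm_triangle_ineq] add_mono order_trans[OF norm_triangle_ineq4] order_refl)
    moreover have "cmod (2 * P r) = 2 * cmod (P r)" by (simp add: norm_mult)
    ultimately show "cmod (P r) \<le> C + ?A + (?M + ?B)" using norm_ge_zero[of "P r"] by linarith
  qed
qed

end

text \<open>The equation \<open>H1 w = F\<close> for the regular representative \<open>w\<close>, with \<open>gauss * K1 (gauss * w)\<close> replaced by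
  \<open>ground * stream w\<close>.\<close>

locale nonlocal_solution = half_line_function +
  fixes F :: "real \<Rightarrow> complex" and \<beta> lam :: real
  assumes w1: "ac_deriv w1 (\<lambda>r. (complex_of_real (harmonic_pot r) + \<i> * complex_of_real (\<beta> * sigma r - lam)) * w r
        - \<i> * complex_of_real (\<beta> * ground r) * stream w r - F r)"
    and F_L2: "set_integrable lborel {0<..} (\<lambda>r. (cmod (F r))\<^sup>2)"
    and w1_0: "\<And>r. 0 < r \<Longrightarrow> r \<le> 1 \<Longrightarrow> cmod (w1 r) \<le> C"
    and orth: "(LINT s:{0<..}|lborel. complex_of_real (ground s) * w s) = 0"
begin

text \<open>The primitive of \<open>ground * F\<close>: the self-adjoint part of the operator contributes the Wronskian of \<open>w\<close> with the
  ground state, and the skew part contributes \<open>sigma * J - mass * P\<close>, in which the only nonlocal term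
  comes with the factor \<open>mass\<close>.\<close>

definition JF :: "real \<Rightarrow> complex" where
  "JF r = complex_of_real (ground r * slope r) * w r - complex_of_real (ground r) * w1 r
     + ((1 / 2 - \<i> * complex_of_real lam) * J r
     + \<i> * complex_of_real \<beta> * (complex_of_real (sigma r) * J r - complex_of_real (mass r) * P r))"

text \<open>For the skew part this rests on \<open>sigma' = - mass / r ^ 3\<close>, \<open>mass' = ground\<^sup>2\<close> and \<open>P' = - J / r ^ 3\<close>: the terms
  with \<open>J\<close> cancel.\<close>

lemma JF_deriv: "ac_deriv JF (\<lambda>r. complex_of_real (ground r) * F r)"
proof -
  have g: "ac_deriv (\<lambda>r. complex_of_real (ground r)) (\<lambda>r. complex_of_real (ground r * slope r))"
    by (rule ac_deriv_real) (auto intro!: ground_deriv continuous_intros ground_cont slope_cont)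
  have gs: "ac_deriv (\<lambda>r. complex_of_real (ground r * slope r)) (\<lambda>r. complex_of_real (ground r * (harmonic_pot r - 1 / 2)))"
  proof (rule ac_deriv_real)
    show "((\<lambda>r. ground r * slope r) has_real_derivative ground r * (harmonic_pot r - 1 / 2)) (at r)" if r: "0 < r" for r
    proof -
      have "((\<lambda>r. ground r * slope r) has_real_derivative
         ground r * slope r * slope r + (- (3 / (2 * r\<^sup>2)) - 1 / 4) * ground r) (at r)"
        by (rule DERIV_mult[OF ground_deriv[OF r] slope_deriv[OF r]])
      also have "ground r * slope r * slope r + (- (3 / (2 * r\<^sup>2)) - 1 / 4) * ground r =
          ground r * ((slope r)\<^sup>2 + (- (3 / (2 * r\<^sup>2)) - 1 / 4))"
        by (simp add: algebra_simps power2_eq_square)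
      finally show ?thesis unfolding slope_riccati[OF r] .
    qed
  qed (intro continuous_intros ground_cont harmonic_pot_cont)
  have sg: "ac_deriv (\<lambda>r. complex_of_real (sigma r)) (\<lambda>r. complex_of_real (- (mass r / r ^ 3)))"
    by (rule ac_deriv_real[OF sigma_deriv]) (auto intro!: continuous_intros mass_cont)
  have ms: "ac_deriv (\<lambda>r. complex_of_real (mass r)) (\<lambda>r. complex_of_real ((ground r)\<^sup>2))"
    by (rule ac_deriv_real[OF mass_deriv_ground]) (auto intro!: continuous_intros ground_cont)
  show ?thesis
  proof (rule ac_deriv_cong)
    show "ac_deriv (\<lambda>r. complex_of_real (ground r * slope r) * w r - complex_of_real (ground r) * w1 r
     + ((1 / 2 - \<i> * complex_of_real lam) * J r
     + \<i> * complex_of_real \<beta> * (complex_of_real (sigma r) * J r - complex_of_real (mass r) * P r)))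
     (\<lambda>r. (complex_of_real (ground r * (harmonic_pot r - 1 / 2)) * w r + complex_of_real (ground r * slope r) * w1 r)
       - (complex_of_real (ground r * slope r) * w1 r + complex_of_real (ground r) *
          ((complex_of_real (harmonic_pot r) + \<i> * complex_of_real (\<beta> * sigma r - lam)) * w r
            - \<i> * complex_of_real (\<beta> * ground r) * P r - F r))
       + ((1 / 2 - \<i> * complex_of_real lam) * (complex_of_real (ground r) * w r)
       + \<i> * complex_of_real \<beta> * ((complex_of_real (- (mass r / r ^ 3)) * J r + complex_of_real (sigma r) * (complex_of_real (ground r) * w r))
          - (complex_of_real ((ground r)\<^sup>2) * P r + complex_of_real (mass r) * (- complex_of_real (1 / r ^ 3) * J r)))))"
      by (intro ac_deriv_add ac_deriv_diff ac_deriv_cmult ac_deriv_mult g gs sg ms w w1 J_deriv P_deriv)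
  qed (auto simp: JF_def algebra_simps power2_eq_square)
qed

lemma JF_0: "((\<lambda>r. cmod (JF r)) \<longlongrightarrow> 0) (at_right 0)"
proof -
  obtain K where K: "0 \<le> K" "\<And>r. 0 < r \<Longrightarrow> cmod (P r) \<le> K" by (rule P_bound) (rule that)
  define A where "A = cmod (1 / 2 - \<i> * complex_of_real lam)"
  have bound: "cmod (JF r) \<le> (2 * C + C + A * C + \<bar>\<beta>\<bar> * C) * r + \<bar>\<beta>\<bar> * K * mass r" if r: "0 < r" "r \<le> 1" for r
  proof -
    have g: "0 < ground r" "ground r \<le> r" using ground_pos ground_le r by auto
    note sl = slope_le[OF r]
    have r2: "r\<^sup>2 \<le> r" using r by (simp add: power2_eq_square mult_left_le)
    have J': "cmod (J r) \<le> C * r" using J_bound_quad[OF r] mult_left_mono[OF r2 C_nonneg] by linarith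
    have 1: "cmod (complex_of_real (ground r * slope r) * w r) \<le> 2 * C * r"
    proof -
      have "ground r * \<bar>slope r\<bar> * cmod (w r) \<le> r * (2 / r) * (C * r)"
        by (intro mult_mono g sl w_0 r) (use g C_nonneg r in auto)
      also have "\<dots> = 2 * C * r" using r by simp
      finally show ?thesis using g by (simp add: norm_mult abs_mult)
    qed
    have 2: "cmod (complex_of_real (ground r) * w1 r) \<le> C * r"
    proof -
      have "ground r * cmod (w1 r) \<le> r * C" by (intro mult_mono g w1_0 r) (use g r in auto)
      then show ?thesis using g by (simp add: norm_mult mult.commute)
    qed
    have 3: "cmod ((1 / 2 - \<i> * complex_of_real lam) * J r) \<le> A * C * r"
      unfolding norm_mult A_def[symmetric] using mult_left_mono[OF J', of A] by (simp add: A_def mult.assoc)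
    have 4: "cmod (\<i> * complex_of_real \<beta> * (complex_of_real (sigma r) * J r - complex_of_real (mass r) * P r))
        \<le> \<bar>\<beta>\<bar> * (C * r + K * mass r)"
    proof -
      have s: "0 \<le> sigma r" "sigma r \<le> 1" using sigma_pos sigma_le_1 r by (auto intro: less_imp_le)
      have "cmod (complex_of_real (sigma r) * J r) \<le> C * r"
        using mult_mono[OF s(2) J'] s by (simp add: norm_mult)
      moreover have "cmod (complex_of_real (mass r) * P r) \<le> K * mass r"
        using mult_left_mono[OF K(2)[OF r(1)], of "mass r"] mass_pos[OF r(1)] by (simp add: norm_mult mult.commute)
      ultimately have "cmod (complex_of_real (sigma r) * J r - complex_of_real (mass r) * P r) \<le> C * r + K * mass r"
        by (meson norm_triangle_le_diff add_mono order_trans)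
      then show ?thesis unfolding norm_mult by (simp add: mult_left_mono)
    qed
    have "cmod (JF r) \<le> (2 * C * r + C * r) + (A * C * r + \<bar>\<beta>\<bar> * (C * r + K * mass r))"
      unfolding JF_def
      by (intro order_trans[OF norm_triangle_ineq] add_mono 1 2 3 4 order_trans[OF norm_triangle_ineq4])
    then show ?thesis by (simp add: algebra_simps)
  qed
  show ?thesis
  proof (rule tendsto_sandwich[where f="\<lambda>_. 0"])
    show "((\<lambda>r. (2 * C + C + A * C + \<bar>\<beta>\<bar> * C) * r + \<bar>\<beta>\<bar> * K * mass r) \<longlongrightarrow> 0) (at_right 0)"
      by (rule tendsto_eq_intros tendsto_add_zero tendsto_mult_right_zero mass_tendsto_0 tendsto_ident_at refl | simp)+
    have "eventually (\<lambda>x. x \<in> {0<..<1}) (at_right (0::real))"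
      by (rule eventually_at_right_real) simp
    then show "eventually (\<lambda>r. cmod (JF r) \<le> (2 * C + C + A * C + \<bar>\<beta>\<bar> * C) * r + \<bar>\<beta>\<bar> * K * mass r) (at_right 0)"
      by eventually_elim (rule bound, auto)
  qed auto
qed

lemma J_0: "((\<lambda>r. cmod (J r)) \<longlongrightarrow> 0) (at_right 0)"
proof (rule tendsto_sandwich[where f="\<lambda>_. 0"])
  show "((\<lambda>r. C * r\<^sup>2) \<longlongrightarrow> 0) (at_right 0)" by (rule tendsto_eq_intros refl | simp)+
  have "eventually (\<lambda>x. x \<in> {0<..<1}) (at_right (0::real))"
    by (rule eventually_at_right_real) simp
  then show "eventually (\<lambda>r. cmod (J r) \<le> C * r\<^sup>2) (at_right 0)"
    by eventually_elim (rule J_bound_quad, auto)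
qed auto

lemma J_infinity: "(\<lambda>k. J (real k)) \<longlonglongrightarrow> 0"
  unfolding ground_moment_def using primitive0_tendsto[OF moment_integrable] unfolding orth .

text \<open>The transforms of \<open>w\<close> and \<open>F\<close>, with the derivative of the former.\<close>

definition u :: "real \<Rightarrow> complex" where "u r = w r - complex_of_real (ground_ratio r) * J r"
definition u1 :: "real \<Rightarrow> complex" where
  "u1 r = w1 r - (complex_of_real (ground_ratio r * (slope r - mass_rate r)) * J r + complex_of_real (mass_rate r) * w r)"
definition G :: "real \<Rightarrow> complex" where "G r = F r - complex_of_real (ground_ratio r) * JF r"

lemma ground_ratio_ground: "ground_ratio r * ground r = mass_rate r"
  unfolding ground_ratio_def mass_rate_def by (simp add: power2_eq_square)

lemma ground_ratio_mass: "ground_ratio r * mass r = ground r" if "0 < r"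
  unfolding ground_ratio_def using mass_pos[OF that] by simp

lemma u_deriv: "ac_deriv u u1"
proof -
  have k: "ac_deriv (\<lambda>r. complex_of_real (ground_ratio r)) (\<lambda>r. complex_of_real (ground_ratio r * (slope r - mass_rate r)))"
    by (rule ac_deriv_real) (auto intro!: ground_ratio_deriv continuous_intros ground_ratio_cont slope_cont mass_rate_cont)
  have "ac_deriv (\<lambda>r. w r - complex_of_real (ground_ratio r) * J r)
     (\<lambda>r. w1 r - (complex_of_real (ground_ratio r * (slope r - mass_rate r)) * J r + complex_of_real (ground_ratio r) * (complex_of_real (ground r) * w r)))"
    by (intro ac_deriv_diff ac_deriv_mult k w J_deriv)
  then show ?thesis
    by (rule ac_deriv_cong) (auto simp: u_def u1_def ground_ratio_ground[symmetric] mult.assoc)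
qed

text \<open>The heart of the matter: since \<open>ground_ratio * mass = ground\<close>, the nonlocal term of \<open>JF\<close> cancels that of the
  equation, and \<open>u\<close> solves a local equation with the potential \<open>darboux_pot\<close> added.\<close>

lemma u1_deriv: "ac_deriv u1 (\<lambda>r. (complex_of_real (harmonic_pot r + darboux_pot r) + \<i> * complex_of_real (\<beta> * sigma r - lam)) * u r - G r)"
proof -
  have k': "ac_deriv (\<lambda>r. complex_of_real (ground_ratio r * (slope r - mass_rate r))) (\<lambda>r. complex_of_real (ground_ratio r * (harmonic_pot r - 1 / 2 + darboux_pot r)))"
    by (rule ac_deriv_real) (auto intro!: ground_ratio_deriv2 continuous_intros ground_ratio_cont harmonic_pot_cont darboux_pot_cont)
  have m: "ac_deriv (\<lambda>r. complex_of_real (mass_rate r)) (\<lambda>r. complex_of_real (mass_rate r * (2 * slope r - mass_rate r)))"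
    by (rule ac_deriv_real) (auto intro!: mass_rate_deriv continuous_intros slope_cont mass_rate_cont)
  show ?thesis
  proof (rule ac_deriv_cong)
    show "ac_deriv (\<lambda>r. w1 r - (complex_of_real (ground_ratio r * (slope r - mass_rate r)) * J r + complex_of_real (mass_rate r) * w r))
     (\<lambda>r. ((complex_of_real (harmonic_pot r) + \<i> * complex_of_real (\<beta> * sigma r - lam)) * w r
        - \<i> * complex_of_real (\<beta> * ground r) * P r - F r) -
       ((complex_of_real (ground_ratio r * (harmonic_pot r - 1 / 2 + darboux_pot r)) * J r + complex_of_real (ground_ratio r * (slope r - mass_rate r)) * (complex_of_real (ground r) * w r))
       + (complex_of_real (mass_rate r * (2 * slope r - mass_rate r)) * w r + complex_of_real (mass_rate r) * w1 r)))"
      by (intro ac_deriv_add ac_deriv_diff ac_deriv_mult k' m w w1 J_deriv)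
    fix r :: real assume r: "0 < r"
    let ?k = "complex_of_real (ground_ratio r)" and ?m = "complex_of_real (mass_rate r)" and ?s = "complex_of_real (slope r)"
      and ?g = "complex_of_real (ground r)" and ?q = "complex_of_real (harmonic_pot r)" and ?V = "complex_of_real (darboux_pot r)"
      and ?N = "complex_of_real (mass r)"
    have kg: "?k * ?g = ?m" and kN: "?k * ?N = ?g" and V: "?V = 2 * ?m\<^sup>2 - 4 * ?s * ?m"
      using ground_ratio_ground[of r] ground_ratio_mass[OF r] unfolding darboux_pot_mass_rate[OF r] by (simp_all flip: of_real_mult) simp
    have kJF: "?k * JF r = ?m * ?s * w r - ?m * w1 r + (1 / 2 - \<i> * complex_of_real lam) * (?k * J r)
        + \<i> * complex_of_real \<beta> * (complex_of_real (sigma r) * (?k * J r) - ?g * P r)"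
    proof -
      have "?k * JF r = (?k * ?g) * ?s * w r - (?k * ?g) * w1 r + (1 / 2 - \<i> * complex_of_real lam) * (?k * J r)
        + \<i> * complex_of_real \<beta> * (complex_of_real (sigma r) * (?k * J r) - (?k * ?N) * P r)"
        unfolding JF_def of_real_mult by (simp add: algebra_simps)
      then show ?thesis unfolding kg kN .
    qed
    have c: "complex_of_real (ground_ratio r * (slope r - mass_rate r)) * (?g * w r) = (?s - ?m) * ?m * w r"
    proof -
      have "complex_of_real (ground_ratio r * (slope r - mass_rate r)) * (?g * w r) = (?s - ?m) * (?k * ?g) * w r"
        by simp
      then show ?thesis unfolding kg .
    qed
    show "((?q + \<i> * complex_of_real (\<beta> * sigma r - lam)) * w r
        - \<i> * complex_of_real (\<beta> * ground r) * P r - F r) -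
       ((complex_of_real (ground_ratio r * (harmonic_pot r - 1 / 2 + darboux_pot r)) * J r + complex_of_real (ground_ratio r * (slope r - mass_rate r)) * (?g * w r))
       + (complex_of_real (mass_rate r * (2 * slope r - mass_rate r)) * w r + ?m * w1 r)) =
      (complex_of_real (harmonic_pot r + darboux_pot r) + \<i> * complex_of_real (\<beta> * sigma r - lam)) * u r - G r"
      unfolding c unfolding u_def G_def right_diff_distrib[of _ _ "?k * J r"] kJF of_real_add of_real_mult of_real_diff V
      by (simp add: algebra_simps power2_eq_square)
  qed (simp add: u1_def)
qed

lemma kJ_bound: "cmod (complex_of_real (ground_ratio r) * J r) \<le> 16 * C * r" if r: "0 < r" "r \<le> 1"
proof -
  have h2: "r powr (3 / 2) * r powr (3 / 2) = r ^ 3"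
    using r by (simp add: powr_add[symmetric] powr_numeral)
  have g: "0 < ground r" "ground r \<le> r powr (3 / 2)"
    using ground_pos[OF r(1)] unfolding ground_def gauss_def by (auto simp: mult_left_le)
  have k: "0 \<le> ground_ratio r" "ground_ratio r \<le> r powr (3 / 2) / (r ^ 4 / 16)"
  proof -
    have m: "0 < mass r" by (rule mass_pos[OF r(1)])
    show "0 \<le> ground_ratio r" unfolding ground_ratio_def using g m by simp
    show "ground_ratio r \<le> r powr (3 / 2) / (r ^ 4 / 16)"
      unfolding ground_ratio_def by (rule frac_le) (use g mass_lower_unit[OF r] r in auto)
  qed
  have "ground_ratio r * cmod (J r) \<le> r powr (3 / 2) / (r ^ 4 / 16) * (C * (r\<^sup>2 * r powr (3 / 2)))"
    by (intro mult_mono k J_bound_sharp r) (use r in auto)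
  also have "\<dots> = 16 * C * (r powr (3 / 2) * r powr (3 / 2)) * r\<^sup>2 / r ^ 4" by simp
  also have "\<dots> = 16 * C * r" unfolding h2 using r by (simp add: power2_eq_square power3_eq_cube power4_eq_xxxx)
  finally show ?thesis using k by (simp add: norm_mult)
qed

lemma u_bound: "cmod (u r) \<le> 17 * C * r" if r: "0 < r" "r \<le> 1"
  unfolding u_def using norm_triangle_ineq4[of "w r" "complex_of_real (ground_ratio r) * J r"] kJ_bound[OF r] w_0[OF r] by simp

lemma u1_bound: "cmod (u1 r) \<le> 400 * C" if r: "0 < r" "r \<le> 1"
proof -
  have sl: "\<bar>slope r - mass_rate r\<bar> \<le> 18 / r"
  proof -
    have "\<bar>slope r\<bar> \<le> 2 / r" by (rule slope_le[OF r])
    moreover have "18 / r = 2 / r + 16 / r" using r by (simp add: field_simps)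
    ultimately show ?thesis using mass_rate_le[OF r] by linarith
  qed
  have "cmod (complex_of_real (ground_ratio r * (slope r - mass_rate r)) * J r) = \<bar>slope r - mass_rate r\<bar> * cmod (complex_of_real (ground_ratio r) * J r)"
    unfolding norm_mult norm_of_real abs_mult by simp
  also have "\<dots> \<le> 18 / r * (16 * C * r)"
    by (intro mult_mono sl kJ_bound r) (use r in auto)
  also have "\<dots> = 288 * C" using r by simp
  finally have 1: "cmod (complex_of_real (ground_ratio r * (slope r - mass_rate r)) * J r) \<le> 288 * C" .
  have "cmod (complex_of_real (mass_rate r) * w r) \<le> 16 / r * (C * r)"
    unfolding norm_mult using mass_rate_le[OF r] w_0[OF r] r by (intro mult_mono) auto
  also have "\<dots> = 16 * C" using r by simp
  finally have 2: "cmod (complex_of_real (mass_rate r) * w r) \<le> 16 * C" .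
  have "cmod (u1 r) \<le> C + (288 * C + 16 * C)"
    unfolding u1_def
    by (intro order_trans[OF norm_triangle_ineq4] order_trans[OF norm_triangle_ineq] add_mono w1_0 1 2 r)
  then show ?thesis using C_nonneg by simp
qed

lemma conjugated: "resolvent_solution u u1 G (\<lambda>r. harmonic_pot r + darboux_pot r) (\<lambda>r. \<beta> * sigma r - lam)"
proof
  show "ac_deriv u u1" by (rule u_deriv)
  show "ac_deriv u1 (\<lambda>r. (complex_of_real (harmonic_pot r + darboux_pot r) + \<i> * complex_of_real (\<beta> * sigma r - lam)) * u r - G r)"
    by (rule u1_deriv)
  show "continuous_on {0<..} (\<lambda>r. harmonic_pot r + darboux_pot r)" by (intro continuous_intros harmonic_pot_cont darboux_pot_cont)
  show "continuous_on {0<..} (\<lambda>r. \<beta> * sigma r - lam)" by (intro continuous_intros sigma_cont)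
  show "set_integrable lborel {0<..} (\<lambda>r. (cmod (u r))\<^sup>2)"
    unfolding u_def by (rule transform_contraction(1)[OF J_deriv w_L2 J_0])
  show "set_integrable lborel {0<..} (\<lambda>r. (cmod (G r))\<^sup>2)"
    unfolding G_def by (rule transform_contraction(1)[OF JF_deriv F_L2 JF_0])
  have ev: "eventually (\<lambda>x. x \<in> {0<..<1}) (at_right (0::real))"
    by (rule eventually_at_right_real) simp
  show "((\<lambda>r. cmod (u r)) \<longlongrightarrow> 0) (at_right 0)"
  proof (rule tendsto_sandwich[where f="\<lambda>_. 0"])
    show "((\<lambda>r. 17 * C * r) \<longlongrightarrow> 0) (at_right 0)" by (rule tendsto_eq_intros refl | simp)+
    show "eventually (\<lambda>r. cmod (u r) \<le> 17 * C * r) (at_right 0)"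
      using ev by eventually_elim (rule u_bound, auto)
  qed auto
  show "((\<lambda>r. cmod (u1 r) * cmod (u r)) \<longlongrightarrow> 0) (at_right 0)"
  proof (rule tendsto_sandwich[where f="\<lambda>_. 0"])
    show "((\<lambda>r. 400 * C * (17 * C * r)) \<longlongrightarrow> 0) (at_right 0)" by (rule tendsto_eq_intros refl | simp)+
    show "eventually (\<lambda>r. cmod (u1 r) * cmod (u r) \<le> 400 * C * (17 * C * r)) (at_right 0)"
      using ev by eventually_elim (rule mult_mono, use C_nonneg u_bound u1_bound in auto)
  qed auto
qed

text \<open>The transform preserves the norm of \<open>w\<close> and does not increase that of \<open>F\<close>, so the estimate for the local
  operator carries over.\<close>

lemma nonlocal_lower_bound:
  assumes s: "0 < s" and F_le: "(LINT r:{0<..}|lborel. (cmod (F r))\<^sup>2) \<le> s ^ 4 * (LINT r:{0<..}|lborel. (cmod (w r))\<^sup>2)"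
    and pos: "0 < (LINT r:{0<..}|lborel. (cmod (w r))\<^sup>2)"
  shows "\<bar>\<beta>\<bar> \<le> (2600 * s\<^sup>2) ^ 3"
proof (cases "\<beta> = 0")
  case True
  then show ?thesis by simp
next
  case False
  interpret R: resolvent_solution u u1 G "\<lambda>r. harmonic_pot r + darboux_pot r" "\<lambda>r. \<beta> * sigma r - lam" by (rule conjugated)
  have n: "(LINT r:{0<..}|lborel. (cmod (w r))\<^sup>2) \<le> R.norm_sq"
    unfolding R.norm_sq_def u_def by (rule transform_isometry[OF J_deriv w_L2 J_0 J_infinity])
  have "(LINT r:{0<..}|lborel. (cmod (G r))\<^sup>2) \<le> (LINT r:{0<..}|lborel. (cmod (F r))\<^sup>2)"
    unfolding G_def by (rule transform_contraction(2)[OF JF_deriv F_L2 JF_0])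
  also have "\<dots> \<le> s ^ 4 * R.norm_sq" using F_le mult_left_mono[OF n, of "s ^ 4"] by simp
  finally have Gle: "(LINT r:{0<..}|lborel. (cmod (G r))\<^sup>2) \<le> s ^ 4 * R.norm_sq" .
  show ?thesis
  proof (rule R.resolvent_lower_bound[OF s Gle])
    show "\<beta> * sigma r - lam = \<beta> * (sigma r - lam / \<beta>)" for r using False by (simp add: algebra_simps)
    show "(1 + r\<^sup>2) / 400 \<le> harmonic_pot r + darboux_pot r" if "0 < r" for r by (rule effective_potential_lower[OF that])
    show "0 < R.norm_sq" using n pos by simp
  qed
qed

end


section \<open>Domain regularity and the lower bound\<close>

lemma set_meas_mult:
  fixes f g :: "real \<Rightarrow> complex"
  assumes "set_borel_measurable lborel A f" "set_borel_measurable lborel A g"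
  shows "set_borel_measurable lborel A (\<lambda>x. f x * g x)"
proof -
  have "(\<lambda>x. indicator A x *\<^sub>R (f x * g x)) = (\<lambda>x. (indicator A x *\<^sub>R f x) * (indicator A x *\<^sub>R g x))"
    by (auto simp: indicator_def)
  then show ?thesis using assms unfolding set_borel_measurable_def by (simp only: borel_measurable_times)
qed

lemma set_meas_add:
  fixes f g :: "real \<Rightarrow> complex"
  assumes "set_borel_measurable lborel A f" "set_borel_measurable lborel A g"
  shows "set_borel_measurable lborel A (\<lambda>x. f x + g x)"
  using assms unfolding set_borel_measurable_def scaleR_add_right by simp

lemma set_meas_diff:
  fixes f g :: "real \<Rightarrow> complex"
  assumes "set_borel_measurable lborel A f" "set_borel_measurable lborel A g"
  shows "set_borel_measurable lborel A (\<lambda>x. f x - g x)"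
  using assms unfolding set_borel_measurable_def scaleR_diff_right by simp

lemma set_meas_continuous: "continuous_on {0<..} f \<Longrightarrow> set_borel_measurable lborel {0<..} (f :: real \<Rightarrow> complex)"
  by (rule loc_integrable_measurable[OF loc_integrable_continuous])

lemma set_meas_cmod_sq:
  fixes f :: "real \<Rightarrow> complex"
  assumes "set_borel_measurable lborel A f"
  shows "set_borel_measurable lborel A (\<lambda>x. (cmod (f x))\<^sup>2)"
proof -
  have "(\<lambda>x. indicator A x *\<^sub>R (cmod (f x))\<^sup>2) = (\<lambda>x. (cmod (indicator A x *\<^sub>R f x))\<^sup>2)"
    by (auto simp: indicator_def)
  moreover have "(\<lambda>x. (cmod (indicator A x *\<^sub>R f x))\<^sup>2) \<in> borel_measurable lborel"
    using assms unfolding set_borel_measurable_def by measurable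
  ultimately show ?thesis unfolding set_borel_measurable_def by (simp only:)
qed

lemma set_meas_cong: "(\<And>x. x \<in> A \<Longrightarrow> f x = g x) \<Longrightarrow> set_borel_measurable lborel A f \<Longrightarrow> set_borel_measurable lborel A (g :: real \<Rightarrow> complex)"
proof -
  assume e: "\<And>x. x \<in> A \<Longrightarrow> f x = g x" and m: "set_borel_measurable lborel A f"
  have "(\<lambda>x. indicator A x *\<^sub>R f x) = (\<lambda>x. indicator A x *\<^sub>R g x)" using e by (auto simp: indicator_def fun_eq_iff)
  then show ?thesis using m unfolding set_borel_measurable_def by simp
qed

text \<open>Norm inequalities are only required almost everywhere, so that this also transports membership between
  representatives.\<close>

lemma L2_bound:
  assumes g: "g \<in> L2_pos" and m: "set_borel_measurable lborel {0<..} f"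
    and le: "AE r in lborel. 0 < r \<longrightarrow> cmod (f r) \<le> K * cmod (g r)"
  shows "f \<in> L2_pos"
proof -
  have "set_integrable lborel {0<..} (\<lambda>r. (cmod (f r))\<^sup>2)"
  proof (rule set_integrable_bound)
    show "set_integrable lborel {0<..} (\<lambda>r. K\<^sup>2 * (cmod (g r))\<^sup>2)" using g unfolding L2_pos_def by auto
    show "set_borel_measurable lborel {0<..} (\<lambda>r. (cmod (f r))\<^sup>2)" by (rule set_meas_cmod_sq[OF m])
    show "AE r in lborel. r \<in> {0<..} \<longrightarrow> norm ((cmod (f r))\<^sup>2) \<le> norm (K\<^sup>2 * (cmod (g r))\<^sup>2)"
      using le
    proof eventually_elim
      case (elim r)
      show ?case
      proof
        assume "r \<in> {0<..}"
        then have "(cmod (f r))\<^sup>2 \<le> (K * cmod (g r))\<^sup>2" using elim by (intro power_mono) auto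
        then show "norm ((cmod (f r))\<^sup>2) \<le> norm (K\<^sup>2 * (cmod (g r))\<^sup>2)" by (simp add: power_mult_distrib)
      qed
    qed
  qed
  then show ?thesis using m unfolding L2_pos_def by simp
qed

lemma L2_add:
  assumes f: "f \<in> L2_pos" and g: "g \<in> L2_pos"
  shows "(\<lambda>r. f r + g r) \<in> L2_pos"
proof -
  have m: "set_borel_measurable lborel {0<..} (\<lambda>r. f r + g r)" using f g unfolding L2_pos_def by (auto intro: set_meas_add)
  have "set_integrable lborel {0<..} (\<lambda>r. (cmod (f r + g r))\<^sup>2)"
  proof (rule set_integrable_bound)
    show "set_integrable lborel {0<..} (\<lambda>r. 2 * (cmod (f r))\<^sup>2 + 2 * (cmod (g r))\<^sup>2)"
      using f g unfolding L2_pos_def by (auto intro: set_integral_add)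
    show "set_borel_measurable lborel {0<..} (\<lambda>r. (cmod (f r + g r))\<^sup>2)" by (rule set_meas_cmod_sq[OF m])
    have "(cmod (f r + g r))\<^sup>2 \<le> 2 * (cmod (f r))\<^sup>2 + 2 * (cmod (g r))\<^sup>2" for r
    proof -
      have "(cmod (f r + g r))\<^sup>2 \<le> (cmod (f r) + cmod (g r))\<^sup>2" by (intro power_mono norm_triangle_ineq) auto
      also have "\<dots> \<le> 2 * (cmod (f r))\<^sup>2 + 2 * (cmod (g r))\<^sup>2"
        using sum_squares_bound[of "cmod (f r)" "cmod (g r)"] by (simp only: power2_sum)
      finally show ?thesis .
    qed
    then show "AE r in lborel. r \<in> {0<..} \<longrightarrow> norm ((cmod (f r + g r))\<^sup>2) \<le> norm (2 * (cmod (f r))\<^sup>2 + 2 * (cmod (g r))\<^sup>2)"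
      by simp
  qed
  then show ?thesis using m unfolding L2_pos_def by simp
qed

lemma L2_cmult: "f \<in> L2_pos \<Longrightarrow> (\<lambda>r. c * f r) \<in> L2_pos"
  by (rule L2_bound[where K="cmod c"])
     (auto simp: norm_mult L2_pos_def intro: set_meas_mult[OF set_meas_continuous[of "\<lambda>_. c"]])

lemma le_one_plus_square: "x \<le> 1 + x\<^sup>2" for x :: real
  using sum_squares_bound[of x 1] zero_le_power2[of x] by (smt (verit) power2_eq_square mult_le_cancel_left1 one_power2)

lemma L2_loc_integrable:
  assumes "f \<in> L2_pos"
  shows "loc_integrable_pos f"
  unfolding loc_integrable_pos_def
proof (intro allI impI)
  fix a b :: real assume a: "0 < a"
  have f: "set_borel_measurable lborel {0<..} f" "set_integrable lborel {0<..} (\<lambda>r. (cmod (f r))\<^sup>2)"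
    using assms unfolding L2_pos_def by auto
  show "set_integrable lborel {a..b} f"
  proof (rule set_integrable_bound)
    show "set_integrable lborel {a..b} (\<lambda>r. 1 + (cmod (f r))\<^sup>2)"
      by (intro set_integral_add set_integrable_const_Icc set_integrable_subset[OF f(2)]) (use a in auto)
    have "(\<lambda>x. indicator {a..b} x *\<^sub>R f x) = (\<lambda>x. indicator {a..b} x *\<^sub>R (indicator {0<..} x *\<^sub>R f x))"
      using a by (auto simp: indicator_def fun_eq_iff)
    moreover have "(\<lambda>x. indicator {a..b} x *\<^sub>R (indicator {0<..} x *\<^sub>R f x)) \<in> borel_measurable lborel"
      using f(1) unfolding set_borel_measurable_def by measurable
    ultimately show "set_borel_measurable lborel {a..b} f"
      unfolding set_borel_measurable_def by simp
    show "AE r in lborel. r \<in> {a..b} \<longrightarrow> norm (f r) \<le> norm (1 + (cmod (f r))\<^sup>2)"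
      using le_one_plus_square by (simp add: abs_of_nonneg add_nonneg_nonneg)
  qed
qed

text \<open>On \<open>{r..1}\<close> one factor \<open>s powr (- 1 / 2)\<close> is bounded by its value at \<open>r\<close>; the remaining integrand
  \<open>s powr (1 / 2) * \<bar>h s\<bar>\<close> is at most \<open>1 + s * \<bar>h s\<bar>\<^sup>2\<close>.\<close>

lemma origin_growth:
  assumes f: "ac_deriv f h" and h: "(\<lambda>r. complex_of_real (r powr (1 / 2)) * h r) \<in> L2_pos"
  obtains K where "\<And>r. 0 < r \<Longrightarrow> r \<le> 1 \<Longrightarrow> cmod (f r) \<le> K * r powr (- (1 / 2))"
proof -
  let ?q = "\<lambda>r. (cmod (complex_of_real (r powr (1 / 2)) * h r))\<^sup>2"
  have q: "set_integrable lborel {0<..} ?q" using h unfolding L2_pos_def by auto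
  let ?T = "LINT r:{0<..}|lborel. ?q r"
  have T: "0 \<le> ?T" by (rule set_integral_nonneg) simp
  show ?thesis
  proof (rule that[of "cmod (f 1) + (1 + ?T)"])
    fix r :: real assume r: "0 < r" "r \<le> 1"
    let ?a = "r powr (- (1 / 2))"
    have a1: "1 \<le> ?a" using r powr_mono'[of "- (1/2)" 0 r] by simp
    note d = ac_derivD[OF f r]
    have iq: "set_integrable lborel {r..1} ?q" by (rule set_integrable_subset[OF q]) (use r in auto)
    have i: "set_integrable lborel {r..1} (\<lambda>s. ?a * (1 + ?q s))"
      by (intro set_integrable_mult_right set_integral_add set_integrable_const_Icc iq)
    have "cmod (f 1 - f r) \<le> (LINT s:{r..1}|lborel. ?a * (1 + ?q s))"
      unfolding d(2)[symmetric]
    proof (rule norm_set_integral_le[OF i _ _ d(1)])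
      fix s assume s: "s \<in> {r..1}"
      then have s0: "0 < s" using r by auto
      have e: "s powr (- (1 / 2)) * s powr (1 / 2) = 1" using s0 by (simp add: powr_add[symmetric])
      have "cmod (h s) = s powr (- (1 / 2)) * (s powr (1 / 2) * cmod (h s))" using e by (simp add: mult.assoc[symmetric])
      also have "\<dots> \<le> ?a * (1 + ?q s)"
      proof (intro mult_mono)
        show "s powr (- (1 / 2)) \<le> ?a" using s r by (intro powr_mono2') auto
        show "s powr (1 / 2) * cmod (h s) \<le> 1 + ?q s"
          using le_one_plus_square[of "s powr (1 / 2) * cmod (h s)"] by (simp add: norm_mult)
      qed auto
      finally show "cmod (h s) \<le> ?a * (1 + ?q s)" .
    qed simp
    also have "\<dots> = ?a * ((LINT s:{r..1}|lborel. 1) + (LINT s:{r..1}|lborel. ?q s))"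
      by (simp add: set_integral_add(2)[OF set_integrable_const_Icc iq])
    also have "\<dots> \<le> ?a * (1 + ?T)"
    proof (intro mult_left_mono add_mono)
      show "(LINT s:{r..1}|lborel. 1) \<le> (1::real)" using r by (simp add: set_integral_const)
      show "(LINT s:{r..1}|lborel. ?q s) \<le> ?T" by (rule set_integral_mono_set[OF q]) (use r in auto)
    qed simp
    finally have "cmod (f 1 - f r) \<le> ?a * (1 + ?T)" .
    then have "cmod (f r) \<le> cmod (f 1) * 1 + ?a * (1 + ?T)"
      using norm_triangle_ineq2[of "f r" "f 1"] by (simp add: norm_minus_commute)
    also have "\<dots> \<le> cmod (f 1) * ?a + ?a * (1 + ?T)" by (intro add_mono mult_left_mono a1) auto
    finally show "cmod (f r) \<le> (cmod (f 1) + (1 + ?T)) * ?a" by (simp add: algebra_simps)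
  qed
qed

lemma powr_deriv: "((\<lambda>r. r powr a) has_real_derivative a * r powr (a - 1)) (at r)" if "0 < r"
  using that by (auto intro!: derivative_eq_intros)

lemma powr_cont: "continuous_on {0<..} (\<lambda>r::real. r powr a)"
  by (intro continuous_intros) auto

lemma powr_ac: "ac_deriv (\<lambda>r. complex_of_real (r powr a)) (\<lambda>r. complex_of_real (a * r powr (a - 1)))"
  by (rule ac_deriv_real[OF powr_deriv]) (auto intro!: continuous_intros powr_cont)

text \<open>With \<open>U = w / r powr (1 / 2)\<close>, the growth lemma applied to \<open>U'\<close> and to \<open>U / r\<close> gives the behaviour at the
  origin. The singular part \<open>- v'' + 3 / (4 * r\<^sup>2) * v\<close> is \<open>- r powr (1 / 2) * (U'' + (U / r)')\<close>, a sum of two square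
  integrable terms.\<close>

lemma domain_representative:
  assumes "w \<in> D1"
  obtains v v1 v2 C where "ac_deriv v v1" "ac_deriv v1 v2" "AE r in lborel. 0 < r \<longrightarrow> w r = v r"
    "\<And>r. 0 < r \<Longrightarrow> r \<le> 1 \<Longrightarrow> cmod (v r) \<le> C * r" "\<And>r. 0 < r \<Longrightarrow> r \<le> 1 \<Longrightarrow> cmod (v1 r) \<le> C"
    "(\<lambda>r. - v2 r + complex_of_real (3 / (4 * r\<^sup>2)) * v r) \<in> L2_pos"
proof -
  let ?h = "\<lambda>a r. complex_of_real (r powr a)"
  obtain V where V: "has_weak_deriv 2 (\<lambda>r. w r / ?h (1/2) r) V" "(\<lambda>r. ?h (1/2) r * V r) \<in> L2_pos"
    using assms unfolding D1_def by blast
  obtain Y where Y: "has_weak_deriv 1 (\<lambda>r. w r / ?h (3/2) r) Y" "(\<lambda>r. ?h (1/2) r * Y r) \<in> L2_pos"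
    using assms unfolding D1_def by blast
  obtain U U1 where U: "ac_deriv U U1" "ac_deriv U1 V" "AE r in lborel. 0 < r \<longrightarrow> w r / ?h (1/2) r = U r"
    using weak_deriv2_imp_ac_deriv[OF V(1)] by blast
  have p: "r powr a * r powr b = r powr (a + b)" for r a b :: real by (simp add: powr_add)
  have p1: "r powr 1 = r" "r powr (-1) = 1 / r" "r powr (-2) = 1 / r\<^sup>2" if "0 < r" for r :: real
    using that by (simp_all add: powr_minus_divide powr_numeral)
  define Z where "Z = (\<lambda>r. ?h (-1) r * U r)"
  define Z1 where "Z1 = (\<lambda>r. complex_of_real (- 1 * r powr (- 1 - 1)) * U r + ?h (-1) r * U1 r)"
  have Z: "ac_deriv Z Z1" unfolding Z_def Z1_def by (rule ac_deriv_mult[OF powr_ac U(1)])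
  have wZ: "AE r in lborel. 0 < r \<longrightarrow> w r / ?h (3/2) r = Z r"
    using U(3)
  proof eventually_elim
    case (elim r)
    show ?case
    proof
      assume r: "0 < r"
      have "Z r = w r / ?h (1/2) r * ?h (-1) r" using elim r by (simp add: Z_def)
      also have "\<dots> = w r / ?h (3/2) r"
      proof -
        have "r powr (3/2) = r powr (1/2) * r" using p[of r "1/2" 1] p1[OF r] by simp
        then show ?thesis using r p1[OF r] by (simp add: field_simps)
      qed
      finally show "w r / ?h (3/2) r = Z r" by simp
    qed
  qed
  have lw: "loc_integrable_pos (\<lambda>r. w r / ?h (3/2) r)" using Y(1) unfolding has_weak_deriv_def by blast
  have "has_weak_deriv 1 (\<lambda>r. w r / ?h (3/2) r) Z1" by (rule ac_deriv_imp_weak_deriv1[OF Z lw wZ])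
  then have YZ: "AE r in lborel. 0 < r \<longrightarrow> Y r = Z1 r" by (rule has_weak_deriv_unique[OF Y(1)])
  have Z1L: "(\<lambda>r. ?h (1/2) r * Z1 r) \<in> L2_pos"
  proof (rule L2_bound[OF Y(2), where K=1])
    show "set_borel_measurable lborel {0<..} (\<lambda>r. ?h (1/2) r * Z1 r)"
      by (rule set_meas_continuous) (auto simp: Z1_def intro!: continuous_intros powr_cont ac_deriv_continuous[OF U(1)] ac_deriv_continuous[OF U(2)])
    show "AE r in lborel. 0 < r \<longrightarrow> cmod (?h (1/2) r * Z1 r) \<le> 1 * cmod (?h (1/2) r * Y r)"
      using YZ by eventually_elim auto
  qed
  obtain K1 where K1: "\<And>r. 0 < r \<Longrightarrow> r \<le> 1 \<Longrightarrow> cmod (U1 r) \<le> K1 * r powr (- (1 / 2))"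
    using origin_growth[OF U(2) V(2)] by blast
  obtain K2 where K2: "\<And>r. 0 < r \<Longrightarrow> r \<le> 1 \<Longrightarrow> cmod (Z r) \<le> K2 * r powr (- (1 / 2))"
    using origin_growth[OF Z Z1L] by blast
  define v where "v = (\<lambda>r. ?h (1/2) r * U r)"
  define v1 where "v1 = (\<lambda>r. complex_of_real (1/2 * r powr (1/2 - 1)) * U r + ?h (1/2) r * U1 r)"
  define v2 where "v2 = (\<lambda>r. (1/2 * (complex_of_real ((1/2-1) * r powr (1/2 - 1 - 1)) * U r + ?h (1/2 - 1) r * U1 r))
     + (complex_of_real (1/2 * r powr (1/2 - 1)) * U1 r + ?h (1/2) r * V r))"
  have vd: "ac_deriv v v1" unfolding v_def v1_def by (rule ac_deriv_mult[OF powr_ac U(1)])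
  have v1d: "ac_deriv v1 v2"
  proof -
    have "ac_deriv (\<lambda>r. 1/2 * (?h (1/2-1) r * U r) + ?h (1/2) r * U1 r) v2"
      unfolding v2_def by (intro ac_deriv_add ac_deriv_cmult ac_deriv_mult powr_ac U)
    then show ?thesis by (rule ac_deriv_cong) (auto simp: v1_def)
  qed
  have h1: "r powr (1/2) * r powr (- (1/2)) = 1" if "0 < r" for r :: real using that by (simp add: p)
  have h2: "r powr (1/2) * r powr (1/2) = r" if "0 < r" for r :: real using that by (simp add: p)
  have Ub: "cmod (U r) \<le> K2 * r powr (1/2)" if r: "0 < r" "r \<le> 1" for r
  proof -
    have "U r = complex_of_real r * Z r" unfolding Z_def using p1[OF r(1)] r by simp
    then have "cmod (U r) = r * cmod (Z r)" using r by (simp add: norm_mult)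
    also have "\<dots> \<le> r * (K2 * r powr (- (1/2)))" using K2[OF r] r by (intro mult_left_mono) auto
    also have "\<dots> = K2 * (r powr (1/2) * (r powr (1/2) * r powr (- (1/2))))" using h2[OF r(1)] by (simp add: mult.assoc[symmetric])
    finally show ?thesis using h1[OF r(1)] by simp
  qed
  have vb: "cmod (v r) \<le> K2 * r" if r: "0 < r" "r \<le> 1" for r
  proof -
    have "cmod (v r) = r powr (1/2) * cmod (U r)" unfolding v_def by (simp add: norm_mult)
    also have "\<dots> \<le> r powr (1/2) * (K2 * r powr (1/2))" by (intro mult_left_mono Ub r) simp
    also have "\<dots> = K2 * (r powr (1/2) * r powr (1/2))" by simp
    finally show ?thesis unfolding h2[OF r(1)] .
  qed
  have v1b: "cmod (v1 r) \<le> K2 + K1" if r: "0 < r" "r \<le> 1" for r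
  proof -
    have K20: "0 \<le> K2" using K2[of 1] norm_ge_zero[of "Z 1"] by (simp del: norm_ge_zero)
    have "cmod (complex_of_real (1/2 * r powr (1/2 - 1)) * U r) = 1/2 * r powr (- (1/2)) * cmod (U r)" by (simp add: norm_mult)
    also have "\<dots> \<le> 1/2 * r powr (- (1/2)) * (K2 * r powr (1/2))" by (intro mult_left_mono Ub r) simp
    also have "\<dots> = 1/2 * K2 * (r powr (1/2) * r powr (- (1/2)))" by simp
    also have "\<dots> \<le> K2" unfolding h1[OF r(1)] using K20 by simp
    finally have a: "cmod (complex_of_real (1/2 * r powr (1/2 - 1)) * U r) \<le> K2" .
    have "cmod (?h (1/2) r * U1 r) = r powr (1/2) * cmod (U1 r)" by (simp add: norm_mult)
    also have "\<dots> \<le> r powr (1/2) * (K1 * r powr (- (1/2)))" by (intro mult_left_mono K1 r) simp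
    also have "\<dots> = K1 * (r powr (1/2) * r powr (- (1/2)))" by simp
    finally have b: "cmod (?h (1/2) r * U1 r) \<le> K1" unfolding h1[OF r(1)] by simp
    show ?thesis unfolding v1_def by (rule order_trans[OF norm_triangle_ineq add_mono[OF a b]])
  qed
  show ?thesis
  proof (rule that[OF vd v1d])
    show "AE r in lborel. 0 < r \<longrightarrow> w r = v r"
      using U(3)
    proof eventually_elim
      case (elim r)
      show ?case
      proof
        assume r: "0 < r"
        then have "U r = w r / ?h (1/2) r" using elim by simp
        then show "w r = v r" unfolding v_def using r by simp
      qed
    qed
    show "cmod (v r) \<le> (max K2 (K2 + K1)) * r" if "0 < r" "r \<le> 1" for r
    proof -
      have "K2 * r \<le> max K2 (K2 + K1) * r" using that by (intro mult_right_mono) auto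
      then show ?thesis using vb[OF that] by linarith
    qed
    show "cmod (v1 r) \<le> max K2 (K2 + K1)" if "0 < r" "r \<le> 1" for r
      using v1b[OF that] by simp
    show "(\<lambda>r. - v2 r + complex_of_real (3 / (4 * r\<^sup>2)) * v r) \<in> L2_pos"
    proof (rule L2_bound[OF L2_cmult[OF L2_add[OF V(2) Z1L], of "-1"], where K=1])
      have e: "- v2 r + complex_of_real (3 / (4 * r\<^sup>2)) * v r = - 1 * (?h (1/2) r * V r + ?h (1/2) r * Z1 r)" if r: "0 < r" for r
      proof -
        have a: "r powr (1/2 - 1) = r powr (1/2) / r" "r powr (1/2 - 1 - 1) = r powr (1/2) / r\<^sup>2" "r powr (- 1 - 1) = 1 / r\<^sup>2" "r powr (-1) = 1 / r"
          unfolding powr_diff p1[OF r] by (simp_all add: power2_eq_square)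
        show ?thesis unfolding v2_def v_def Z1_def a using r
          by (simp add: field_simps power2_eq_square)
      qed
      show "AE r in lborel. 0 < r \<longrightarrow> cmod (- v2 r + complex_of_real (3 / (4 * r\<^sup>2)) * v r) \<le> 1 * cmod (- 1 * (?h (1/2) r * V r + ?h (1/2) r * Z1 r))"
        using e by (intro AE_I2) simp
      have "set_borel_measurable lborel {0<..} (\<lambda>r. - 1 * (?h (1/2) r * V r + ?h (1/2) r * Z1 r))"
        using L2_cmult[OF L2_add[OF V(2) Z1L], of "-1"] unfolding L2_pos_def by simp
      then show "set_borel_measurable lborel {0<..} (\<lambda>r. - v2 r + complex_of_real (3 / (4 * r\<^sup>2)) * v r)"
        by (rule set_meas_cong[rotated]) (use e in auto)
    qed
  qed
qed

text \<open>Splitting the integral at \<open>s = r\<close> resolves the minimum in the kernel.\<close>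

lemma (in half_line_function) K1_stream:
  assumes r: "0 < r" and wt: "AE s in lborel. 0 < s \<longrightarrow> wt s = w s" and wtm: "set_borel_measurable lborel {0<..} wt"
  shows "K1 (\<lambda>s. complex_of_real (gauss s) * wt s) r = complex_of_real (r powr (3 / 2)) * stream w r"
proof -
  let ?k = "\<lambda>s. min (r / s) (s / r) * (r * s) powr (1 / 2) * gauss s"
  have kc: "continuous_on {0<..} ?k"
    unfolding gauss_def using r by (intro continuous_intros) auto
  have kcc: "continuous_on {0<..} (\<lambda>s. complex_of_real (?k s))" by (intro continuous_intros kc)
  let ?f = "\<lambda>s. complex_of_real (?k s) * w s"
  have cong: "(LINT s:{0<..}|lborel. complex_of_real (min (r / s) (s / r) * (r * s) powr (1 / 2)) * (complex_of_real (gauss s) * wt s))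
     = (LINT s:{0<..}|lborel. ?f s)"
  proof (rule set_cong_AE(2))
    have "set_borel_measurable lborel {0<..} (\<lambda>s. complex_of_real (?k s) * wt s)"
      by (rule set_meas_mult[OF set_meas_continuous[OF kcc] wtm])
    then show "set_borel_measurable lborel {0<..} (\<lambda>s. complex_of_real (min (r / s) (s / r) * (r * s) powr (1 / 2)) * (complex_of_real (gauss s) * wt s))"
      by (simp add: mult.assoc)
    show "set_borel_measurable lborel {0<..} ?f" by (rule set_meas_mult[OF set_meas_continuous[OF kcc] w_meas])
    show "AE s in lborel. s \<in> {0<..} \<longrightarrow> complex_of_real (min (r / s) (s / r) * (r * s) powr (1 / 2)) * (complex_of_real (gauss s) * wt s) = ?f s"
      using wt by eventually_elim auto
  qed
  have sq: "(r * s) powr (1/2) = r powr (1/2) * s powr (1/2)" if "0 < s" for s using r that by (simp add: powr_mult)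
  have pr: "r powr (1/2) / r = r powr (- (1/2))" "r * r powr (1/2) = r powr (3/2)"
    using r powr_diff[of r "1/2" 1] powr_add[of r 1 "1/2"] by simp_all
  have in1: "?f s = complex_of_real (r powr (- (1/2))) * (complex_of_real (ground s) * w s)" if s: "0 < s" "s \<le> r" for s
  proof -
    have "s * s \<le> r * r" using s by (intro mult_mono) auto
    then have "s / r \<le> r / s" using s r by (simp add: field_simps)
    then have "?k s = (r powr (1/2) / r) * (s * s powr (1/2) * gauss s)" unfolding sq[OF s(1)] by (simp add: min_def field_simps)
    also have "s * s powr (1/2) = s powr (3/2)" using s powr_add[of s 1 "1/2"] by simp
    finally have "?k s = r powr (- (1/2)) * ground s" unfolding pr ground_def .
    then show ?thesis by simp
  qed
  have in2: "?f s = complex_of_real (r powr (3/2)) * (complex_of_real (ground s / s\<^sup>2) * w s)" if s: "r < s" for s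
  proof -
    have s0: "0 < s" using s r by simp
    have "r * r \<le> s * s" using s r by (intro mult_mono) auto
    then have "r / s \<le> s / r" using s0 r by (simp add: field_simps)
    then have "?k s = (r * r powr (1/2)) * (s powr (1/2) / s * gauss s)" unfolding sq[OF s0] by (simp add: min_def field_simps)
    also have "s powr (1/2) / s = s powr (3/2) / s\<^sup>2"
      using s0 powr_add[of s 1 "1/2"] by (simp add: power2_eq_square field_simps)
    finally have "?k s = r powr (3/2) * (ground s / s\<^sup>2)" unfolding pr ground_def by simp
    then show ?thesis by simp
  qed
  have i1: "set_integrable lborel {0<..r} ?f"
    by (subst set_integrable_cong[OF refl refl in1]) (auto intro!: set_integrable_mult_right set_integrable_subset[OF moment_integrable] simp del: of_real_divide)
  have i2: "set_integrable lborel {r<..} ?f"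
    by (subst set_integrable_cong[OF refl refl in2]) (use r in \<open>auto intro!: set_integrable_mult_right set_integrable_subset[OF tail_integrable] simp del: of_real_divide\<close>)
  have un: "{0<..} = {0<..r} \<union> {r<..}" using r by auto
  have "(LINT s:{0<..}|lborel. ?f s) = (LINT s:{0<..r}|lborel. ?f s) + (LINT s:{r<..}|lborel. ?f s)"
    unfolding un by (rule set_integral_Un[OF _ i1 i2]) auto
  also have "(LINT s:{0<..r}|lborel. ?f s) = complex_of_real (r powr (- (1/2))) * J r"
    unfolding ground_moment_def primitive0_def by (subst set_lebesgue_integral_cong[OF _ allI[OF impI[OF in1]]]) auto
  also have "(LINT s:{r<..}|lborel. ?f s) = complex_of_real (r powr (3/2)) * (LINT s:{r<..}|lborel. complex_of_real (ground s / s\<^sup>2) * w s)"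
    by (subst set_lebesgue_integral_cong[OF _ allI[OF impI[OF in2]]]) (auto simp del: of_real_divide)
  also have "(LINT s:{r<..}|lborel. complex_of_real (ground s / s\<^sup>2) * w s) =
     (LINT s:{0<..}|lborel. complex_of_real (ground s / s\<^sup>2) * w s) - primitive0 (\<lambda>s. complex_of_real (ground s / s\<^sup>2) * w s) r"
  proof -
    have "(LINT s:{0<..}|lborel. complex_of_real (ground s / s\<^sup>2) * w s) =
       (LINT s:{0<..r}|lborel. complex_of_real (ground s / s\<^sup>2) * w s) + (LINT s:{r<..}|lborel. complex_of_real (ground s / s\<^sup>2) * w s)"
      unfolding un by (rule set_integral_Un) (use r in \<open>auto intro!: set_integrable_subset[OF tail_integrable] simp del: of_real_divide\<close>)
    then show ?thesis unfolding primitive0_def by simp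
  qed
  also have "r powr (- (1/2)) = r powr (3/2) * (1 / r\<^sup>2)"
  proof -
    have "r powr (3/2) / r\<^sup>2 = r powr (3/2 - 2)" using r powr_diff[of r "3/2" 2] by (simp add: powr_numeral)
    then show ?thesis by simp
  qed
  finally have val: "(LINT s:{0<..}|lborel. ?f s) = complex_of_real (r powr (3/2) * (1 / r\<^sup>2)) * J r + complex_of_real (r powr (3/2)) *
     ((LINT s:{0<..}|lborel. complex_of_real (ground s / s\<^sup>2) * w s) - primitive0 (\<lambda>s. complex_of_real (ground s / s\<^sup>2) * w s) r)" .
  show ?thesis
    unfolding K1_def cong val unfolding stream_def of_real_mult by (simp only: distrib_left mult.assoc mult.left_commute)
qed

lemma L2_AE_cong:
  assumes "f \<in> L2_pos" "set_borel_measurable lborel {0<..} g" "AE r in lborel. 0 < r \<longrightarrow> f r = g r"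
  shows "g \<in> L2_pos"
  by (rule L2_bound[OF assms(1,2), where K=1]) (use assms(3) in eventually_elim, auto)

lemma l2norm_AE_cong:
  assumes "set_borel_measurable lborel {0<..} f" "set_borel_measurable lborel {0<..} g" "AE r in lborel. 0 < r \<longrightarrow> f r = g r"
  shows "l2norm f = l2norm g"
proof -
  have "AE r in lborel. r \<in> {0<..} \<longrightarrow> (cmod (f r))\<^sup>2 = (cmod (g r))\<^sup>2" using assms(3) by eventually_elim auto
  then show ?thesis unfolding l2norm_def using set_cong_AE(2)[OF set_meas_cmod_sq[OF assms(1)] set_meas_cmod_sq[OF assms(2)]] by simp
qed

text \<open>The operator with the weak derivative replaced by the almost everywhere derivative of a regular
  representative, and with the singular terms grouped into one square integrable function.\<close>

definition H1_regular :: "real \<Rightarrow> real \<Rightarrow> (real \<Rightarrow> complex) \<Rightarrow> (real \<Rightarrow> complex) \<Rightarrow> real \<Rightarrow> complex" where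
  "H1_regular b lam v v2 r = (- v2 r + complex_of_real (3 / (4 * r\<^sup>2)) * v r)
     + ((complex_of_real (r\<^sup>2 / 16 - 1 / 2) + \<i> * complex_of_real (b * sigma r - lam)) * v r
     - \<i> * complex_of_real b * (complex_of_real (ground r) * stream v r))"

lemma (in half_line_function) H1_representative:
  assumes w1: "ac_deriv w1 w2" and wtL: "wt \<in> L2_pos" and wt: "AE r in lborel. 0 < r \<longrightarrow> wt r = w r"
  shows "AE r in lborel. 0 < r \<longrightarrow> H1 \<alpha> lam wt r = H1_regular (beta1 \<alpha>) lam w w2 r"
    and "set_borel_measurable lborel {0<..} (H1 \<alpha> lam wt)"
proof -
  have wtm: "set_borel_measurable lborel {0<..} wt" using wtL unfolding L2_pos_def by simp
  have hw: "has_weak_deriv 2 wt w2" by (rule ac_deriv_imp_weak_deriv2[OF w w1 L2_loc_integrable[OF wtL] wt])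
  then have hs: "has_weak_deriv 2 wt (weak_deriv 2 wt)" unfolding weak_deriv_def by (rule someI[where P="has_weak_deriv 2 wt"])
  have wd: "AE r in lborel. 0 < r \<longrightarrow> weak_deriv 2 wt r = w2 r" by (rule has_weak_deriv_unique[OF hs hw])
  have K: "complex_of_real (gauss r) * K1 (\<lambda>s. complex_of_real (gauss s) * wt s) r = complex_of_real (ground r) * stream w r" if "0 < r" for r
    unfolding K1_stream[OF that wt wtm] ground_def by simp
  let ?G = "\<lambda>r. - 1 * weak_deriv 2 wt r + ((complex_of_real (harmonic_pot r) + \<i> * complex_of_real (beta1 \<alpha> * sigma r - lam)) * wt r
     - \<i> * complex_of_real (beta1 \<alpha>) * (complex_of_real (ground r) * stream w r))"
  have e: "?G r = H1 \<alpha> lam wt r" if "0 < r" for r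
    unfolding H1_def K[OF that, symmetric] harmonic_pot_def by (simp add: algebra_simps)
  show "AE r in lborel. 0 < r \<longrightarrow> H1 \<alpha> lam wt r = H1_regular (beta1 \<alpha>) lam w w2 r"
    using wt wd
  proof eventually_elim
    case (elim r)
    show ?case
    proof
      assume r: "0 < r"
      have "H1 \<alpha> lam wt r = ?G r" using e[OF r] by simp
      also have "\<dots> = H1_regular (beta1 \<alpha>) lam w w2 r"
        using elim r unfolding H1_regular_def harmonic_pot_def by (simp add: algebra_simps)
      finally show "H1 \<alpha> lam wt r = H1_regular (beta1 \<alpha>) lam w w2 r" .
    qed
  qed
  have "set_borel_measurable lborel {0<..} ?G"
  proof (intro set_meas_add set_meas_diff set_meas_mult)
    show "set_borel_measurable lborel {0<..} (weak_deriv 2 wt)"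
      using hs unfolding has_weak_deriv_def by (intro loc_integrable_measurable) blast
    show "set_borel_measurable lborel {0<..} wt" by (rule wtm)
    show "set_borel_measurable lborel {0<..} (stream w)" by (rule set_meas_continuous[OF ac_deriv_continuous[OF P_deriv]])
    show "set_borel_measurable lborel {0<..} (\<lambda>r. complex_of_real (ground r))"
      by (rule set_meas_continuous) (intro continuous_intros ground_cont)
    show "set_borel_measurable lborel {0<..} (\<lambda>r. complex_of_real (beta1 \<alpha> * sigma r - lam))"
      by (rule set_meas_continuous) (intro continuous_intros sigma_cont)
    show "set_borel_measurable lborel {0<..} (\<lambda>r. complex_of_real (harmonic_pot r))"
      by (rule set_meas_continuous) (intro continuous_intros harmonic_pot_cont)
  qed (rule set_meas_continuous, rule continuous_on_const)+
  then show "set_borel_measurable lborel {0<..} (H1 \<alpha> lam wt)" by (rule set_meas_cong[rotated]) (use e in auto)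
qed

lemma (in half_line_function) nonlocal_L2: "(\<lambda>r. complex_of_real (ground r) * stream w r) \<in> L2_pos"
proof -
  obtain K where K: "0 \<le> K" "\<And>r. 0 < r \<Longrightarrow> cmod (P r) \<le> K" by (rule P_bound) (rule that)
  have g: "(\<lambda>r. complex_of_real (ground r)) \<in> L2_pos"
    unfolding L2_pos_def using ground_sq_integrable by (auto intro!: set_meas_continuous continuous_intros ground_cont)
  show ?thesis
  proof (rule L2_bound[OF g, where K=K])
    show "set_borel_measurable lborel {0<..} (\<lambda>r. complex_of_real (ground r) * stream w r)"
      by (rule set_meas_continuous) (intro continuous_intros ground_cont ac_deriv_continuous[OF P_deriv])
    show "AE r in lborel. 0 < r \<longrightarrow> cmod (complex_of_real (ground r) * stream w r) \<le> K * cmod (complex_of_real (ground r))"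
      using K(2) by (intro AE_I2) (auto simp: norm_mult mult.commute[of K] intro!: mult_left_mono)
  qed
qed

lemma L2_bounded_mult:
  assumes "f \<in> L2_pos" "continuous_on {0<..} c" "\<And>r. 0 < r \<Longrightarrow> cmod (c r) \<le> K"
  shows "(\<lambda>r. c r * f r) \<in> L2_pos"
proof (rule L2_bound[OF assms(1), where K=K])
  show "set_borel_measurable lborel {0<..} (\<lambda>r. c r * f r)"
    using assms(1) by (intro set_meas_mult set_meas_continuous[OF assms(2)]) (simp add: L2_pos_def)
  show "AE r in lborel. 0 < r \<longrightarrow> cmod (c r * f r) \<le> K * cmod (f r)"
    using assms(3) by (intro AE_I2) (auto simp: norm_mult intro!: mult_right_mono)
qed

lemma L2_norm_sq: "(LINT r:{0<..}|lborel. (cmod (f r))\<^sup>2) = (l2norm f)\<^sup>2" "0 \<le> l2norm f"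
proof -
  have "0 \<le> (LINT r:{0<..}|lborel. (cmod (f r))\<^sup>2)" by (rule set_integral_nonneg) simp
  then show "(LINT r:{0<..}|lborel. (cmod (f r))\<^sup>2) = (l2norm f)\<^sup>2" "0 \<le> l2norm f" unfolding l2norm_def by auto
qed

text \<open>Every \<open>t\<close> above the ratio of the norms satisfies \<open>\<bar>\<beta>\<bar> \<le> (2600 * t) ^ 3\<close>, also if the ratio is zero.\<close>

lemma pseudospectral_lower_bound:
  assumes wD: "w \<in> D1" and orth: "orth_ground w"
  shows "l2norm (H1 \<alpha> lam w) \<ge> inverse 2600 * \<bar>beta1 \<alpha>\<bar> powr (1 / 3) * l2norm w"
proof -
  define b where "b = beta1 \<alpha>"
  have wL: "w \<in> L2_pos" and r2w: "(\<lambda>r. complex_of_real (r\<^sup>2) * w r) \<in> L2_pos" using wD unfolding D1_def by auto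
  obtain v v1 v2 C where v: "ac_deriv v v1" "ac_deriv v1 v2" "AE r in lborel. 0 < r \<longrightarrow> w r = v r"
    "\<And>r. 0 < r \<Longrightarrow> r \<le> 1 \<Longrightarrow> cmod (v r) \<le> C * r" "\<And>r. 0 < r \<Longrightarrow> r \<le> 1 \<Longrightarrow> cmod (v1 r) \<le> C"
    "(\<lambda>r. - v2 r + complex_of_real (3 / (4 * r\<^sup>2)) * v r) \<in> L2_pos"
    by (rule domain_representative[OF wD]) (rule that)
  have vc: "continuous_on {0<..} v" by (rule ac_deriv_continuous[OF v(1)])
  have vL: "v \<in> L2_pos" by (rule L2_AE_cong[OF wL set_meas_continuous[OF vc] v(3)])
  have r2v: "(\<lambda>r. complex_of_real (r\<^sup>2) * v r) \<in> L2_pos"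
    by (rule L2_AE_cong[OF r2w set_meas_continuous])
       (use v(3) vc in \<open>auto intro!: continuous_intros elim: eventually_mono\<close>)
  have vL2: "set_integrable lborel {0<..} (\<lambda>r. (cmod (v r))\<^sup>2)" using vL unfolding L2_pos_def by simp
  interpret B: half_line_function v v1 C by unfold_locales (use v(1,4) vL2 in auto)
  define F where "F = H1_regular b lam v v2"
  have FL: "F \<in> L2_pos"
  proof -
    have p1: "(\<lambda>r. 1 / 16 * (complex_of_real (r\<^sup>2) * v r)) \<in> L2_pos" by (rule L2_cmult[OF r2v])
    have p2: "(\<lambda>r. (\<i> * complex_of_real (b * sigma r - lam) - 1 / 2) * v r) \<in> L2_pos"
    proof (rule L2_bounded_mult[OF vL, where K="\<bar>b\<bar> + \<bar>lam\<bar> + 1 / 2"])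
      show "continuous_on {0<..} (\<lambda>r. \<i> * complex_of_real (b * sigma r - lam) - 1 / 2)"
        by (intro continuous_intros sigma_cont)
      fix r :: real assume r: "0 < r"
      have "\<bar>b * sigma r\<bar> \<le> \<bar>b\<bar>"
        using sigma_pos[OF r] sigma_le_1[OF r] by (simp add: abs_mult mult_left_le)
      then have "\<bar>b * sigma r - lam\<bar> \<le> \<bar>b\<bar> + \<bar>lam\<bar>" by linarith
      then have "cmod (\<i> * complex_of_real (b * sigma r - lam)) \<le> \<bar>b\<bar> + \<bar>lam\<bar>" by (simp only: norm_mult norm_ii norm_of_real mult_1)
      then show "cmod (\<i> * complex_of_real (b * sigma r - lam) - 1 / 2) \<le> \<bar>b\<bar> + \<bar>lam\<bar> + 1 / 2"
        by (intro order_trans[OF norm_triangle_ineq4] add_mono) auto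
    qed
    have p3: "(\<lambda>r. (- \<i> * complex_of_real b) * (complex_of_real (ground r) * stream v r)) \<in> L2_pos"
      by (rule L2_cmult[OF B.nonlocal_L2])
    show ?thesis
      using L2_add[OF v(6) L2_add[OF L2_add[OF p1 p2] p3]]
      by (rule back_subst[of "\<lambda>f. f \<in> L2_pos"]) (auto simp: F_def H1_regular_def fun_eq_iff algebra_simps)
  qed
  have FL2: "set_integrable lborel {0<..} (\<lambda>r. (cmod (F r))\<^sup>2)" using FL unfolding L2_pos_def by simp
  have gm: "continuous_on {0<..} (\<lambda>s. complex_of_real (ground s))" by (intro continuous_intros ground_cont)
  have orth': "(LINT s:{0<..}|lborel. complex_of_real (ground s) * v s) = 0"
  proof -
    have "(LINT s:{0<..}|lborel. complex_of_real (ground s) * v s) = (LINT s:{0<..}|lborel. complex_of_real (ground s) * w s)"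
    proof (rule set_cong_AE(2))
      show "set_borel_measurable lborel {0<..} (\<lambda>s. complex_of_real (ground s) * v s)"
        "set_borel_measurable lborel {0<..} (\<lambda>s. complex_of_real (ground s) * w s)"
        using vL wL unfolding L2_pos_def by (auto intro!: set_meas_mult set_meas_continuous[OF gm])
      show "AE s in lborel. s \<in> {0<..} \<longrightarrow> complex_of_real (ground s) * v s = complex_of_real (ground s) * w s"
        using v(3) by eventually_elim auto
    qed
    also have "\<dots> = 0"
      using orth unfolding orth_ground_def l2inner_def ground_def by (simp add: mult.commute)
    finally show ?thesis .
  qed
  interpret S: nonlocal_solution v v1 C F b lam
  proof unfold_locales
    show "ac_deriv v1 (\<lambda>r. (complex_of_real (harmonic_pot r) + \<i> * complex_of_real (b * sigma r - lam)) * v r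
        - \<i> * complex_of_real (b * ground r) * stream v r - F r)"
      by (rule ac_deriv_cong[OF v(2)]) (auto simp: F_def H1_regular_def harmonic_pot_def algebra_simps)
  qed (use FL2 v(5) orth' in auto)
  have nF: "l2norm (H1 \<alpha> lam w) = l2norm F"
    unfolding F_def b_def
    by (rule l2norm_AE_cong[OF B.H1_representative(2)[OF v(2) wL v(3)] _ B.H1_representative(1)[OF v(2) wL v(3)]])
       (use FL in \<open>simp add: L2_pos_def F_def b_def\<close>)
  have nw: "l2norm w = l2norm v"
    by (rule l2norm_AE_cong[OF _ _ v(3)]) (use wL vL in \<open>auto simp: L2_pos_def\<close>)
  show ?thesis
  proof (cases "l2norm v = 0")
    case True
    then show ?thesis unfolding nw using L2_norm_sq(2) by simp
  next
    case False
    then have n: "0 < l2norm v" using L2_norm_sq(2)[of v] by simp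
    have "\<bar>b\<bar> powr (1 / 3) / 2600 \<le> l2norm F / l2norm v"
    proof (rule dense_ge)
      fix t assume t: "l2norm F / l2norm v < t"
      then have t0: "0 < t" using n L2_norm_sq(2)[of F] by (meson divide_nonneg_pos le_less_trans)
      define s where "s = sqrt t"
      have s: "0 < s" "s\<^sup>2 = t" "s ^ 4 = t\<^sup>2" unfolding s_def using t0 by (auto simp: power2_eq_square power4_eq_xxxx)
      have "l2norm F \<le> t * l2norm v" using t n by (simp add: field_simps)
      then have "(l2norm F)\<^sup>2 \<le> (t * l2norm v)\<^sup>2" using L2_norm_sq(2) by (intro power_mono) auto
      then have "\<bar>b\<bar> \<le> (2600 * s\<^sup>2) ^ 3"
        by (intro S.nonlocal_lower_bound[OF s(1)]) (use n in \<open>simp_all add: L2_norm_sq(1) s(3) power_mult_distrib\<close>)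
      then have "\<bar>b\<bar> \<le> (2600 * t) ^ 3" unfolding s(2) .
      then have "\<bar>b\<bar> powr (1 / 3) \<le> ((2600 * t) ^ 3) powr (1 / 3)" by (intro powr_mono2) auto
      also have "(2600 * t) ^ 3 = (2600 * t) powr 3" using t0 by (simp only: powr_numeral mult_pos_pos zero_less_numeral)
      also have "\<dots> powr (1 / 3) = 2600 * t" unfolding powr_powr using t0 by simp
      finally show "\<bar>b\<bar> powr (1 / 3) / 2600 \<le> t" by simp
    qed
    then show ?thesis unfolding nF nw b_def[symmetric] using n by (simp add: field_simps)
  qed
qed


section \<open>A quasimode at the critical radius\<close>

lemma compact_support_L2:
  assumes c: "continuous_on {0<..} f" and a: "0 < a" and z: "\<And>r. 0 < r \<Longrightarrow> r \<notin> {a..c} \<Longrightarrow> f r = 0"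
  shows "f \<in> L2_pos"
proof -
  have cc: "continuous_on {a..c} (\<lambda>r. (cmod (f r))\<^sup>2)"
    by (intro continuous_intros continuous_on_subset[OF assms(1)]) (use a in auto)
  have "(\<lambda>r. indicator {a..c} r *\<^sub>R (cmod (f r))\<^sup>2) = (\<lambda>r. indicator {0<..} r *\<^sub>R (cmod (f r))\<^sup>2)"
    using z a by (auto simp: fun_eq_iff indicator_def)
  then have "set_integrable lborel {0<..} (\<lambda>r. (cmod (f r))\<^sup>2)"
    using borel_integrable_atLeastAtMost'[OF cc] unfolding set_integrable_def by simp
  then show ?thesis unfolding L2_pos_def using set_meas_continuous[OF assms(1)] by simp
qed

lemma compact_support_D1:
  assumes f: "\<And>r. 0 < r \<Longrightarrow> (f has_real_derivative f1 r) (at r)" "\<And>r. 0 < r \<Longrightarrow> (f1 has_real_derivative f2 r) (at r)"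
    "continuous_on {0<..} f2" and a: "0 < a"
    and z: "\<And>r. r \<notin> {a..c} \<Longrightarrow> f r = 0 \<and> f1 r = 0 \<and> f2 r = (0::real)"
  shows "(\<lambda>r. complex_of_real (f r)) \<in> D1"
proof -
  have c: "continuous_on {0<..} f" "continuous_on {0<..} f1"
    using continuous_on_pos_DERIV[OF f(1)] continuous_on_pos_DERIV[OF f(2)] by auto
  have d: "ac_deriv (\<lambda>r. complex_of_real (f r)) (\<lambda>r. complex_of_real (f1 r))"
    "ac_deriv (\<lambda>r. complex_of_real (f1 r)) (\<lambda>r. complex_of_real (f2 r))"
    by (rule ac_deriv_real, use f c in auto)+
  let ?h = "\<lambda>a r. complex_of_real (r powr a)"
  let ?f = "\<lambda>r. complex_of_real (f r)" and ?f1 = "\<lambda>r. complex_of_real (f1 r)" and ?f2 = "\<lambda>r. complex_of_real (f2 r)"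
  have inv: "?f r / ?h s r = ?h (- s) r * ?f r" for s r
    by (simp add: powr_minus divide_inverse mult.commute)
  have p1: "ac_deriv (\<lambda>r. ?h s r * ?f r) (\<lambda>r. complex_of_real (s * r powr (s - 1)) * ?f r + ?h s r * ?f1 r)" for s
    by (rule ac_deriv_mult[OF powr_ac d(1)])
  have cont: "continuous_on {0<..} (\<lambda>r. ?f r / ?h s r)" for s
    unfolding inv by (intro continuous_intros c powr_cont)
  have W1: "has_weak_deriv 1 (\<lambda>r. ?f r / ?h (3/2) r) (\<lambda>r. complex_of_real (- (3/2) * r powr (- (3/2) - 1)) * ?f r + ?h (- (3/2)) r * ?f1 r)"
    by (rule ac_deriv_imp_weak_deriv1[OF p1 loc_integrable_continuous[OF cont]]) (intro AE_I2 impI inv)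
  let ?V = "\<lambda>r. - (1/2) * (complex_of_real ((- (1/2) - 1) * r powr (- (1/2) - 1 - 1)) * ?f r + ?h (- (1/2) - 1) r * ?f1 r)
     + (complex_of_real (- (1/2) * r powr (- (1/2) - 1)) * ?f1 r + ?h (- (1/2)) r * ?f2 r)"
  have p2: "ac_deriv (\<lambda>r. complex_of_real (- (1/2) * r powr (- (1/2) - 1)) * ?f r + ?h (- (1/2)) r * ?f1 r) ?V"
  proof -
    have "ac_deriv (\<lambda>r. - (1/2) * (?h (- (1/2) - 1) r * ?f r) + ?h (- (1/2)) r * ?f1 r) ?V"
      by (intro ac_deriv_add ac_deriv_cmult ac_deriv_mult powr_ac d)
    then show ?thesis by (rule ac_deriv_cong) auto
  qed
  have W2: "has_weak_deriv 2 (\<lambda>r. ?f r / ?h (1/2) r) ?V"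
    by (rule ac_deriv_imp_weak_deriv2[OF p1 p2 loc_integrable_continuous[OF cont]]) (intro AE_I2 impI inv)
  have L0: "?f \<in> L2_pos"
    by (rule compact_support_L2[OF _ a, where c=c]) (use z c in \<open>auto intro!: continuous_intros\<close>)
  have L1: "(\<lambda>r. ?h (1/2) r * ?V r) \<in> L2_pos"
  proof (rule compact_support_L2[OF _ a, where c=c])
    show "continuous_on {0<..} (\<lambda>r. ?h (1/2) r * ?V r)"
      by (auto intro!: continuous_intros c f(3) powr_cont)
    show "?h (1/2) r * ?V r = 0" if "r \<notin> {a..c}" for r using z[OF that] by simp
  qed
  have L2: "(\<lambda>r. ?h (1/2) r * (complex_of_real (- (3/2) * r powr (- (3/2) - 1)) * ?f r + ?h (- (3/2)) r * ?f1 r)) \<in> L2_pos"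
  proof (rule compact_support_L2[OF _ a, where c=c])
    show "continuous_on {0<..} (\<lambda>r. ?h (1/2) r * (complex_of_real (- (3/2) * r powr (- (3/2) - 1)) * ?f r + ?h (- (3/2)) r * ?f1 r))"
      by (auto intro!: continuous_intros c powr_cont)
    show "?h (1/2) r * (complex_of_real (- (3/2) * r powr (- (3/2) - 1)) * ?f r + ?h (- (3/2)) r * ?f1 r) = 0" if "r \<notin> {a..c}" for r
      using z[OF that] by simp
  qed
  have L3: "(\<lambda>r. complex_of_real (r\<^sup>2) * ?f r) \<in> L2_pos"
  proof (rule compact_support_L2[OF _ a, where c=c])
    show "continuous_on {0<..} (\<lambda>r. complex_of_real (r\<^sup>2) * ?f r)" by (intro continuous_intros c)
    show "complex_of_real (r\<^sup>2) * ?f r = 0" if "r \<notin> {a..c}" for r using z[OF that] by simp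
  qed
  show ?thesis
    unfolding D1_def mem_Collect_eq
  proof (intro conjI L0 L3)
    show "\<exists>v. has_weak_deriv 2 (\<lambda>r. ?f r / ?h (1/2) r) v \<and> (\<lambda>r. ?h (1/2) r * v r) \<in> L2_pos"
      by (rule exI[of _ ?V]) (rule conjI[OF W2 L1])
    show "\<exists>v. has_weak_deriv 1 (\<lambda>r. ?f r / ?h (3/2) r) v \<and> (\<lambda>r. ?h (1/2) r * v r) \<in> L2_pos"
      by (rule exI, rule conjI[OF W1 L2])
  qed
qed

lemma sigma_lipschitz:
  assumes b: "1 \<le> b" and r: "b \<le> r" "r \<le> b + 2 / b"
  shows "\<bar>sigma r - sigma b\<bar> \<le> 16 / b ^ 4"
proof (cases "r = b")
  case True
  then show ?thesis using b by simp
next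
  case False
  then have br: "b < r" using r by simp
  have "(sigma has_real_derivative - (mass z / z ^ 3)) (at z)" if "b \<le> z" for z
    by (rule sigma_deriv) (use that b in auto)
  then obtain z where z: "b < z" "z < r" "sigma r - sigma b = (r - b) * - (mass z / z ^ 3)"
    using MVT2[OF br, of sigma "\<lambda>z. - (mass z / z ^ 3)"] by auto
  have "mass z / z ^ 3 \<le> 8 / b ^ 3" using mass_le[of z] z b by (intro frac_le power_mono) auto
  then have "(r - b) * (mass z / z ^ 3) \<le> 2 / b * (8 / b ^ 3)"
    using r z b mass_pos[of z] by (intro mult_mono) auto
  also have "\<dots> = 16 / b ^ 4" using b by (simp add: power3_eq_cube power4_eq_xxxx)
  finally have "(r - b) * (mass z / z ^ 3) \<le> 16 / b ^ 4" .
  moreover have "0 \<le> (r - b) * (mass z / z ^ 3)" using r z b mass_pos[of z] by simp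
  ultimately show ?thesis unfolding z(3) by simp
qed

lemma ground_far:
  assumes b: "1 \<le> b" and r: "b \<le> r" "r \<le> b + 2 / b"
  shows "ground r \<le> 9 * b\<^sup>2 * gauss b"
proof -
  have "2 / b \<le> 2" using b by (simp add: field_simps)
  then have r3: "r \<le> 3 * b" "1 \<le> r" using r b by auto
  have "r powr (3 / 2) \<le> r powr 2" using r3 by (intro powr_mono) auto
  also have "\<dots> = r\<^sup>2" using r3 by (simp add: powr_numeral)
  also have "\<dots> \<le> (3 * b)\<^sup>2" using r3 by (intro power_mono) auto
  finally have p: "r powr (3 / 2) \<le> 9 * b\<^sup>2" by (simp add: power_mult_distrib)
  have "b\<^sup>2 \<le> r\<^sup>2" using r b by (intro power_mono) auto
  then have "gauss r \<le> gauss b" unfolding gauss_def by simp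
  then show ?thesis unfolding ground_def using p by (intro mult_mono) (auto simp: gauss_def)
qed

text \<open>Since \<open>\<bar>\<beta>\<bar> = b ^ 6\<close> below, the Gaussian factor absorbs the coupling constant of the nonlocal term.\<close>

lemma gauss_decay:
  assumes "1 \<le> b"
  shows "b ^ 6 * gauss b \<le> 13824"
proof -
  have "gauss b \<le> (real 3 / (b\<^sup>2 / 8)) ^ 3"
    unfolding gauss_def by (rule exp_minus_le_power) (use assms in auto)
  also have "\<dots> = 13824 / b ^ 6" by (simp add: power_divide power_mult_distrib power_mult[symmetric])
  finally show ?thesis using assms by (simp add: field_simps)
qed

abbreviation eta :: "real \<Rightarrow> real" where "eta \<equiv> bump 1 0 1"

lemma eta_smooth: "smooth eta" by (rule smooth_bump) auto

lemma eta_bounds: "0 \<le> eta x" "eta x \<le> 1"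
  unfolding bump_def by (auto simp: mult_nonneg_nonneg)

lemma eta_outside: "x \<notin> {0..1} \<Longrightarrow> eta x = 0" "x \<le> 0 \<Longrightarrow> eta x = 0" "1 \<le> x \<Longrightarrow> eta x = 0"
  unfolding bump_def by auto

text \<open>The constant is the value of the bump at \<open>1 / 4\<close>, where \<open>x * (1 - x) = 3 / 16\<close>.\<close>

lemma eta_core: "exp (- (16 / 3)) \<le> eta x" if "1 / 4 \<le> x" "x \<le> 3 / 4"
proof -
  have "0 \<le> (x - 1 / 4) * (3 / 4 - x)" using that by simp
  also have "(x - 1 / 4) * (3 / 4 - x) = x * (1 - x) - 3 / 16" by (simp add: field_simps)
  finally have "3 / 16 \<le> x * (1 - x)" by simp
  then have "1 / (x * (1 - x)) \<le> 1 / (3 / 16)" by (intro divide_left_mono) auto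
  then show ?thesis using that unfolding bump_def by simp
qed

lemma eta_deriv2_bounded:
  obtains E where "0 \<le> E" "\<And>x. \<bar>deriv (deriv eta) x\<bar> \<le> E"
proof -
  have "compact (deriv (deriv eta) ` {0..1})"
    by (intro compact_continuous_image smooth_continuous smooth_deriv eta_smooth) auto
  then obtain E where E: "\<And>x. x \<in> {0..1} \<Longrightarrow> \<bar>deriv (deriv eta) x\<bar> \<le> E"
    using compact_imp_bounded bounded_iff by (metis imageI real_norm_def)
  have "\<bar>deriv (deriv eta) x\<bar> \<le> max E 0" for x
  proof (cases "x \<in> {0..1}")
    case False
    then have "deriv (deriv eta) x = 0"
      by (intro deriv_zero_outside[of 0 1] deriv_zero_outside[of 0 1 eta] eta_outside(1))
    then show ?thesis by simp
  qed (use E in fastforce)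
  then show ?thesis using that[of "max E 0"] by auto
qed

text \<open>At radius \<open>b\<close>, with \<open>\<bar>\<beta>\<bar> = b ^ 6\<close>, a function of width \<open>1 / b\<close> sees a second derivative of order \<open>b\<^sup>2\<close>, the oscillator
  potential of order \<open>b\<^sup>2\<close>, and a variation of \<open>\<beta> * sigma\<close> of order \<open>b ^ 6 * b powr (- 3) / b = b\<^sup>2\<close>.\<close>

locale quasimode =
  fixes b E :: real
  assumes b: "1 \<le> b" and E: "0 \<le> E" "\<And>x. \<bar>deriv (deriv eta) x\<bar> \<le> E"
begin

definition shift :: "(real \<Rightarrow> real) \<Rightarrow> real \<Rightarrow> real \<Rightarrow> real" where
  "shift h j r = h (b * (r - b) - j)"

definition weight :: "real \<Rightarrow> real" where
  "weight j = (LINT r:{0<..}|lborel. ground r * shift eta j r)"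

text \<open>Two adjacent copies of a profile, weighted so that for the profile \<open>eta\<close> the combination is orthogonal to the
  ground state.\<close>

definition combo :: "(real \<Rightarrow> real) \<Rightarrow> real \<Rightarrow> real" where
  "combo h r = weight 1 * shift h 0 r - weight 0 * shift h 1 r"

definition S :: "real set" where "S = {b..b + 2 / b}"

lemma b_pos: "0 < b" using b by simp

lemma shift_outside:
  assumes h: "\<And>x. x \<notin> {0..1} \<Longrightarrow> h x = 0" and j: "j = 0 \<or> j = 1" and r: "r \<notin> S"
  shows "shift h j r = 0"
proof -
  have "b * (r - b) < 0 \<or> 2 < b * (r - b)"
  proof (cases "r < b")
    case True
    then show ?thesis using b_pos by (simp add: mult_pos_neg)
  next
    case False
    then have "2 / b < r - b" using r unfolding S_def by auto
    then show ?thesis using b_pos by (simp add: field_simps)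
  qed
  then show ?thesis unfolding shift_def using j by (intro h) auto
qed

lemma combo_outside:
  assumes "\<And>x. x \<notin> {0..1} \<Longrightarrow> h x = 0" "r \<notin> S"
  shows "combo h r = 0"
  unfolding combo_def using shift_outside[where h=h and j=0 and r=r, OF assms(1)] shift_outside[where h=h and j=1 and r=r, OF assms(1)] assms(2) by simp

lemma combo_deriv:
  assumes "\<And>x. (h has_real_derivative h' x) (at x)"
  shows "(combo h has_real_derivative b * combo h' r) (at r)"
proof -
  have s: "(shift h j has_real_derivative b * shift h' j r) (at r)" for j
  proof -
    have "((\<lambda>r. b * (r - b) - j) has_real_derivative b) (at r)"
      by (auto intro!: derivative_eq_intros)
    then have "((\<lambda>r. h (b * (r - b) - j)) has_real_derivative h' (b * (r - b) - j) * b) (at r)"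
      by (rule DERIV_chain2[OF assms])
    then show ?thesis unfolding shift_def by (simp add: mult.commute)
  qed
  have "((\<lambda>r. weight 1 * shift h 0 r - weight 0 * shift h 1 r) has_real_derivative
     weight 1 * (b * shift h' 0 r) - weight 0 * (b * shift h' 1 r)) (at r)"
    by (intro DERIV_diff DERIV_cmult s)
  moreover have "weight 1 * (b * shift h' 0 r) - weight 0 * (b * shift h' 1 r) = b * combo h' r"
    unfolding combo_def by (simp add: algebra_simps)
  ultimately show ?thesis unfolding combo_def by simp
qed

lemma shift_cont: "smooth h \<Longrightarrow> continuous_on A (shift h j)"
  unfolding shift_def
  by (rule continuous_on_compose2[OF smooth_continuous[of h UNIV]]) (auto intro!: continuous_intros)

lemma combo_cont: "smooth h \<Longrightarrow> continuous_on A (combo h)"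
  unfolding combo_def by (intro continuous_intros shift_cont)

lemma S_pos: "r \<in> S \<Longrightarrow> 0 < r" and S_ge_1: "r \<in> S \<Longrightarrow> 1 \<le> r"
  using b unfolding S_def by auto

lemma shift_integrable:
  assumes "smooth h" "\<And>x. x \<notin> {0..1} \<Longrightarrow> h x = 0" "j = 0 \<or> j = 1"
  shows "set_integrable lborel {0<..} (\<lambda>r. ground r * shift h j r)"
proof -
  have "continuous_on S (\<lambda>r. ground r * shift h j r)"
    by (intro continuous_intros shift_cont assms(1) continuous_on_subset[OF ground_cont]) (use S_pos in auto)
  then have "set_integrable lborel S (\<lambda>r. ground r * shift h j r)"
    unfolding S_def by (rule borel_integrable_atLeastAtMost')
  moreover have "(\<lambda>r. indicator S r *\<^sub>R (ground r * shift h j r)) = (\<lambda>r. indicator {0<..} r *\<^sub>R (ground r * shift h j r))"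
  proof
    fix r show "indicator S r *\<^sub>R (ground r * shift h j r) = indicator {0<..} r *\<^sub>R (ground r * shift h j r)"
      using S_pos[of r] shift_outside[where h=h and j=j and r=r, OF assms(2,3)] by (cases "r \<in> S") auto
  qed
  ultimately show ?thesis unfolding set_integrable_def by simp
qed

text \<open>The middle half of the support of each copy, where \<open>eta\<close> is bounded below.\<close>

definition core :: "real \<Rightarrow> real set" where
  "core j = {b + (j + 1 / 4) / b..b + (j + 3 / 4) / b}"

lemma core_sub: "j = 0 \<or> j = 1 \<Longrightarrow> core j \<subseteq> S"
  unfolding core_def S_def using b_pos by (auto simp: field_simps)

lemma core_arg: "r \<in> core j \<Longrightarrow> 1 / 4 \<le> b * (r - b) - j \<and> b * (r - b) - j \<le> 3 / 4"
  unfolding core_def using b_pos by (auto simp: field_simps)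

lemma core_integral: "integrable lborel (indicat_real (core j))" "(LINT r|lborel. indicat_real (core j) r) = 1 / (2 * b)"
proof -
  show "integrable lborel (indicat_real (core j))"
    using set_integrable_const_Icc[of "b + (j + 1 / 4) / b" "b + (j + 3 / 4) / b" 1]
    unfolding set_integrable_def core_def by simp
  have "(j + 1 / 4) / b \<le> (j + 3 / 4) / b" using b_pos by (intro divide_right_mono) auto
  then show "(LINT r|lborel. indicat_real (core j) r) = 1 / (2 * b)"
    unfolding core_def using b_pos by (simp add: field_simps)
qed

lemma S_integral: "integrable lborel (indicat_real S)" "(LINT r|lborel. indicat_real S r) = 2 / b"
proof -
  show "integrable lborel (indicat_real S)"
    using set_integrable_const_Icc[of b "b + 2 / b" 1] unfolding set_integrable_def S_def by simp
  show "(LINT r|lborel. indicat_real S r) = 2 / b" unfolding S_def using b_pos by simp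
qed

lemma weight_nonneg: "0 \<le> weight j"
  unfolding weight_def shift_def
  by (rule set_integral_nonneg) (simp add: mult_nonneg_nonneg[OF less_imp_le[OF ground_pos] eta_bounds(1)])

lemma weight_pos: "0 < weight 0"
proof -
  let ?m = "gauss (3 * b) * exp (- (16 / 3))"
  have m: "0 < ?m" unfolding gauss_def by simp
  have "?m * (1 / (2 * b)) = (LINT r|lborel. ?m * indicat_real (core 0) r)"
    using core_integral[of 0] by simp
  also have "\<dots> \<le> (LINT r|lborel. indicator {0<..} r *\<^sub>R (ground r * shift eta 0 r))"
  proof (rule integral_mono)
    show "integrable lborel (\<lambda>r. ?m * indicat_real (core 0) r)" using core_integral[of 0] by simp
    show "integrable lborel (\<lambda>r. indicator {0<..} r *\<^sub>R (ground r * shift eta 0 r))"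
      using shift_integrable[OF eta_smooth eta_outside(1), of 0] unfolding set_integrable_def by simp
    fix r
    show "?m * indicat_real (core 0) r \<le> indicator {0<..} r *\<^sub>R (ground r * shift eta 0 r)"
    proof (cases "r \<in> core 0")
      case True
      then have rS: "r \<in> S" using core_sub[of 0] by auto
      have "2 / b \<le> 2" using b by (simp add: field_simps)
      then have r3: "1 \<le> r" "r \<le> 3 * b" using rS b unfolding S_def by auto
      have "r\<^sup>2 \<le> (3 * b)\<^sup>2" using r3 by (intro power_mono) auto
      then have "gauss (3 * b) \<le> gauss r" unfolding gauss_def by simp
      moreover have "1 \<le> r powr (3 / 2)" using r3 by (simp add: ge_one_powr_ge_zero)
      ultimately have "1 * gauss (3 * b) \<le> r powr (3 / 2) * gauss r" by (intro mult_mono) (auto simp: gauss_def)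
      then have g: "gauss (3 * b) \<le> ground r" unfolding ground_def by simp
      have e: "exp (- (16 / 3)) \<le> shift eta 0 r" unfolding shift_def by (rule eta_core) (use core_arg[OF True] in auto)
      have "?m \<le> ground r * shift eta 0 r" by (intro mult_mono g e) (auto simp: gauss_def ground_def)
      then show ?thesis using True r3 by simp
    next
      case False
      then show ?thesis unfolding shift_def
        using mult_nonneg_nonneg[OF less_imp_le[OF ground_pos] eta_bounds(1), of r "b * (r - b) - 0"]
        by (cases "0 < r") simp_all
    qed
  qed
  finally have "?m * (1 / (2 * b)) \<le> weight 0" unfolding weight_def set_lebesgue_integral_def .
  moreover have "0 < ?m * (1 / (2 * b))" using m b_pos by simp
  ultimately show ?thesis by linarith
qed

definition p :: real where "p = weight 0 + weight 1"

lemma combo_bound: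
  assumes h: "\<And>x. \<bar>h x\<bar> \<le> K"
  shows "\<bar>combo h r\<bar> \<le> p * K"
proof -
  have "\<bar>weight 1 * shift h 0 r\<bar> \<le> weight 1 * K" "\<bar>weight 0 * shift h 1 r\<bar> \<le> weight 0 * K"
    unfolding abs_mult shift_def using weight_nonneg h by (auto intro!: mult_mono)
  then show ?thesis unfolding combo_def p_def distrib_right by linarith
qed

abbreviation v :: "real \<Rightarrow> complex" where "v \<equiv> \<lambda>r. complex_of_real (combo eta r)"
abbreviation v1 :: "real \<Rightarrow> complex" where "v1 \<equiv> \<lambda>r. complex_of_real (b * combo (deriv eta) r)"
abbreviation v2 :: "real \<Rightarrow> complex" where "v2 \<equiv> \<lambda>r. complex_of_real (b\<^sup>2 * combo (deriv (deriv eta)) r)"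

lemma combo_derivs:
  "(combo eta has_real_derivative b * combo (deriv eta) r) (at r)"
  "((\<lambda>r. b * combo (deriv eta) r) has_real_derivative b\<^sup>2 * combo (deriv (deriv eta)) r) (at r)"
proof -
  show "(combo eta has_real_derivative b * combo (deriv eta) r) (at r)"
    by (rule combo_deriv[OF smooth_has_deriv[OF eta_smooth]])
  show "((\<lambda>r. b * combo (deriv eta) r) has_real_derivative b\<^sup>2 * combo (deriv (deriv eta)) r) (at r)"
    using DERIV_cmult[OF combo_deriv[OF smooth_has_deriv[OF smooth_deriv[OF eta_smooth]]], of b r] by (simp add: power2_eq_square mult.assoc)
qed

lemma deriv_eta_outside: "x \<notin> {0..1} \<Longrightarrow> deriv eta x = 0" "x \<notin> {0..1} \<Longrightarrow> deriv (deriv eta) x = 0"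
proof -
  show a: "x \<notin> {0..1} \<Longrightarrow> deriv eta x = 0" for x by (rule deriv_zero_outside[OF eta_outside(1)])
  show "x \<notin> {0..1} \<Longrightarrow> deriv (deriv eta) x = 0" by (rule deriv_zero_outside[OF a])
qed

lemma v2_cont: "continuous_on {0<..} (\<lambda>r. b\<^sup>2 * combo (deriv (deriv eta)) r)"
  unfolding combo_def by (intro continuous_intros shift_cont smooth_deriv eta_smooth)

lemma v_D1: "v \<in> D1"
  by (rule compact_support_D1[where a=b and c="b + 2 / b", OF combo_derivs v2_cont b_pos])
     (use combo_outside[OF eta_outside(1)] combo_outside[OF deriv_eta_outside(1)] combo_outside[OF deriv_eta_outside(2)]
      in \<open>auto simp: S_def\<close>)

lemma v_ac: "ac_deriv v v1" "ac_deriv v1 v2"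
proof -
  show "ac_deriv v1 v2" by (rule ac_deriv_real[OF combo_derivs(2) v2_cont])
  show "ac_deriv v v1"
    by (rule ac_deriv_real[OF combo_derivs(1)]) (rule continuous_on_pos_DERIV[OF combo_derivs(2)])
qed

lemma v_orth: "orth_ground v"
proof -
  have "(LINT r:{0<..}|lborel. v r * cnj (complex_of_real (r powr (3 / 2) * gauss r))) =
     (LINT r:{0<..}|lborel. complex_of_real (weight 1 * (ground r * shift eta 0 r) - weight 0 * (ground r * shift eta 1 r)))"
    by (rule set_lebesgue_integral_cong) (auto simp: combo_def ground_def algebra_simps)
  also have "\<dots> = complex_of_real (LINT r:{0<..}|lborel. weight 1 * (ground r * shift eta 0 r) - weight 0 * (ground r * shift eta 1 r))"
    by (rule set_integral_complex_of_real)
  also have "(LINT r:{0<..}|lborel. weight 1 * (ground r * shift eta 0 r) - weight 0 * (ground r * shift eta 1 r)) =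
     (LINT r:{0<..}|lborel. weight 1 * (ground r * shift eta 0 r)) - (LINT r:{0<..}|lborel. weight 0 * (ground r * shift eta 1 r))"
    by (rule set_integral_diff) (auto intro!: set_integrable_mult_right shift_integrable eta_smooth eta_outside(1))
  also have "\<dots> = weight 1 * weight 0 - weight 0 * weight 1"
    unfolding weight_def[of 0] weight_def[of 1] set_integral_mult_right ..
  finally show ?thesis unfolding orth_ground_def l2inner_def by simp
qed

text \<open>The two copies have disjoint supports, so there is no cancellation between them.\<close>

lemma v_norm_lower: "(exp (- (16 / 3)))\<^sup>2 * p\<^sup>2 / (4 * b) \<le> (l2norm v)\<^sup>2"
proof -
  let ?c = "exp (- (16 / 3)) :: real"
  have vL: "v \<in> L2_pos" using v_D1 unfolding D1_def by simp
  have pt: "(?c * weight 1)\<^sup>2 * indicat_real (core 0) r + (?c * weight 0)\<^sup>2 * indicat_real (core 1) r \<le> indicator {0<..} r *\<^sub>R (cmod (v r))\<^sup>2" for r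
  proof -
    consider "r \<in> core 0" | "r \<in> core 1" | "r \<notin> core 0" "r \<notin> core 1" by blast
    then show ?thesis
    proof cases
      case 1
      note a = core_arg[OF 1]
      have n: "r \<notin> core 1" using a core_arg[of r 1] by auto
      have "shift eta 1 r = 0" unfolding shift_def by (rule eta_outside) (use a in auto)
      then have "cmod (v r) = weight 1 * shift eta 0 r"
        unfolding combo_def using weight_nonneg eta_bounds by (simp add: shift_def norm_mult)
      moreover have "?c \<le> shift eta 0 r" unfolding shift_def by (rule eta_core) (use a in auto)
      ultimately have "?c * weight 1 \<le> cmod (v r)" using weight_nonneg[of 1] by (simp add: mult.commute mult_left_mono)
      then have "(?c * weight 1)\<^sup>2 \<le> (cmod (v r))\<^sup>2" using weight_nonneg by (intro power_mono) auto
      then show ?thesis using 1 n S_pos core_sub[of 0] by auto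
    next
      case 2
      note a = core_arg[OF 2]
      have n: "r \<notin> core 0" using a core_arg[of r 0] by auto
      have "shift eta 0 r = 0" unfolding shift_def by (rule eta_outside) (use a in auto)
      then have "cmod (v r) = weight 0 * shift eta 1 r"
        unfolding combo_def using weight_nonneg eta_bounds by (simp add: shift_def norm_mult)
      moreover have "?c \<le> shift eta 1 r" unfolding shift_def by (rule eta_core) (use a in auto)
      ultimately have "?c * weight 0 \<le> cmod (v r)" using weight_nonneg[of 0] by (simp add: mult.commute mult_left_mono)
      then have "(?c * weight 0)\<^sup>2 \<le> (cmod (v r))\<^sup>2" using weight_nonneg by (intro power_mono) auto
      then show ?thesis using 2 n S_pos core_sub[of 1] by auto
    qed simp
  qed
  have ii: "integrable lborel (\<lambda>r. (?c * weight 1)\<^sup>2 * indicat_real (core 0) r)" "integrable lborel (\<lambda>r. (?c * weight 0)\<^sup>2 * indicat_real (core 1) r)"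
    using core_integral by auto
  have "(LINT r|lborel. (?c * weight 1)\<^sup>2 * indicat_real (core 0) r + (?c * weight 0)\<^sup>2 * indicat_real (core 1) r)
     \<le> (LINT r|lborel. indicator {0<..} r *\<^sub>R (cmod (v r))\<^sup>2)"
    by (rule integral_mono) (use pt ii vL in \<open>auto simp: L2_pos_def set_integrable_def\<close>)
  also have "\<dots> = (l2norm v)\<^sup>2" unfolding L2_norm_sq(1)[symmetric] set_lebesgue_integral_def ..
  also have "(LINT r|lborel. (?c * weight 1)\<^sup>2 * indicat_real (core 0) r + (?c * weight 0)\<^sup>2 * indicat_real (core 1) r)
     = ?c\<^sup>2 * ((weight 1)\<^sup>2 + (weight 0)\<^sup>2) / (2 * b)"
    unfolding Bochner_Integration.integral_add[OF ii] using core_integral(2) by (simp add: power_mult_distrib distrib_left add_divide_distrib)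
  finally have low: "?c\<^sup>2 * ((weight 1)\<^sup>2 + (weight 0)\<^sup>2) / (2 * b) \<le> (l2norm v)\<^sup>2" .
  have "p\<^sup>2 \<le> 2 * ((weight 1)\<^sup>2 + (weight 0)\<^sup>2)"
    unfolding p_def using sum_squares_bound[of "weight 0" "weight 1"] by (simp add: power2_sum)
  then have "?c\<^sup>2 * p\<^sup>2 / (4 * b) \<le> ?c\<^sup>2 * (2 * ((weight 1)\<^sup>2 + (weight 0)\<^sup>2)) / (4 * b)"
    using b_pos by (intro divide_right_mono mult_left_mono) auto
  also have "\<dots> = ?c\<^sup>2 * ((weight 1)\<^sup>2 + (weight 0)\<^sup>2) / (2 * b)"
  proof -
    have "x * (2 * y) / (4 * b) = x * y / (2 * b)" for x y :: real using b_pos by simp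
    then show ?thesis .
  qed
  finally show ?thesis using low by linarith
qed

lemma p_pos: "0 < p" unfolding p_def using weight_pos weight_nonneg[of 1] by simp

lemma v_half: "half_line_function v v1 0"
proof
  show "ac_deriv v v1" by (rule v_ac)
  show "set_integrable lborel {0<..} (\<lambda>r. (cmod (v r))\<^sup>2)" using v_D1 unfolding D1_def L2_pos_def by auto
  show "cmod (v r) \<le> 0 * r" if "0 < r" "r \<le> 1" for r
  proof -
    have "b * (r - b) \<le> 0" using that b by (intro mult_nonneg_nonpos) auto
    then have "combo eta r = 0" unfolding combo_def shift_def by (simp add: eta_outside(2))
    then show ?thesis by simp
  qed
qed

text \<open>A bound for the integral of \<open>ground * \<bar>v\<bar>\<close>: a bound for the integrand times the length of \<open>S\<close>.\<close>

definition A :: real where "A = 9 * b\<^sup>2 * gauss b * p * (2 / b)"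

lemma A_nonneg: "0 \<le> A" unfolding A_def gauss_def using b_pos p_pos by simp

lemma stream_bound: "cmod (stream v r) \<le> 2 * A" if r: "0 < r"
proof -
  interpret B: half_line_function v v1 0 by (rule v_half)
  let ?K = "9 * b\<^sup>2 * gauss b * p"
  have K0: "0 \<le> ?K" unfolding gauss_def using b_pos p_pos by simp
  have g: "cmod (complex_of_real (ground s) * v s) \<le> ?K * indicat_real S s" for s
  proof (cases "s \<in> S")
    case True
    have "ground s * \<bar>combo eta s\<bar> \<le> 9 * b\<^sup>2 * gauss b * (p * 1)"
      by (intro mult_mono ground_far b combo_bound) (use True S_def eta_bounds b_pos in \<open>auto simp: gauss_def\<close>)
    then show ?thesis using True ground_pos[OF S_pos[OF True]] by (simp add: norm_mult)
  next
    case False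
    then show ?thesis using combo_outside[OF eta_outside(1) False] by simp
  qed
  have g2: "cmod (complex_of_real (ground s / s\<^sup>2) * v s) \<le> ?K * indicat_real S s" for s
  proof (cases "s \<in> S")
    case True
    have "1 \<le> s\<^sup>2" using S_ge_1[OF True] by simp
    then have "ground s / s\<^sup>2 \<le> ground s / 1"
      using ground_pos[OF S_pos[OF True]] by (intro divide_left_mono) auto
    then have "ground s / s\<^sup>2 * cmod (v s) \<le> ground s * cmod (v s)" by (intro mult_right_mono) auto
    moreover have "cmod (complex_of_real (ground s / s\<^sup>2) * v s) = ground s / s\<^sup>2 * cmod (v s)"
      "cmod (complex_of_real (ground s) * v s) = ground s * cmod (v s)"
      using ground_pos[OF S_pos[OF True]] unfolding norm_mult norm_of_real by simp_all
    ultimately have "cmod (complex_of_real (ground s / s\<^sup>2) * v s) \<le> cmod (complex_of_real (ground s) * v s)" by linarith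
    then show ?thesis using g[of s] by linarith
  next
    case False
    then show ?thesis using combo_outside[OF eta_outside(1) False] by simp
  qed
  have bound: "cmod (LINT s:X|lborel. h s) \<le> A"
    if "\<And>s. cmod (h s) \<le> ?K * indicat_real S s" "X \<in> sets lborel" for X and h :: "real \<Rightarrow> complex"
  proof -
    have "cmod (LINT s:X|lborel. h s) \<le> (LINT s|lborel. norm (indicator X s *\<^sub>R h s))"
      unfolding set_lebesgue_integral_def by (rule integral_norm_bound)
    also have "\<dots> \<le> (LINT s|lborel. ?K * indicat_real S s)"
    proof (rule integral_mono')
      show "integrable lborel (\<lambda>s. ?K * indicat_real S s)" using S_integral by simp
      fix s
      show "norm (indicator X s *\<^sub>R h s) \<le> ?K * indicat_real S s"
        using that(1)[of s] K0 by (cases "s \<in> X") (auto simp: indicator_def)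
      show "0 \<le> ?K * indicat_real S s" using K0 by simp
    qed
    also have "\<dots> = A" unfolding A_def using S_integral by simp
    finally show ?thesis .
  qed
  have J: "cmod (complex_of_real (1 / r\<^sup>2) * ground_moment v r) \<le> A"
  proof (cases "r \<le> 1")
    case True
    have "cmod (ground_moment v r) \<le> 0 * (r\<^sup>2)" using B.J_bound_quad[OF r True] by simp
    then show ?thesis using A_nonneg by simp
  next
    case False
    then have "1 / r\<^sup>2 \<le> 1" by simp
    moreover have "cmod (ground_moment v r) \<le> A" unfolding ground_moment_def primitive0_def by (rule bound[OF g]) simp
    ultimately have "1 / r\<^sup>2 * cmod (ground_moment v r) \<le> 1 * A" by (intro mult_mono) auto
    then show ?thesis by (simp add: norm_mult norm_divide norm_power)
  qed
  have M: "cmod ((LINT s:{0<..}|lborel. complex_of_real (ground s / s\<^sup>2) * v s) - primitive0 (\<lambda>s. complex_of_real (ground s / s\<^sup>2) * v s) r) \<le> A + A"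
    unfolding primitive0_def by (intro order_trans[OF norm_triangle_ineq4] add_mono bound g2) auto
  have "2 * stream v r = complex_of_real (1 / r\<^sup>2) * ground_moment v r + ((LINT s:{0<..}|lborel. complex_of_real (ground s / s\<^sup>2) * v s) - primitive0 (\<lambda>s. complex_of_real (ground s / s\<^sup>2) * v s) r)"
    unfolding stream_def by (simp only: mult.assoc[symmetric]) simp
  then have "cmod (2 * stream v r) \<le> A + (A + A)"
    using J M by (simp only:) (intro order_trans[OF norm_triangle_ineq] add_mono)
  moreover have "cmod (2 * stream v r) = 2 * cmod (stream v r)" by (simp add: norm_mult)
  ultimately show ?thesis using A_nonneg by simp
qed

text \<open>The four terms contribute \<open>E\<close>, \<open>1\<close>, \<open>2\<close> and \<open>16\<close> to the constant.\<close>

lemma local_bound: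
  assumes \<beta>: "\<bar>\<beta>\<bar> = b ^ 6" and r: "0 < r"
  shows "cmod ((- v2 r + complex_of_real (3 / (4 * r\<^sup>2)) * v r) +
     (complex_of_real (r\<^sup>2 / 16 - 1 / 2) + \<i> * complex_of_real (\<beta> * sigma r - \<beta> * sigma b)) * v r) \<le> (E + 19) * b\<^sup>2 * p * indicat_real S r"
proof (cases "r \<in> S")
  case False
  then show ?thesis using combo_outside[OF eta_outside(1) False] combo_outside[OF deriv_eta_outside(2) False] by simp
next
  case True
  then have rb: "b \<le> r" "r \<le> b + 2 / b" unfolding S_def by auto
  have "2 / b \<le> 2" using b by (simp add: field_simps)
  then have r3: "r \<le> 3 * b" "1 \<le> r" using rb b by auto
  have b2: "1 \<le> b\<^sup>2" using b by simp
  have vb: "cmod (v r) \<le> p" using combo_bound[of eta 1 r] eta_bounds by simp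
  have 1: "cmod (- v2 r) \<le> E * b\<^sup>2 * p"
  proof -
    have "b\<^sup>2 * \<bar>combo (deriv (deriv eta)) r\<bar> \<le> b\<^sup>2 * (p * E)" by (intro mult_left_mono combo_bound E) simp
    then show ?thesis by (simp add: norm_mult norm_power mult_ac)
  qed
  have 2: "cmod (complex_of_real (3 / (4 * r\<^sup>2)) * v r) \<le> 1 * b\<^sup>2 * p"
  proof -
    have "1 \<le> r\<^sup>2" using r3 by simp
    then have "3 / (4 * r\<^sup>2) \<le> 1" by (subst pos_divide_le_eq) auto
    then have "3 / (4 * r\<^sup>2) \<le> b\<^sup>2" using b2 by linarith
    then have "3 / (4 * r\<^sup>2) * cmod (v r) \<le> b\<^sup>2 * p" using vb by (intro mult_mono) auto
    moreover have "cmod (complex_of_real (3 / (4 * r\<^sup>2))) = 3 / (4 * r\<^sup>2)" unfolding norm_of_real by simp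
    ultimately show ?thesis unfolding norm_mult by simp
  qed
  have 3: "cmod (complex_of_real (r\<^sup>2 / 16 - 1 / 2) + \<i> * complex_of_real (\<beta> * sigma r - \<beta> * sigma b)) \<le> 18 * b\<^sup>2"
  proof -
    have "r\<^sup>2 \<le> (3 * b)\<^sup>2" using r3 by (intro power_mono) auto
    then have "r\<^sup>2 \<le> 9 * b\<^sup>2" by (simp add: power_mult_distrib)
    then have "\<bar>r\<^sup>2 / 16 - 1 / 2\<bar> \<le> 2 * b\<^sup>2" using b2 zero_le_power2[of r] by linarith
    moreover have "\<bar>\<beta> * sigma r - \<beta> * sigma b\<bar> \<le> 16 * b\<^sup>2"
    proof -
      have "\<bar>\<beta> * sigma r - \<beta> * sigma b\<bar> = b ^ 6 * \<bar>sigma r - sigma b\<bar>"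
        unfolding right_diff_distrib[symmetric] abs_mult \<beta> ..
      also have "\<dots> \<le> b ^ 6 * (16 / b ^ 4)" using b_pos by (intro mult_left_mono sigma_lipschitz b rb) auto
      also have "\<dots> = 16 * b\<^sup>2" using b_pos by (simp add: field_simps flip: power_add)
      finally show ?thesis .
    qed
    moreover have "cmod (complex_of_real x + \<i> * complex_of_real y) \<le> \<bar>x\<bar> + \<bar>y\<bar>" for x y
      by (rule order_trans[OF norm_triangle_ineq]) (simp add: norm_mult)
    ultimately show ?thesis by (smt (verit))
  qed
  have 4: "cmod ((complex_of_real (r\<^sup>2 / 16 - 1 / 2) + \<i> * complex_of_real (\<beta> * sigma r - \<beta> * sigma b)) * v r) \<le> 18 * b\<^sup>2 * p"
    unfolding norm_mult[of _ "v r"] by (rule mult_mono[OF 3 vb]) auto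
  have "cmod ((- v2 r + complex_of_real (3 / (4 * r\<^sup>2)) * v r) +
     (complex_of_real (r\<^sup>2 / 16 - 1 / 2) + \<i> * complex_of_real (\<beta> * sigma r - \<beta> * sigma b)) * v r) \<le> (E * b\<^sup>2 * p + 1 * b\<^sup>2 * p) + 18 * b\<^sup>2 * p"
    by (rule order_trans[OF norm_triangle_ineq add_mono[OF order_trans[OF norm_triangle_ineq add_mono[OF 1 2]] 4]])
  then show ?thesis using True by (simp add: algebra_simps)
qed

lemma ground_sq_total: "(LINT r:{0<..}|lborel. (ground r)\<^sup>2) \<le> 8"
  by (rule half_line_integral_le[OF ground_sq_integrable ground_sq_Icc_le])

lemma H_norm_upper:
  assumes \<beta>: "\<bar>\<beta>\<bar> = b ^ 6"
  shows "(LINT r:{0<..}|lborel. (cmod (H1_regular \<beta> (\<beta> * sigma b) v v2 r))\<^sup>2)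
    \<le> (4 * (E + 19)\<^sup>2 + 64 * 248832\<^sup>2) * b ^ 4 * p\<^sup>2 / b"
proof -
  let ?L = "(E + 19) * b\<^sup>2 * p" and ?N = "b ^ 6 * (2 * A)"
  let ?g = "\<lambda>r. 2 * ?L\<^sup>2 * indicat_real S r + 2 * ?N\<^sup>2 * (indicator {0<..} r *\<^sub>R (ground r)\<^sup>2)"
  have ig: "integrable lborel (\<lambda>r. 2 * ?L\<^sup>2 * indicat_real S r)" "integrable lborel (\<lambda>r. 2 * ?N\<^sup>2 * (indicator {0<..} r *\<^sub>R (ground r)\<^sup>2))"
    using S_integral(1) ground_sq_integrable unfolding set_integrable_def by auto
  have pt: "indicator {0<..} r *\<^sub>R (cmod (H1_regular \<beta> (\<beta> * sigma b) v v2 r))\<^sup>2 \<le> ?g r" for r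
  proof (cases "0 < r")
    case True
    let ?X = "(- v2 r + complex_of_real (3 / (4 * r\<^sup>2)) * v r) +
     (complex_of_real (r\<^sup>2 / 16 - 1 / 2) + \<i> * complex_of_real (\<beta> * sigma r - \<beta> * sigma b)) * v r"
    let ?Y = "\<i> * complex_of_real \<beta> * (complex_of_real (ground r) * stream v r)"
    have X: "cmod ?X \<le> ?L * indicat_real S r" by (rule local_bound[OF \<beta> True])
    have Y: "cmod ?Y \<le> ?N * ground r"
    proof -
      have "cmod ?Y = b ^ 6 * (ground r * cmod (stream v r))" using \<beta> ground_pos[OF True] by (simp add: norm_mult)
      also have "\<dots> \<le> b ^ 6 * (ground r * (2 * A))"
        using b_pos ground_pos[OF True] by (intro mult_left_mono stream_bound True) auto
      finally show ?thesis by (simp only: mult_ac)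
    qed
    have "H1_regular \<beta> (\<beta> * sigma b) v v2 r = ?X - ?Y" unfolding H1_regular_def by (simp only: add_diff_eq)
    then have "cmod (H1_regular \<beta> (\<beta> * sigma b) v v2 r) \<le> ?L * indicat_real S r + ?N * ground r"
      using X Y by (simp only:) (intro order_trans[OF norm_triangle_ineq4] add_mono)
    then have "(cmod (H1_regular \<beta> (\<beta> * sigma b) v v2 r))\<^sup>2 \<le> (?L * indicat_real S r + ?N * ground r)\<^sup>2" by (intro power_mono) auto
    also have "\<dots> \<le> 2 * (?L * indicat_real S r)\<^sup>2 + 2 * (?N * ground r)\<^sup>2"
      using sum_squares_bound[of "?L * indicat_real S r" "?N * ground r"] by (simp only: power2_sum)
    also have "(?L * indicat_real S r)\<^sup>2 = ?L\<^sup>2 * indicat_real S r" by (simp add: power_mult_distrib indicator_def)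
    finally show ?thesis using True by (simp add: power_mult_distrib)
  qed (simp add: indicator_def)
  have "(LINT r:{0<..}|lborel. (cmod (H1_regular \<beta> (\<beta> * sigma b) v v2 r))\<^sup>2) \<le> (LINT r|lborel. ?g r)"
    unfolding set_lebesgue_integral_def
    by (rule integral_mono') (use pt ig in auto)
  also have "\<dots> = 2 * ?L\<^sup>2 * (2 / b) + 2 * ?N\<^sup>2 * (LINT r:{0<..}|lborel. (ground r)\<^sup>2)"
    unfolding Bochner_Integration.integral_add[OF ig] set_lebesgue_integral_def integral_mult_right_zero S_integral(2) ..
  also have "\<dots> \<le> 2 * ?L\<^sup>2 * (2 / b) + 2 * ?N\<^sup>2 * 8"
    by (intro add_left_mono mult_left_mono ground_sq_total) auto
  also have "\<dots> \<le> 4 * (E + 19)\<^sup>2 * b ^ 4 * p\<^sup>2 / b + 64 * 248832\<^sup>2 * b ^ 4 * p\<^sup>2 / b"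
  proof (rule add_mono)
    show "2 * ?L\<^sup>2 * (2 / b) \<le> 4 * (E + 19)\<^sup>2 * b ^ 4 * p\<^sup>2 / b"
      by (simp add: power_mult_distrib power_mult[symmetric])
    have "b ^ 6 * A = (b ^ 6 * gauss b) * (18 * b\<^sup>2 * p / b)" unfolding A_def by simp
    also have "\<dots> \<le> 13824 * (18 * b\<^sup>2 * p / b)" using b_pos p_pos by (intro mult_right_mono gauss_decay b) auto
    finally have "b ^ 6 * A \<le> 248832 * (b\<^sup>2 * p / b)" by simp
    then have "(b ^ 6 * A)\<^sup>2 \<le> (248832 * (b\<^sup>2 * p / b))\<^sup>2" using A_nonneg b_pos by (intro power_mono) auto
    also have "\<dots> = 248832\<^sup>2 * b ^ 4 * p\<^sup>2 / (b * b)" 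
    proof -
      have "(b\<^sup>2 * p / b)\<^sup>2 = b ^ 4 * p\<^sup>2 / (b * b)"
        by (simp add: power_mult_distrib power_divide power2_eq_square power4_eq_xxxx)
      then show ?thesis unfolding power_mult_distrib[of 248832] by simp
    qed
    also have "\<dots> \<le> 248832\<^sup>2 * b ^ 4 * p\<^sup>2 / b"
      using b b_pos by (intro divide_left_mono) (auto simp: mult_le_cancel_left1)
    finally have "(b ^ 6 * A)\<^sup>2 \<le> 248832\<^sup>2 * b ^ 4 * p\<^sup>2 / b" .
    moreover have "2 * ?N\<^sup>2 * 8 = 64 * (b ^ 6 * A)\<^sup>2" by (simp add: power_mult_distrib)
    ultimately show "2 * ?N\<^sup>2 * 8 \<le> 64 * 248832\<^sup>2 * b ^ 4 * p\<^sup>2 / b" by simp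
  qed
  also have "\<dots> = (4 * (E + 19)\<^sup>2 + 64 * 248832\<^sup>2) * b ^ 4 * p\<^sup>2 / b"
    by (simp only: add_divide_distrib distrib_right)
  finally show ?thesis .
qed

definition Cq :: real where
  "Cq = sqrt (4 * (4 * (E + 19)\<^sup>2 + 64 * 248832\<^sup>2)) / exp (- (16 / 3))"

text \<open>Both sides scale like \<open>b powr (3 / 2) * p\<close>: the support has length of order \<open>1 / b\<close>.\<close>

lemma quasimode_upper_bound:
  assumes \<beta>: "\<bar>beta1 \<alpha>\<bar> = b ^ 6"
  shows "l2norm (H1 \<alpha> (beta1 \<alpha> * sigma b) v) \<le> Cq * b\<^sup>2 * l2norm v"
proof -
  interpret B: half_line_function v v1 0 by (rule v_half)
  have vL: "v \<in> L2_pos" using v_D1 unfolding D1_def by simp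
  have vv: "AE r in lborel. 0 < r \<longrightarrow> v r = v r" by simp
  note hr = B.H1_representative[OF v_ac(2) vL vv]
  let ?H = "H1 \<alpha> (beta1 \<alpha> * sigma b) v" and ?R = "H1_regular (beta1 \<alpha>) (beta1 \<alpha> * sigma b) v v2"
  let ?K = "4 * (E + 19)\<^sup>2 + 64 * 248832\<^sup>2" and ?c = "exp (- (16 / 3)) :: real"
  have K0: "0 \<le> ?K" by simp
  have Rm: "set_borel_measurable lborel {0<..} ?R"
    unfolding H1_regular_def
    by (rule set_meas_continuous)
       (auto intro!: continuous_intros combo_cont smooth_deriv eta_smooth sigma_cont ground_cont ac_deriv_continuous[OF v_ac(1)] ac_deriv_continuous[OF B.P_deriv] continuous_on_pos_DERIV[OF combo_derivs(1)])
  have "l2norm ?H = l2norm ?R" by (rule l2norm_AE_cong[OF hr(2) Rm hr(1)])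
  then have "(l2norm ?H)\<^sup>2 \<le> ?K * b ^ 4 * p\<^sup>2 / b"
    using H_norm_upper[OF \<beta>] unfolding L2_norm_sq(1) by simp
  also have "\<dots> = 4 * ?K / ?c\<^sup>2 * b ^ 4 * (?c\<^sup>2 * p\<^sup>2 / (4 * b))" using b_pos by (simp add: field_simps)
  also have "\<dots> \<le> 4 * ?K / ?c\<^sup>2 * b ^ 4 * (l2norm v)\<^sup>2"
    using K0 b_pos by (intro mult_left_mono v_norm_lower) auto
  also have "\<dots> = (Cq * b\<^sup>2 * l2norm v)\<^sup>2"
  proof -
    have "Cq\<^sup>2 = 4 * ?K / ?c\<^sup>2" unfolding Cq_def power_divide by (subst real_sqrt_pow2) auto
    moreover have "(b\<^sup>2)\<^sup>2 = b ^ 4" by simp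
    ultimately show ?thesis by (simp only: power_mult_distrib)
  qed
  finally show ?thesis
  proof (rule power2_le_imp_le)
    show "0 \<le> Cq * b\<^sup>2 * l2norm v" unfolding Cq_def using L2_norm_sq(2)[of v] by simp
  qed
qed

lemma v_nonzero: "\<not> (AE r in lborel. 0 < r \<longrightarrow> v r = 0)"
proof
  assume z: "AE r in lborel. 0 < r \<longrightarrow> v r = 0"
  have vL: "v \<in> L2_pos" using v_D1 unfolding D1_def by simp
  have "l2norm v = l2norm (\<lambda>_. 0)"
    by (rule l2norm_AE_cong[OF _ _ z]) (use vL in \<open>auto simp: L2_pos_def set_borel_measurable_def\<close>)
  then have "l2norm v = 0" by (simp add: l2norm_def)
  then have "(exp (- (16 / 3)))\<^sup>2 * p\<^sup>2 / (4 * b) \<le> 0" using v_norm_lower by simp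
  moreover have "0 < (exp (- (16 / 3)))\<^sup>2 * p\<^sup>2 / (4 * b)" using p_pos b_pos by simp
  ultimately show False by linarith
qed

end

theorem theorem4p1:
  shows "\<exists>C::real. C > 0 \<and>
    (\<forall>(\<alpha>::real) (lam::real). \<forall>w\<in>D1. orth_ground w \<longrightarrow>
        l2norm (H1 \<alpha> lam w) \<ge> inverse C * \<bar>beta1 \<alpha>\<bar> powr (1 / 3) * l2norm w) \<and>
    (\<forall>\<alpha>::real. \<bar>beta1 \<alpha>\<bar> \<ge> 1 \<longrightarrow>
        (\<exists>lam::real. \<exists>v\<in>D1. \<not> (AE r in lborel. 0 < r \<longrightarrow> v r = 0) \<and> orth_ground v \<and>
           l2norm (H1 \<alpha> lam v) \<le> C * \<bar>beta1 \<alpha>\<bar> powr (1 / 3) * l2norm v))"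
proof -
  obtain E where E: "0 \<le> E" "\<And>x. \<bar>deriv (deriv eta) x\<bar> \<le> E" by (rule eta_deriv2_bounded) (rule that)
  define Cq where "Cq = quasimode.Cq E"
  define C where "C = max 2600 Cq"
  show ?thesis
  proof (rule exI[of _ C], intro conjI allI ballI impI)
    show "C > 0" unfolding C_def by simp
    fix \<alpha> lam :: real and w assume w: "w \<in> D1" "orth_ground w"
    have "inverse C \<le> inverse 2600" unfolding C_def by (intro le_imp_inverse_le) auto
    then have "inverse C * \<bar>beta1 \<alpha>\<bar> powr (1 / 3) * l2norm w \<le> inverse 2600 * \<bar>beta1 \<alpha>\<bar> powr (1 / 3) * l2norm w"
      using L2_norm_sq(2) by (intro mult_right_mono) auto
    also have "\<dots> \<le> l2norm (H1 \<alpha> lam w)" by (rule pseudospectral_lower_bound[OF w])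
    finally show "inverse C * \<bar>beta1 \<alpha>\<bar> powr (1 / 3) * l2norm w \<le> l2norm (H1 \<alpha> lam w)" .
  next
    fix \<alpha> :: real assume a: "1 \<le> \<bar>beta1 \<alpha>\<bar>"
    define b where "b = \<bar>beta1 \<alpha>\<bar> powr (1 / 6)"
    have b1: "1 \<le> b" unfolding b_def using a by (simp add: ge_one_powr_ge_zero)
    have b2: "b\<^sup>2 = \<bar>beta1 \<alpha>\<bar> powr (1 / 3)" and b6: "\<bar>beta1 \<alpha>\<bar> = b ^ 6"
    proof -
      have "b ^ n = \<bar>beta1 \<alpha>\<bar> powr (1 / 6 * real n)" for n
        unfolding b_def powr_powr[symmetric] using a by (subst powr_realpow) auto
      from this[of 2] this[of 6] show "b\<^sup>2 = \<bar>beta1 \<alpha>\<bar> powr (1 / 3)" "\<bar>beta1 \<alpha>\<bar> = b ^ 6" using a by simp_all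
    qed
    interpret Q: quasimode b E by unfold_locales (use b1 E in auto)
    have "l2norm (H1 \<alpha> (beta1 \<alpha> * sigma b) Q.v) \<le> Cq * b\<^sup>2 * l2norm Q.v"
      unfolding Cq_def by (rule Q.quasimode_upper_bound[OF b6])
    also have "\<dots> \<le> C * b\<^sup>2 * l2norm Q.v"
      unfolding C_def using L2_norm_sq(2) by (intro mult_right_mono) auto
    finally show "\<exists>lam. \<exists>v\<in>D1. \<not> (AE r in lborel. 0 < r \<longrightarrow> v r = 0) \<and> orth_ground v \<and>
           l2norm (H1 \<alpha> lam v) \<le> C * \<bar>beta1 \<alpha>\<bar> powr (1 / 3) * l2norm v"
      unfolding b2 by (intro exI[of _ "beta1 \<alpha> * sigma b"] bexI[OF _ Q.v_D1] conjI Q.v_nonzero Q.v_orth)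
  qed
qed

end
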